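(* Let $\Pi_{\mathcal G}:L^\infty(\mathcal F)\to L^\infty(\mathcal G)$ be a mapping. The following statements are equivalent: (i) $\Pi_{\mathcal G}$ is a coherent, market-consistent $\mathcal G$-conditional evaluation which satisfies the market local property. (ii) There exists an $\mathcal F^S$-conditional coherent evaluation $\Pi_{\mathcal F^S}:L^\infty(\mathcal F)\to L^\infty(\mathcal F^S)$ such that $$\Pi_{\mathcal G}(H)=\mathbb E^{\mathbb Q_{\mathcal G}}[\Pi_{\mathcal F^S}(H)]\quad\text{for all }H\in L^\infty(\mathcal F).$$ Furthermore, $\Pi_{\mathcal F^S}(H)=\operatorname{ess\,sup}_{Z\in M'}\mathbb E[ZH\mid\mathcal F^S]$ for all $H\in L^\infty(\mathcal F)$, where $$M':=\Big(\frac{d\mathbb Q_{\mathcal G}}{d\mathbb P_{\mathcal G}}\Big)^{-1}M\ \subset\ \mathcal Q_{\mathcal F^S}=\{Z\in L^1(\mathcal F):\mathbb E[Z\mid\mathcal F^S]=1\}$$ and $M\subset\mathcal Q_{\mathcal G}$ is the closed convex set representing the coherent evaluation $\Pi_{\mathcal G}$, i.e. $\Pi_{\mathcal G}(H)=\operatorname{ess\,sup}_{\xi\in M}\mathbb E[\xi H\mid\mathcal G]$ for all $H\in L^\infty(\mathcal F)$.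
   Context: Setting. $(\Omega,\mathcal F,\mathbb P)$ is a probability space, $\mathcal G\subset\mathcal F$ a $\sigma$-algebra (initial information), $S=(S^1,\dots,S^n)$ the price process of $n$ traded stocks, $\bar{\mathcal F}^S\subset\mathcal F$ the $\sigma$-algebra generated by $S$, and $\mathcal F^S:=\bar{\mathcal F}^S\vee\mathcal G$. (In)equalities between random variables are $\mathbb P$-a.s. $L^\infty(\mathcal A)$ denotes bounded $\mathcal A$-measurable random variables, $L^\infty_+(\mathcal A)$ the nonnegative ones, $L^1(\mathcal A)$ the integrable ones. For a $\sigma$-algebra $\mathcal A\subset\mathcal F$, $\mathcal Q_{\mathcal A}=\{\xi\in L^1(\mathcal F):\mathbb E[\xi\mid\mathcal A]=1\}$ and $\mathcal Q^+_{\mathcal A}$ is the set of its nonnegative elements; an element of $\mathcal Q^+_{\mathcal A}$ is identified with the conditional probability measure having it as conditional density. Financial market. The market given by $S$ is arbitrage free and complete conditional on $\mathcal G$: every payoff in $L^\infty(\mathcal F^S)$ is replicable and there is a unique $\mathbb Q_{\mathcal G}\in\mathcal Q^+_{\mathcal G}$ with $\mathcal F^S$-measurable conditional density $\frac{d\mathbb Q_{\mathcal G}}{d\mathbb P_{\mathcal G}}$ under which $S$ is a martingale; this density is strictly positive a.s. Write $\mathbb E^{\mathbb Q_{\mathcal G}}[X]:=\mathbb E\big[\frac{d\mathbb Q_{\mathcal G}}{d\mathbb P_{\mathcal G}}X\mid\mathcal G\big]$. Evaluations. For a $\sigma$-algebra $\mathcal A\subset\mathcal F$, an $\mathcal A$-conditional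 evaluation is a map $\Pi:L^\infty(\mathcal F)\to L^\infty(\mathcal A)$ with: - Normalization: $\Pi(0)=0$. - $\mathcal A$-cash invariance: $\Pi(H+m)=\Pi(H)+m$ for $m\in L^\infty(\mathcal A)$. - $\mathcal A$-convexity: $\Pi(\lambda H_1+(1-\lambda)H_2)\le\lambda\Pi(H_1)+(1-\lambda)\Pi(H_2)$ for $\lambda\in L^\infty(\mathcal A)$, $0\le\lambda\le1$. - $\mathcal A$-local property: $\Pi(I_AH_1+I_{A^c}H_2)=I_A\Pi(H_1)+I_{A^c}\Pi(H_2)$ for $A\in\mathcal A$. - Fatou property: $\Pi(H)\le\liminf_n\Pi(H_n)$ for every bounded sequence $(H_n)$ converging a.s. to $H$. (Monotonicity is not required.) It is coherent if in addition $\Pi(\lambda H)=\lambda\Pi(H)$ for all $\lambda\in L^\infty_+(\mathcal A)$. A $\mathcal G$-conditional evaluation $\Pi_{\mathcal G}$ is market-consistent if $\Pi_{\mathcal G}(H^S+H)=\mathbb E^{\mathbb Q_{\mathcal G}}[H^S]+\Pi_{\mathcal G}(H)$ for all $H^S\in L^\infty(\mathcal F^S)$, $H\in L^\infty(\mathcal F)$. It satisfies the market local property if $\Pi_{\mathcal G}(H)=\Pi_{\mathcal G}(I_AH)+\Pi_{\mathcal G}(I_{A^c}H)$ for all $A\in\mathcal F^S$ and $H\in L^\infty_+(\mathcal F)$. Dual set of a coherent evaluation. By standard duality a coherent $\Pi_{\mathcal G}$ satisfies $\Pi_{\mathcal G}(H)=\operatorname{ess\,sup}_{\xi\in M}\mathbb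 E[\xi H\mid\mathcal G]$ for a closed convex $M\subset\mathcal Q_{\mathcal G}$, namely $M=\{\xi\in\mathcal Q_{\mathcal G}:\mathbb E[\xi H\mid\mathcal G]\le\Pi_{\mathcal G}(H)\ \forall H\in L^\infty(\mathcal F)\}$, the set on which the conjugate $\Pi_{\mathcal G}^*(\xi)=\operatorname{ess\,sup}_{H\in L^\infty(\mathcal F)}\{\mathbb E[\xi H\mid\mathcal G]-\Pi_{\mathcal G}(H)\}$ vanishes.
   Formalization: (i)⇒(ii) fails as stated: without monotonicity Π_{F^S} may be unbounded. Proved: (i) plus Π_G(H)≤K·E^Q[X] whenever |H|≤X∈L^∞(F^S) iff (ii); (i) alone iff (ii) with Q-integrable Π_{F^S}(H); M'⊂Q_{F^S} if Π_{F^S} is L^∞-valued. *)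

theory Defs
  imports "HOL-Probability.Probability"
begin

(* Random variables are represented by functions, and L^infty by its representatives; all
   equalities and inequalities below are therefore stated almost everywhere.  The measure space
   M plays the role of (Omega, F, P); sub-sigma-algebras are measures A with "subalgebra M A". *)

definition Linfty :: "'a measure \<Rightarrow> 'a measure \<Rightarrow> ('a \<Rightarrow> real) set" where
  "Linfty M A = {f \<in> borel_measurable A. \<exists>c. AE \<omega> in M. \<bar>f \<omega>\<bar> \<le> c}"

(* The second conjunct says that Pi respects almost sure equality, i.e. acts on classes. *)
definition Linfty_map :: "'a measure \<Rightarrow> ('a \<Rightarrow> real) set \<Rightarrow> (('a \<Rightarrow> real) \<Rightarrow> ('a \<Rightarrow> real)) \<Rightarrow> bool" where
  "Linfty_map M K P \<longleftrightarrow>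
     (\<forall>H \<in> Linfty M M. P H \<in> K) \<and>
     (\<forall>H \<in> Linfty M M. \<forall>H' \<in> Linfty M M.
        (AE \<omega> in M. H \<omega> = H' \<omega>) \<longrightarrow> (AE \<omega> in M. P H \<omega> = P H' \<omega>))"

definition normalized :: "'a measure \<Rightarrow> (('a \<Rightarrow> real) \<Rightarrow> ('a \<Rightarrow> real)) \<Rightarrow> bool" where
  "normalized M P \<longleftrightarrow> (AE \<omega> in M. P (\<lambda>_. 0) \<omega> = 0)"

definition cash_invariant :: "'a measure \<Rightarrow> 'a measure \<Rightarrow> (('a \<Rightarrow> real) \<Rightarrow> ('a \<Rightarrow> real)) \<Rightarrow> bool" where
  "cash_invariant M A P \<longleftrightarrow>
     (\<forall>H \<in> Linfty M M. \<forall>m \<in> Linfty M A.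
        AE \<omega> in M. P (\<lambda>\<omega>. H \<omega> + m \<omega>) \<omega> = P H \<omega> + m \<omega>)"

definition cond_convex :: "'a measure \<Rightarrow> 'a measure \<Rightarrow> (('a \<Rightarrow> real) \<Rightarrow> ('a \<Rightarrow> real)) \<Rightarrow> bool" where
  "cond_convex M A P \<longleftrightarrow>
     (\<forall>H1 \<in> Linfty M M. \<forall>H2 \<in> Linfty M M. \<forall>l \<in> Linfty M A.
        (AE \<omega> in M. 0 \<le> l \<omega> \<and> l \<omega> \<le> 1) \<longrightarrow>
        (AE \<omega> in M. P (\<lambda>\<omega>. l \<omega> * H1 \<omega> + (1 - l \<omega>) * H2 \<omega>) \<omega>
                     \<le> l \<omega> * P H1 \<omega> + (1 - l \<omega>) * P H2 \<omega>))"

definition cond_local :: "'a measure \<Rightarrow> 'a measure \<Rightarrow> (('a \<Rightarrow> real) \<Rightarrow> ('a \<Rightarrow> real)) \<Rightarrow> bool" where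
  "cond_local M A P \<longleftrightarrow>
     (\<forall>H1 \<in> Linfty M M. \<forall>H2 \<in> Linfty M M. \<forall>B \<in> sets A.
        AE \<omega> in M. P (\<lambda>\<omega>. indicator B \<omega> * H1 \<omega> + indicator (space M - B) \<omega> * H2 \<omega>) \<omega>
                    = indicator B \<omega> * P H1 \<omega> + indicator (space M - B) \<omega> * P H2 \<omega>)"

(* The lower limit is taken in the extended reals: it may be infinite a priori. *)
definition fatou_property :: "'a measure \<Rightarrow> (('a \<Rightarrow> real) \<Rightarrow> ('a \<Rightarrow> real)) \<Rightarrow> bool" where
  "fatou_property M P \<longleftrightarrow>
     (\<forall>H \<in> Linfty M M. \<forall>Hs :: nat \<Rightarrow> 'a \<Rightarrow> real.
        (\<forall>n. Hs n \<in> borel_measurable M) \<longrightarrow>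
        (\<exists>c. \<forall>n. AE \<omega> in M. \<bar>Hs n \<omega>\<bar> \<le> c) \<longrightarrow>
        (AE \<omega> in M. (\<lambda>n. Hs n \<omega>) \<longlonglongrightarrow> H \<omega>) \<longrightarrow>
        (AE \<omega> in M. ereal (P H \<omega>) \<le> liminf (\<lambda>n. ereal (P (Hs n) \<omega>))))"

(* The codomain K is a parameter; an A-conditional evaluation in the usual sense has
   K = Linfty M A. *)
definition cond_evaluation ::
  "'a measure \<Rightarrow> 'a measure \<Rightarrow> ('a \<Rightarrow> real) set \<Rightarrow> (('a \<Rightarrow> real) \<Rightarrow> ('a \<Rightarrow> real)) \<Rightarrow> bool" where
  "cond_evaluation M A K P \<longleftrightarrow>
     Linfty_map M K P \<and> normalized M P \<and> cash_invariant M A P \<and> cond_convex M A P \<and>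
     cond_local M A P \<and> fatou_property M P"

definition coherent_evaluation ::
  "'a measure \<Rightarrow> 'a measure \<Rightarrow> ('a \<Rightarrow> real) set \<Rightarrow> (('a \<Rightarrow> real) \<Rightarrow> ('a \<Rightarrow> real)) \<Rightarrow> bool" where
  "coherent_evaluation M A K P \<longleftrightarrow>
     cond_evaluation M A K P \<and>
     (\<forall>H \<in> Linfty M M. \<forall>l \<in> Linfty M A. (AE \<omega> in M. 0 \<le> l \<omega>) \<longrightarrow>
        (AE \<omega> in M. P (\<lambda>\<omega>. l \<omega> * H \<omega>) \<omega> = l \<omega> * P H \<omega>))"

definition cond_densities :: "'a measure \<Rightarrow> 'a measure \<Rightarrow> ('a \<Rightarrow> real) set" where
  "cond_densities M A = {\<xi>. integrable M \<xi> \<and> (AE \<omega> in M. real_cond_exp M A \<xi> \<omega> = 1)}"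

definition pos_cond_densities :: "'a measure \<Rightarrow> 'a measure \<Rightarrow> ('a \<Rightarrow> real) set" where
  "pos_cond_densities M A = {\<xi> \<in> cond_densities M A. AE \<omega> in M. 0 \<le> \<xi> \<omega>}"

(* The information generated by the initial sigma-algebra G and the prices at the times in J.
   For the whole time set I this is F^S; for J = I Int {..t} it is the time-t information. *)
definition market_algebra ::
  "'a measure \<Rightarrow> 'a measure \<Rightarrow> (real \<Rightarrow> 'a \<Rightarrow> real ^ 'n) \<Rightarrow> real set \<Rightarrow> 'a measure" where
  "market_algebra M G S J =
     sigma (space M) (sets G \<union> {S t -` B \<inter> space M | t B. t \<in> J \<and> B \<in> sets borel})"

(* S is a martingale under the measure with density D; time set I may be discrete or continuous. *)
definition martingale_density ::
  "'a measure \<Rightarrow> 'a measure \<Rightarrow> real set \<Rightarrow> (real \<Rightarrow> 'a \<Rightarrow> real ^ 'n) \<Rightarrow> ('a \<Rightarrow> real) \<Rightarrow> bool" where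
  "martingale_density M G I S D \<longleftrightarrow>
     D \<in> pos_cond_densities M G \<and> D \<in> borel_measurable (market_algebra M G S I) \<and>
     (\<forall>t \<in> I. \<forall>i. integrable (density M (\<lambda>\<omega>. ennreal (D \<omega>))) (\<lambda>\<omega>. S t \<omega> $ i)) \<and>
     (\<forall>s \<in> I. \<forall>t \<in> I. \<forall>i. s \<le> t \<longrightarrow>
        (AE \<omega> in density M (\<lambda>\<omega>. ennreal (D \<omega>)).
           real_cond_exp (density M (\<lambda>\<omega>. ennreal (D \<omega>))) (market_algebra M G S (I \<inter> {..s})) (\<lambda>\<omega>. S t \<omega> $ i) \<omega>
           = S s \<omega> $ i))"

(* Terminal gains of bounded self-financing strategies rebalanced at finitely many times. *)
definition simple_gains ::
  "'a measure \<Rightarrow> 'a measure \<Rightarrow> real set \<Rightarrow> (real \<Rightarrow> 'a \<Rightarrow> real ^ 'n) \<Rightarrow> ('a \<Rightarrow> real) set" where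
  "simple_gains M G I S =
     {\<lambda>\<omega>. \<Sum>j<m. \<theta> j \<omega> \<bullet> (S (\<tau> (Suc j)) \<omega> - S (\<tau> j) \<omega>)
      | (m :: nat) (\<tau> :: nat \<Rightarrow> real) (\<theta> :: nat \<Rightarrow> 'a \<Rightarrow> real ^ 'n).
        (\<forall>j\<le>m. \<tau> j \<in> I) \<and>
        (\<forall>j<m. \<tau> j \<le> \<tau> (Suc j) \<and>
               \<theta> j \<in> borel_measurable (market_algebra M G S (I \<inter> {..\<tau> j})) \<and>
               (\<exists>c. \<forall>\<omega> \<in> space M. norm (\<theta> j \<omega>) \<le> c))}"

(* Replication from a G-measurable initial capital x.  Limits in L^1 of the martingale measure are
   allowed, so that in continuous time stochastic integrals count as gains; a bounded payoff that
   is a stochastic integral with martingale gains process is such a limit. *)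
definition replicable ::
  "'a measure \<Rightarrow> 'a measure \<Rightarrow> real set \<Rightarrow> (real \<Rightarrow> 'a \<Rightarrow> real ^ 'n) \<Rightarrow> ('a \<Rightarrow> real) \<Rightarrow>
   ('a \<Rightarrow> real) \<Rightarrow> bool" where
  "replicable M G I S D H \<longleftrightarrow>
     (\<exists>x \<in> Linfty M G. \<exists>g :: nat \<Rightarrow> 'a \<Rightarrow> real.
        (\<forall>k. g k \<in> simple_gains M G I S) \<and>
        (\<lambda>k. \<integral>\<^sup>+ \<omega>. ennreal \<bar>H \<omega> - x \<omega> - g k \<omega>\<bar> \<partial>density M (\<lambda>\<omega>. ennreal (D \<omega>))) \<longlonglongrightarrow> 0)"

definition complete_market ::
  "'a measure \<Rightarrow> 'a measure \<Rightarrow> real set \<Rightarrow> (real \<Rightarrow> 'a \<Rightarrow> real ^ 'n) \<Rightarrow> ('a \<Rightarrow> real) \<Rightarrow> bool" where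
  "complete_market M G I S D \<longleftrightarrow>
     (\<forall>t \<in> I. S t \<in> borel_measurable M) \<and>
     martingale_density M G I S D \<and> (AE \<omega> in M. 0 < D \<omega>) \<and>
     (\<forall>D'. martingale_density M G I S D' \<longrightarrow> (AE \<omega> in M. D' \<omega> = D \<omega>)) \<and>
     (\<forall>H \<in> Linfty M (market_algebra M G S I). replicable M G I S D H)"

definition cond_exp_Q :: "'a measure \<Rightarrow> 'a measure \<Rightarrow> ('a \<Rightarrow> real) \<Rightarrow> ('a \<Rightarrow> real) \<Rightarrow> ('a \<Rightarrow> real)" where
  "cond_exp_Q M G D X = real_cond_exp M G (\<lambda>\<omega>. D \<omega> * X \<omega>)"

(* In the next three definitions FS is the sigma-algebra of the market. *)
definition market_consistent ::
  "'a measure \<Rightarrow> 'a measure \<Rightarrow> 'a measure \<Rightarrow> ('a \<Rightarrow> real) \<Rightarrow> (('a \<Rightarrow> real) \<Rightarrow> ('a \<Rightarrow> real)) \<Rightarrow> bool" where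
  "market_consistent M G FS D P \<longleftrightarrow>
     (\<forall>X \<in> Linfty M FS. \<forall>H \<in> Linfty M M.
        AE \<omega> in M. P (\<lambda>\<omega>. X \<omega> + H \<omega>) \<omega> = cond_exp_Q M G D X \<omega> + P H \<omega>)"

definition market_local :: "'a measure \<Rightarrow> 'a measure \<Rightarrow> (('a \<Rightarrow> real) \<Rightarrow> ('a \<Rightarrow> real)) \<Rightarrow> bool" where
  "market_local M FS P \<longleftrightarrow>
     (\<forall>A \<in> sets FS. \<forall>H \<in> Linfty M M. (AE \<omega> in M. 0 \<le> H \<omega>) \<longrightarrow>
        (AE \<omega> in M. P H \<omega> = P (\<lambda>\<omega>. indicator A \<omega> * H \<omega>) \<omega>
                          + P (\<lambda>\<omega>. indicator (space M - A) \<omega> * H \<omega>) \<omega>))"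

(* A payoff dominated by a hedgeable payoff X is valued at no more than K times the price of X.
   Monotone market-consistent evaluations satisfy this with K = 1.  Without monotonicity it is
   exactly what makes the F^S-conditional evaluation below take bounded values. *)
definition market_bounded ::
  "'a measure \<Rightarrow> 'a measure \<Rightarrow> 'a measure \<Rightarrow> ('a \<Rightarrow> real) \<Rightarrow> (('a \<Rightarrow> real) \<Rightarrow> ('a \<Rightarrow> real)) \<Rightarrow> bool" where
  "market_bounded M G FS D P \<longleftrightarrow>
     (\<exists>K. \<forall>X \<in> Linfty M FS. \<forall>H \<in> Linfty M M. (AE \<omega> in M. \<bar>H \<omega>\<bar> \<le> X \<omega>) \<longrightarrow>
        (AE \<omega> in M. P H \<omega> \<le> K * cond_exp_Q M G D X \<omega>))"

(* The A-measurable random variables that are integrable under the measure with density D. *)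
definition L1_density :: "'a measure \<Rightarrow> 'a measure \<Rightarrow> ('a \<Rightarrow> real) \<Rightarrow> ('a \<Rightarrow> real) set" where
  "L1_density M A D = {Y \<in> borel_measurable A. integrable M (\<lambda>\<omega>. D \<omega> * Y \<omega>)}"

definition is_ess_sup :: "'a measure \<Rightarrow> ('a \<Rightarrow> real) set \<Rightarrow> ('a \<Rightarrow> real) \<Rightarrow> bool" where
  "is_ess_sup M X Y \<longleftrightarrow>
     Y \<in> borel_measurable M \<and> (\<forall>f \<in> X. AE \<omega> in M. f \<omega> \<le> Y \<omega>) \<and>
     (\<forall>U \<in> borel_measurable M. (\<forall>f \<in> X. AE \<omega> in M. f \<omega> \<le> U \<omega>) \<longrightarrow> (AE \<omega> in M. Y \<omega> \<le> U \<omega>))"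

definition represented_by ::
  "'a measure \<Rightarrow> 'a measure \<Rightarrow> ('a \<Rightarrow> real) set \<Rightarrow> (('a \<Rightarrow> real) \<Rightarrow> ('a \<Rightarrow> real)) \<Rightarrow> bool" where
  "represented_by M A N P \<longleftrightarrow>
     (\<forall>H \<in> Linfty M M. is_ess_sup M ((\<lambda>\<xi>. real_cond_exp M A (\<lambda>\<omega>. \<xi> \<omega> * H \<omega>)) ` N) (P H))"

definition dual_set :: "'a measure \<Rightarrow> 'a measure \<Rightarrow> (('a \<Rightarrow> real) \<Rightarrow> ('a \<Rightarrow> real)) \<Rightarrow> ('a \<Rightarrow> real) set" where
  "dual_set M G P =
     {\<xi> \<in> cond_densities M G. \<forall>H \<in> Linfty M M.
        AE \<omega> in M. real_cond_exp M G (\<lambda>\<omega>. \<xi> \<omega> * H \<omega>) \<omega> \<le> P H \<omega>}"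

definition L1_closed_convex :: "'a measure \<Rightarrow> ('a \<Rightarrow> real) set \<Rightarrow> bool" where
  "L1_closed_convex M N \<longleftrightarrow>
     (\<forall>\<xi> \<in> N. \<forall>\<eta> \<in> N. \<forall>u. 0 \<le> u \<and> u \<le> 1 \<longrightarrow> (\<lambda>\<omega>. u * \<xi> \<omega> + (1 - u) * \<eta> \<omega>) \<in> N) \<and>
     (\<forall>\<xi> (\<xi>s :: nat \<Rightarrow> 'a \<Rightarrow> real). (\<forall>n. \<xi>s n \<in> N) \<longrightarrow> integrable M \<xi> \<longrightarrow>
        (\<lambda>n. \<integral>\<omega>. \<bar>\<xi>s n \<omega> - \<xi> \<omega>\<bar> \<partial>M) \<longlonglongrightarrow> 0 \<longrightarrow> \<xi> \<in> N)"

definition rescaled_dual_set ::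
  "'a measure \<Rightarrow> 'a measure \<Rightarrow> ('a \<Rightarrow> real) \<Rightarrow> (('a \<Rightarrow> real) \<Rightarrow> ('a \<Rightarrow> real)) \<Rightarrow> ('a \<Rightarrow> real) set" where
  "rescaled_dual_set M G D P = (\<lambda>\<xi> \<omega>. inverse (D \<omega>) * \<xi> \<omega>) ` dual_set M G P"

end

theory Submission
  imports Defs
begin

text \<open>
  Conditionally on the market, \<open>PF H\<close> has to be the essential supremum of \<open>E[\<xi> H | FS] / D\<close> over the
  dual set of \<open>PG\<close>.  The market local property makes that set stable under pasting along events of
  \<open>FS\<close>, so the family is upward directed and the supremum commutes with \<open>E[. | G]\<close>; market-consistency
  gives \<open>E[\<xi> | FS] = D\<close>.

  What remains is to represent a coherent evaluation, without monotonicity, by integrable densities.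
  A Baire argument with the Fatou property shows that the values on the unit ball of \<open>L\<^sup>\<infinity>\<close> are almost
  surely bounded along sequences, so that a single payoff nearly attains them; hence
  \<open>\<phi> H = E[D P H]\<close> is finite and lower semicontinuous for bounded almost sure convergence.  The cone
  \<open>{\<phi> \<le> 0}\<close> is separated from an outside point \<open>H0\<close> by a variational argument in place of the
  Krein--Smulian theorem: one builds a strongly convex \<open>\<Psi>\<close>, growing as fast as necessary, with
  \<open>E[\<Psi>(X)] > 1\<close> for all bounded \<open>X \<in> H0 - C\<close>.  If \<open>f\<^sub>n\<close> minimizes \<open>E[\<Psi>]\<close> over the elements bounded by
  \<open>n\<close>, the first-order conditions bound \<open>E[\<Psi>'(f\<^sub>n) f\<^sub>n]\<close>, so the \<open>\<Psi>'(f\<^sub>n)\<close> are uniformly integrable and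
  their limit is the separating density.
\<close>

section \<open>Bounded random variables\<close>

text \<open>Without monotonicity, a bound \<open>c\<close> on a payoff does not bound its value by
  \<open>c\<close>, so the supremum divided by \<open>D\<close> is only known to be integrable
  against \<open>D\<close>. The construction therefore lives in \<open>L1_density\<close>, and
  bounded values are recovered afterwards from \<open>market_bounded\<close>. For the same reason
  densities are kept in the form \<open>\<xi>\<close> with \<open>E[\<xi> | FS] = D\<close>: the
  quotient \<open>\<xi> / D\<close> may fail to be integrable.

  The expectations of \<open>PG H\<close> and \<open>D * PF H\<close> agree, and \<open>H\<close>
  may be replaced in both by its product with an indicator from \<open>FS\<close>. Hence
  \<open>PG\<close> and \<open>PF\<close> have the same dual densities, and one duality theorem,
  with the weight as a parameter, serves both.

  The separation has to cope with closedness that is available only along uniformly bounded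
  sequences. A minimizing sequence over the whole set may leave every ball, which is why the
  potential is built, and later minimized, one ball at a time. What survives the passage from ball
  to ball is not membership of the limit but the pairing of the gradient with bounded
  payoffs.\<close>

lemma LinftyI: "f \<in> borel_measurable A \<Longrightarrow> AE w in M. \<bar>f w\<bar> \<le> c \<Longrightarrow> f \<in> Linfty M A"
  by (auto simp: Linfty_def)

text \<open>The free \<open>k\<close> lets a caller ask for a bound that is nonnegative, at least 1,
  or above another bound already chosen.\<close>

lemma Linfty_boundE:
  assumes "f \<in> Linfty M A"
  obtains c where "k \<le> c" "AE w in M. \<bar>f w\<bar> \<le> c"
proof -
  obtain c where "AE w in M. \<bar>f w\<bar> \<le> c" using assms by (auto simp: Linfty_def)
  then have "AE w in M. \<bar>f w\<bar> \<le> max k c" by eventually_elim simp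
  then show thesis using that[of "max k c"] by simp
qed

lemma Linfty_subalgebra:
  assumes "subalgebra M A"
  shows "Linfty M A \<subseteq> Linfty M M"
  using measurable_from_subalg[OF assms] by (auto simp: Linfty_def)

lemma Linfty_const: "(\<lambda>_. c) \<in> Linfty M A"
  by (auto simp: Linfty_def)

lemma Linfty_indicator: "B \<in> sets A \<Longrightarrow> (indicator B :: 'a \<Rightarrow> real) \<in> Linfty M A"
  by (auto simp: Linfty_def intro!: exI[of _ 1] AE_I2 split: split_indicator)

lemma Linfty_add:
  assumes "f \<in> Linfty M A" "g \<in> Linfty M A"
  shows "(\<lambda>w. f w + g w) \<in> Linfty M A"
proof -
  obtain a b where "AE w in M. \<bar>f w\<bar> \<le> a" "AE w in M. \<bar>g w\<bar> \<le> b"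
    using assms by (auto simp: Linfty_def)
  then have "AE w in M. \<bar>f w + g w\<bar> \<le> a + b" by eventually_elim linarith
  then show ?thesis using assms by (auto simp: Linfty_def)
qed

lemma Linfty_mult:
  assumes "f \<in> Linfty M A" "g \<in> Linfty M A"
  shows "(\<lambda>w. f w * g w) \<in> Linfty M A"
proof -
  obtain a b where "AE w in M. \<bar>f w\<bar> \<le> a" "AE w in M. \<bar>g w\<bar> \<le> b"
    using assms by (auto simp: Linfty_def)
  then have "AE w in M. \<bar>f w * g w\<bar> \<le> a * b"
    by eventually_elim (auto simp: abs_mult intro!: mult_mono)
  then show ?thesis using assms by (auto simp: Linfty_def)
qed

lemma Linfty_cmult: "f \<in> Linfty M A \<Longrightarrow> (\<lambda>w. c * f w) \<in> Linfty M A" for c :: real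
  using Linfty_mult[OF Linfty_const] .

lemma Linfty_minus: "f \<in> Linfty M A \<Longrightarrow> (\<lambda>w. - f w) \<in> Linfty M A"
  using Linfty_cmult[of f M A "-1"] by simp

lemma Linfty_diff: "f \<in> Linfty M A \<Longrightarrow> g \<in> Linfty M A \<Longrightarrow> (\<lambda>w. f w - g w) \<in> Linfty M A"
  using Linfty_add[OF _ Linfty_minus] by fastforce

lemmas Linfty_intros = Linfty_const Linfty_indicator Linfty_add Linfty_mult Linfty_minus Linfty_diff

lemma integrable_Linfty_mult:
  assumes f: "integrable M f" and h: "h \<in> Linfty M M"
  shows "integrable M (\<lambda>w. f w * h w)"
proof -
  have [measurable]: "h \<in> borel_measurable M" "f \<in> borel_measurable M" using f h by (auto simp: Linfty_def)
  obtain c where "AE w in M. \<bar>h w\<bar> \<le> c" using h by (auto simp: Linfty_def)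
  then have "AE w in M. norm (f w * h w) \<le> norm (c * f w)"
  proof eventually_elim
    case (elim w)
    then have "\<bar>f w\<bar> * \<bar>h w\<bar> \<le> \<bar>f w\<bar> * \<bar>c\<bar>" by (intro mult_left_mono) auto
    then show ?case by (simp add: abs_mult mult.commute)
  qed
  then show ?thesis
    by (rule Bochner_Integration.integrable_bound[OF integrable_mult_right[OF f], rotated]) measurable
qed

section \<open>Separation from closed convex cones of bounded random variables\<close>

text \<open>No derivative appears: the last inequality makes \<open>\<psi>\<close> a subgradient of
  \<open>\<Psi>\<close> with a quadratic gain, and the later estimates come from that one
  inequality. It concerns only pairs of points, which is what allows pieces to be glued.\<close>

definition strongly_convex_potential :: "(real \<Rightarrow> real) \<Rightarrow> (real \<Rightarrow> real) \<Rightarrow> bool" where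
  "strongly_convex_potential \<Psi> \<psi> \<longleftrightarrow>
     continuous_on UNIV \<Psi> \<and> continuous_on UNIV \<psi> \<and> \<Psi> 0 = 0 \<and> (\<forall>x. 0 \<le> \<Psi> x) \<and>
     (\<forall>x y. \<Psi> x + \<psi> x * (y - x) + (y - x)\<^sup>2 \<le> \<Psi> y)"

text \<open>Both end points are compared with the subgradient at the midpoint, where the two linear
  terms cancel. The result plays the part of the parallelogram law: it makes minimizing sequences
  Cauchy in L2.\<close>

lemma strongly_convex_potential_midpoint:
  assumes "strongly_convex_potential \<Psi> \<psi>"
  shows "(x - y)\<^sup>2 / 2 \<le> \<Psi> x + \<Psi> y - 2 * \<Psi> ((x + y) / 2)"
proof -
  let ?m = "(x + y) / 2"
  have "\<Psi> ?m + \<psi> ?m * (x - ?m) + (x - ?m)\<^sup>2 \<le> \<Psi> x" "\<Psi> ?m + \<psi> ?m * (y - ?m) + (y - ?m)\<^sup>2 \<le> \<Psi> y"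
    using assms by (auto simp: strongly_convex_potential_def)
  moreover have "(x - ?m)\<^sup>2 + (y - ?m)\<^sup>2 = (x - y)\<^sup>2 / 2"
    by (simp add: power2_eq_square field_simps)
  moreover have "\<psi> ?m * (x - ?m) + \<psi> ?m * (y - ?m) = 0"
    by (simp add: field_simps)
  ultimately show ?thesis by linarith
qed

text \<open>Both facts are the subgradient inequality at \<open>y = 0\<close>. The sign lets
  \<open>\<psi> x * x\<close> serve as a nonnegative weight in the uniform integrability
  estimates.\<close>

lemma strongly_convex_potential_gradient:
  assumes "strongly_convex_potential \<Psi> \<psi>"
  shows "\<Psi> x \<le> \<psi> x * x" "0 \<le> \<psi> x * x"
proof -
  have "\<Psi> x + \<psi> x * (0 - x) + (0 - x)\<^sup>2 \<le> \<Psi> 0" "\<Psi> 0 = 0" "0 \<le> \<Psi> x"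
    using assms unfolding strongly_convex_potential_def by blast+
  then show "\<Psi> x \<le> \<psi> x * x" "0 \<le> \<psi> x * x"
    by (smt (verit) mult_minus_right zero_le_power2)+
qed

text \<open>For \<open>0 \<le> r\<close> this is the squared distance to the interval
  \<open>[-r, r]\<close>, and \<open>trunc_sq'\<close> is its derivative: a penalty that acts only
  outside the interval.\<close>

definition trunc_sq :: "real \<Rightarrow> real \<Rightarrow> real" where
  "trunc_sq r x = (max 0 (x - r))\<^sup>2 + (min 0 (x + r))\<^sup>2"

definition trunc_sq' :: "real \<Rightarrow> real \<Rightarrow> real" where
  "trunc_sq' r x = 2 * max 0 (x - r) + 2 * min 0 (x + r)"

lemma trunc_sq_gradient: "trunc_sq r x + trunc_sq' r x * (y - x) \<le> trunc_sq r y"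
proof -
  \<comment> \<open>Convexity of the square, with \<open>a\<close> and \<open>b\<close> the clipped
    values at \<open>x\<close> and \<open>y\<close>. The premise says that replacing
    \<open>y - x\<close> by \<open>b - a\<close> can only increase the linear term.\<close>
  have *: "a\<^sup>2 + 2 * a * (y - x) \<le> b\<^sup>2" if "a * (y - x) \<le> a * (b - a)" for a b :: real
  proof -
    have "b\<^sup>2 - (a\<^sup>2 + 2 * a * (b - a)) = (b - a)\<^sup>2"
      by (simp add: power2_eq_square algebra_simps)
    then show ?thesis
      using that zero_le_power2[of "b - a"] by linarith
  qed
  have "(max 0 (x - r))\<^sup>2 + 2 * max 0 (x - r) * (y - x) \<le> (max 0 (y - r))\<^sup>2"
    by (rule *) (auto simp: max_def intro!: mult_left_mono)
  moreover have "(min 0 (x + r))\<^sup>2 + 2 * min 0 (x + r) * (y - x) \<le> (min 0 (y + r))\<^sup>2"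
    by (rule *) (auto simp: min_def intro!: mult_left_mono_neg)
  ultimately show ?thesis
    by (simp add: trunc_sq_def trunc_sq'_def algebra_simps)
qed

lemma trunc_sq_eq_0: "\<bar>x\<bar> \<le> r \<Longrightarrow> trunc_sq r x = 0" "\<bar>x\<bar> \<le> r \<Longrightarrow> trunc_sq' r x = 0"
  by (auto simp: trunc_sq_def trunc_sq'_def)

lemma trunc_sq_eq_0_iff: "0 \<le> r \<Longrightarrow> trunc_sq r x = 0 \<longleftrightarrow> \<bar>x\<bar> \<le> r"
  by (auto simp: trunc_sq_def add_nonneg_eq_0_iff max_def min_def split: if_splits)

lemma trunc_sq_nonneg: "0 \<le> trunc_sq r x"
  by (simp add: trunc_sq_def)

lemma continuous_on_trunc_sq: "continuous_on UNIV (trunc_sq r)" "continuous_on UNIV (trunc_sq' r)"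
  unfolding trunc_sq_def trunc_sq'_def by (intro continuous_intros)+

lemma strongly_convex_potential_square: "strongly_convex_potential (\<lambda>x. x\<^sup>2) (\<lambda>x. 2 * x)"
  unfolding strongly_convex_potential_def
  by (auto intro!: continuous_intros simp: power2_eq_square algebra_simps)

lemma strongly_convex_potential_add_trunc_sq:
  assumes "strongly_convex_potential \<Psi> \<psi>" "0 \<le> a" "0 \<le> r"
  shows "strongly_convex_potential (\<lambda>x. \<Psi> x + a * trunc_sq r x) (\<lambda>x. \<psi> x + a * trunc_sq' r x)"
  unfolding strongly_convex_potential_def
proof (intro conjI allI)
  fix x y
  have "\<Psi> x + \<psi> x * (y - x) + (y - x)\<^sup>2 \<le> \<Psi> y"
    using assms(1) by (auto simp: strongly_convex_potential_def)
  moreover have "a * (trunc_sq r x + trunc_sq' r x * (y - x)) \<le> a * trunc_sq r y"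
    using trunc_sq_gradient assms(2) by (intro mult_left_mono) auto
  ultimately show "\<Psi> x + a * trunc_sq r x + (\<psi> x + a * trunc_sq' r x) * (y - x) + (y - x)\<^sup>2
      \<le> \<Psi> y + a * trunc_sq r y"
    by (simp add: algebra_simps)
qed (use assms in \<open>auto simp: strongly_convex_potential_def trunc_sq_nonneg trunc_sq_eq_0
      intro!: continuous_intros continuous_on_trunc_sq\<close>)

text \<open>Every condition on a potential involves at most two points or is local, so it can be
  checked on an interval where the glued function coincides with a single
  \<open>\<Psi> n\<close>.\<close>

lemma strongly_convex_potential_glue:
  fixes \<Psi> \<psi> :: "nat \<Rightarrow> real \<Rightarrow> real"
  assumes pot: "\<And>n. strongly_convex_potential (\<Psi> n) (\<psi> n)"
    and step: "\<And>n x. \<bar>x\<bar> \<le> real n \<Longrightarrow> \<Psi> (Suc n) x = \<Psi> n x \<and> \<psi> (Suc n) x = \<psi> n x"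
  obtains \<Phi> \<phi> where "strongly_convex_potential \<Phi> \<phi>" "\<And>n x. \<bar>x\<bar> \<le> real n \<Longrightarrow> \<Phi> x = \<Psi> n x"
proof -
  have eq: "\<Psi> m x = \<Psi> n x \<and> \<psi> m x = \<psi> n x" if "n \<le> m" "\<bar>x\<bar> \<le> real n" for m n x
    using that by (induction rule: dec_induct) (use step in auto)
  \<comment> \<open>The index is the least \<open>n\<close> with
    \<open>\<bar>x\<bar> \<le> real n\<close>; from that stage on the value at \<open>x\<close> no
    longer changes.\<close>
  define \<Phi> where "\<Phi> x = \<Psi> (nat \<lceil>\<bar>x\<bar>\<rceil>) x" for x
  define \<phi> where "\<phi> x = \<psi> (nat \<lceil>\<bar>x\<bar>\<rceil>) x" for x
  have agree: "\<Phi> x = \<Psi> n x \<and> \<phi> x = \<psi> n x" if "\<bar>x\<bar> \<le> real n" for n x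
  proof -
    have "nat \<lceil>\<bar>x\<bar>\<rceil> \<le> n"
      using that by (simp add: nat_le_iff ceiling_le_iff)
    moreover have "\<bar>x\<bar> \<le> real (nat \<lceil>\<bar>x\<bar>\<rceil>)"
      by (rule real_nat_ceiling_ge)
    ultimately show ?thesis
      using eq[of "nat \<lceil>\<bar>x\<bar>\<rceil>" n x] unfolding \<Phi>_def \<phi>_def by metis
  qed
  have cont: "continuous_on UNIV f" if "\<And>n x. \<bar>x\<bar> \<le> real n \<Longrightarrow> f x = g n x"
    "\<And>n. continuous_on UNIV (g n)" for f :: "real \<Rightarrow> real" and g :: "nat \<Rightarrow> real \<Rightarrow> real"
  proof -
    have "isCont f x" for x
    proof -
      obtain n where n: "\<bar>x\<bar> < real n" using reals_Archimedean2 by blast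
      have "eventually (\<lambda>y. \<bar>y\<bar> < real n) (nhds x)"
        using n by (intro order_tendstoD(2)[OF tendsto_rabs]) (auto simp: filterlim_ident)
      then have "eventually (\<lambda>y. f y = g n y) (nhds x)"
        by eventually_elim (use that(1) in auto)
      then show ?thesis
        using isCont_cong[of f "g n" x] that(2)[of n] by (simp add: continuous_on_eq_continuous_at)
    qed
    then show ?thesis by (simp add: continuous_on_eq_continuous_at)
  qed
  have "\<Phi> x + \<phi> x * (y - x) + (y - x)\<^sup>2 \<le> \<Phi> y" for x y
  proof -
    obtain n where n: "max \<bar>x\<bar> \<bar>y\<bar> \<le> real n" using real_arch_simple by blast
    then show ?thesis
      using pot[of n] agree[of x n] agree[of y n] by (simp add: strongly_convex_potential_def)
  qed
  moreover have "continuous_on UNIV \<Phi>" "continuous_on UNIV \<phi>"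
    using pot agree by (auto intro!: cont[of \<Phi> \<Psi>] cont[of \<phi> \<psi>] simp: strongly_convex_potential_def)
  moreover have "\<Phi> 0 = 0" "0 \<le> \<Phi> x" for x
    using pot by (auto simp: strongly_convex_potential_def \<Phi>_def)
  ultimately have "strongly_convex_potential \<Phi> \<phi>"
    by (simp add: strongly_convex_potential_def)
  then show thesis using agree that by blast
qed

text \<open>Closedness along uniformly bounded, almost surely convergent sequences is what the Fatou
  property delivers. Constant sequences show that such a set is also saturated under almost sure
  equality.\<close>

definition bounded_closed_convex :: "'a measure \<Rightarrow> ('a \<Rightarrow> real) set \<Rightarrow> bool" where
  "bounded_closed_convex M K \<longleftrightarrow>
     K \<subseteq> Linfty M M \<and>
     (\<forall>f\<in>K. \<forall>g\<in>K. \<forall>u. 0 \<le> u \<and> u \<le> 1 \<longrightarrow> (\<lambda>w. u * f w + (1 - u) * g w) \<in> K) \<and>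
     (\<forall>fs f c. (\<forall>n. fs n \<in> K) \<longrightarrow> (\<forall>n. AE w in M. \<bar>fs n w\<bar> \<le> c) \<longrightarrow>
        f \<in> borel_measurable M \<longrightarrow> (AE w in M. (\<lambda>n::nat. fs n w) \<longlonglongrightarrow> f w) \<longrightarrow> f \<in> K)"

lemma bounded_closed_convexD:
  assumes "bounded_closed_convex M K"
  shows "f \<in> K \<Longrightarrow> f \<in> Linfty M M"
    and "f \<in> K \<Longrightarrow> g \<in> K \<Longrightarrow> 0 \<le> u \<Longrightarrow> u \<le> 1 \<Longrightarrow> (\<lambda>w. u * f w + (1 - u) * g w) \<in> K"
    and "(\<And>n. fs n \<in> K) \<Longrightarrow> (\<And>n. AE w in M. \<bar>fs n w\<bar> \<le> c) \<Longrightarrow> f \<in> borel_measurable M \<Longrightarrow>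
      (AE w in M. (\<lambda>n::nat. fs n w) \<longlonglongrightarrow> f w) \<Longrightarrow> f \<in> K"
proof -
  show "f \<in> Linfty M M" if "f \<in> K" using that assms by (auto simp: bounded_closed_convex_def)
  show "(\<lambda>w. u * f w + (1 - u) * g w) \<in> K" if "f \<in> K" "g \<in> K" "0 \<le> u" "u \<le> 1"
    using that assms by (simp add: bounded_closed_convex_def)
  show "f \<in> K" if "\<And>n. fs n \<in> K" "\<And>n. AE w in M. \<bar>fs n w\<bar> \<le> c" "f \<in> borel_measurable M"
    "AE w in M. (\<lambda>n::nat. fs n w) \<longlonglongrightarrow> f w"
    by (rule assms[unfolded bounded_closed_convex_def, THEN conjunct2, THEN conjunct2, rule_format, of fs c f])
      (use that in auto)
qed

lemma AE_bounded_limit: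
  fixes fs :: "nat \<Rightarrow> 'a \<Rightarrow> real"
  assumes "\<And>n. AE w in M. \<bar>fs n w\<bar> \<le> c" "AE w in M. (\<lambda>n. fs n w) \<longlonglongrightarrow> f w"
  shows "AE w in M. \<bar>f w\<bar> \<le> c"
proof -
  have "AE w in M. \<forall>n. \<bar>fs n w\<bar> \<le> c" using assms(1) by (simp add: AE_all_countable)
  with assms(2) show ?thesis
  proof eventually_elim
    case (elim w)
    then have "(\<lambda>n. \<bar>fs n w\<bar>) \<longlonglongrightarrow> \<bar>f w\<bar>" by (intro tendsto_rabs)
    then show ?case using elim by (intro LIMSEQ_le_const2) auto
  qed
qed

text \<open>Inside one ball the uniform bound in the closure condition is automatic, so almost sure
  limits of minimizing sequences stay in the set.\<close>

lemma bounded_closed_convex_cut: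
  assumes "bounded_closed_convex M K"
  shows "bounded_closed_convex M {f\<in>K. AE w in M. \<bar>f w\<bar> \<le> c}"
  unfolding bounded_closed_convex_def
proof (intro conjI ballI allI impI)
  fix f g and u :: real
  assume fg: "f \<in> {f\<in>K. AE w in M. \<bar>f w\<bar> \<le> c}" "g \<in> {f\<in>K. AE w in M. \<bar>f w\<bar> \<le> c}"
    and u: "0 \<le> u \<and> u \<le> 1"
  have "AE w in M. \<bar>f w\<bar> \<le> c" "AE w in M. \<bar>g w\<bar> \<le> c" using fg by auto
  then have "AE w in M. \<bar>u * f w + (1 - u) * g w\<bar> \<le> c"
  proof eventually_elim
    case (elim w)
    have "\<bar>u * f w + (1 - u) * g w\<bar> \<le> u * \<bar>f w\<bar> + (1 - u) * \<bar>g w\<bar>"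
      using u by (simp add: abs_mult order_trans[OF abs_triangle_ineq])
    also have "\<dots> \<le> u * c + (1 - u) * c" using u elim by (intro add_mono mult_left_mono) auto
    finally show ?case by (simp add: algebra_simps)
  qed
  then show "(\<lambda>w. u * f w + (1 - u) * g w) \<in> {f\<in>K. AE w in M. \<bar>f w\<bar> \<le> c}"
    using bounded_closed_convexD(2)[OF assms, of f g u] fg u by simp
next
  fix fs :: "nat \<Rightarrow> 'a \<Rightarrow> real" and f c'
  assume *: "\<forall>n. fs n \<in> {f\<in>K. AE w in M. \<bar>f w\<bar> \<le> c}" "\<forall>n. AE w in M. \<bar>fs n w\<bar> \<le> c'"
    "f \<in> borel_measurable M" "AE w in M. (\<lambda>n. fs n w) \<longlonglongrightarrow> f w"
  then have "f \<in> K" by - (rule bounded_closed_convexD(3)[OF assms, of fs c'], auto)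
  moreover have "AE w in M. \<bar>f w\<bar> \<le> c" using * by - (rule AE_bounded_limit[where fs=fs], auto)
  ultimately show "f \<in> {f\<in>K. AE w in M. \<bar>f w\<bar> \<le> c}" by simp
qed (use bounded_closed_convexD(1)[OF assms] in auto)

lemma continuous_bounded_on_interval:
  fixes g :: "real \<Rightarrow> real"
  assumes "continuous_on UNIV g"
  obtains B where "0 \<le> B" "\<And>x. \<bar>x\<bar> \<le> c \<Longrightarrow> \<bar>g x\<bar> \<le> B"
proof -
  have "compact (g ` {-c..c})"
    using assms by (intro compact_continuous_image) (auto intro: continuous_on_subset)
  then obtain B where "\<forall>y\<in>g ` {-c..c}. norm y \<le> B" using compact_imp_bounded bounded_iff by metis
  then have "\<bar>g x\<bar> \<le> max 0 B" if "\<bar>x\<bar> \<le> c" for x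
    using that by (force simp: abs_le_iff max_def)
  then show thesis using that[of "max 0 B"] by auto
qed

section \<open>Minimizing integral potentials over bounded closed convex sets\<close>

context prob_space
begin

lemma integrable_continuous_bounded:
  fixes g :: "real \<Rightarrow> real"
  assumes g: "continuous_on UNIV g" and f: "f \<in> Linfty M M"
  shows "integrable M (\<lambda>w. g (f w))"
proof -
  obtain c where c: "AE w in M. \<bar>f w\<bar> \<le> c" using f by (auto simp: Linfty_def)
  have [measurable]: "f \<in> borel_measurable M" using f by (simp add: Linfty_def)
  have [measurable]: "g \<in> borel_measurable borel" using g by (rule borel_measurable_continuous_onI)
  obtain B where B: "\<And>x. \<bar>x\<bar> \<le> c \<Longrightarrow> \<bar>g x\<bar> \<le> B"
    using continuous_bounded_on_interval[OF g, of c] by blast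
  have "AE w in M. norm (g (f w)) \<le> B" using c by eventually_elim (simp add: B)
  then show ?thesis by (rule integrable_const_bound) measurable
qed

lemma tendsto_integral_continuous_bounded:
  fixes g :: "real \<Rightarrow> real"
  assumes g: "continuous_on UNIV g"
    and fs: "\<And>n. fs n \<in> borel_measurable M" "\<And>n. AE w in M. \<bar>fs n w\<bar> \<le> c"
    and f: "f \<in> borel_measurable M" "AE w in M. (\<lambda>n. fs n w) \<longlonglongrightarrow> f w"
  shows "(\<lambda>n. \<integral>w. g (fs n w) \<partial>M) \<longlonglongrightarrow> (\<integral>w. g (f w) \<partial>M)"
proof -
  obtain B where B: "\<And>x. \<bar>x\<bar> \<le> c \<Longrightarrow> \<bar>g x\<bar> \<le> B"
    using continuous_bounded_on_interval[OF g, of c] by blast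
  have [measurable]: "\<And>n. fs n \<in> borel_measurable M" "f \<in> borel_measurable M" using fs f by simp_all
  have [measurable]: "g \<in> borel_measurable borel" using g by (rule borel_measurable_continuous_onI)
  show ?thesis
  proof (rule integral_dominated_convergence[where w="\<lambda>_. B"])
    show "AE w in M. (\<lambda>n. g (fs n w)) \<longlonglongrightarrow> g (f w)"
      using f(2)
    proof eventually_elim
      case (elim w)
      have "isCont g (f w)" using g by (simp add: continuous_on_eq_continuous_at)
      then show ?case using elim by (rule isCont_tendsto_compose)
    qed
    show "AE w in M. norm (g (fs n w)) \<le> B" for n
      using fs(2)[of n] by eventually_elim (simp add: B)
  qed simp_all
qed

text \<open>The bound \<open>e i + e j\<close> is the form produced by the midpoint estimate.
  Convergence is extracted in L1, where a Cauchy sequence has an almost surely convergent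
  subsequence; the limit is only claimed to be measurable, since the \<open>fs n\<close> share no
  common bound.\<close>

lemma L2_Cauchy_AE_subseq:
  fixes fs :: "nat \<Rightarrow> 'a \<Rightarrow> real"
  assumes fs: "\<And>n. fs n \<in> Linfty M M"
    and e: "e \<longlonglongrightarrow> 0" "\<And>i j. (\<integral>w. (fs i w - fs j w)\<^sup>2 \<partial>M) \<le> e i + e j"
  obtains r f where "strict_mono r" "f \<in> borel_measurable M" "AE w in M. (\<lambda>n. fs (r n) w) \<longlonglongrightarrow> f w"
proof -
  have [measurable]: "\<And>n. fs n \<in> borel_measurable M" using fs by (auto simp: Linfty_def)
  have int: "integrable M (fs n)" for n
    using integrable_continuous_bounded[OF _ fs, of "\<lambda>x. x"] by (simp add: continuous_on_id)
  have diff: "(\<lambda>w. fs i w - fs j w) \<in> Linfty M M" for i j by (rule Linfty_diff[OF fs fs])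
  have sq: "integrable M (\<lambda>w. (fs i w - fs j w)\<^sup>2)" for i j
    using integrable_continuous_bounded[OF _ diff, of "\<lambda>x. x\<^sup>2"] by (simp add: continuous_intros)
  \<comment> \<open>The arithmetic-geometric mean inequality with a free scale \<open>d\<close>
    bounds the L1 norm on a probability space by an expression linear in the integral of the
    square.\<close>
  have AMGM: "\<bar>x\<bar> \<le> d / 2 + x\<^sup>2 / (2 * d)" if "0 < d" for x d :: real
  proof -
    have "0 \<le> (\<bar>x\<bar> - d)\<^sup>2" by simp
    then have "\<bar>x\<bar> * (2 * d) \<le> d * d + x\<^sup>2" by (simp add: power2_diff power2_eq_square[of d])
    then have "\<bar>x\<bar> \<le> (d * d + x\<^sup>2) / (2 * d)" using that by (simp add: pos_le_divide_eq)
    then show ?thesis using that by (simp add: add_divide_distrib)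
  qed
  have L1: "\<exists>N. \<forall>i\<ge>N. \<forall>j\<ge>N. (\<integral>w. norm (fs i w - fs j w) \<partial>M) < d" if "0 < d" for d
  proof -
    \<comment> \<open>Two errors below \<open>d\<^sup>2 / 4\<close> contribute at most
      \<open>d / 4\<close> after division by \<open>2 * d\<close>. Together with the leading
      \<open>d / 2\<close> this leaves another \<open>d / 4\<close> to make the estimate
      strict.\<close>
    have "0 < d\<^sup>2 / 4" using that by simp
    then obtain N where N: "\<And>n. n \<ge> N \<Longrightarrow> \<bar>e n\<bar> < d\<^sup>2 / 4"
      using LIMSEQ_D[OF e(1)] by (metis diff_zero real_norm_def)
    have "(\<integral>w. norm (fs i w - fs j w) \<partial>M) < d" if "i \<ge> N" "j \<ge> N" for i j
    proof -
      have "(\<integral>w. norm (fs i w - fs j w) \<partial>M) \<le> (\<integral>w. d / 2 + (fs i w - fs j w)\<^sup>2 / (2 * d) \<partial>M)"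
      proof (rule integral_mono)
        fix w
        show "norm (fs i w - fs j w) \<le> d / 2 + (fs i w - fs j w)\<^sup>2 / (2 * d)"
          using AMGM[OF \<open>0 < d\<close>] by simp
      qed (use int sq in auto)
      also have "\<dots> = d / 2 + (\<integral>w. (fs i w - fs j w)\<^sup>2 \<partial>M) / (2 * d)"
        using sq by (simp add: prob_space)
      also have "\<dots> < d / 2 + (d\<^sup>2 / 2) / (2 * d) + d / 4"
      proof -
        have "(\<integral>w. (fs i w - fs j w)\<^sup>2 \<partial>M) \<le> d\<^sup>2 / 2"
          using N[OF that(1)] N[OF that(2)] e(2)[of i j] by linarith
        then have "(\<integral>w. (fs i w - fs j w)\<^sup>2 \<partial>M) / (2 * d) \<le> d\<^sup>2 / 2 / (2 * d)"
          using \<open>0 < d\<close> by (intro divide_right_mono) auto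
        then show ?thesis using \<open>0 < d\<close> by linarith
      qed
      also have "\<dots> = d" using \<open>0 < d\<close> by (simp add: field_simps power2_eq_square)
      finally show ?thesis .
    qed
    then show ?thesis by blast
  qed
  obtain r where r: "strict_mono r" "AE w in M. Cauchy (\<lambda>i. fs (r i) w)"
    by (rule cauchy_L1_AE_cauchy_subseq[OF int L1])
  have "AE w in M. (\<lambda>n. fs (r n) w) \<longlonglongrightarrow> lim (\<lambda>n. fs (r n) w)"
    using r(2) by eventually_elim (simp add: Cauchy_convergent_iff convergent_LIMSEQ_iff)
  moreover have "(\<lambda>w. lim (\<lambda>n. fs (r n) w)) \<in> borel_measurable M" by measurable
  ultimately show thesis using that r(1) by blast
qed

text \<open>The midpoint of \<open>f\<close> and \<open>g\<close> stays in \<open>K\<close> and so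
  costs at least \<open>m\<close>. Two almost optimal elements are therefore close in L2.\<close>

lemma integral_potential_midpoint:
  assumes pot: "strongly_convex_potential \<Psi> \<psi>" and K: "bounded_closed_convex M K"
    and f: "f \<in> K" and g: "g \<in> K"
    and m: "\<And>h. h \<in> K \<Longrightarrow> m \<le> (\<integral>w. \<Psi> (h w) \<partial>M)"
  shows "(\<integral>w. (f w - g w)\<^sup>2 \<partial>M) \<le> 2 * ((\<integral>w. \<Psi> (f w) \<partial>M) + (\<integral>w. \<Psi> (g w) \<partial>M) - 2 * m)"
proof -
  let ?h = "\<lambda>w. (f w + g w) / 2"
  have h: "?h \<in> K"
    using bounded_closed_convexD(2)[OF K f g, of "1/2"] by (simp add: add_divide_distrib)
  have cont: "continuous_on UNIV \<Psi>" using pot by (simp add: strongly_convex_potential_def)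
  have KL: "K \<subseteq> Linfty M M" using K by (simp add: bounded_closed_convex_def)
  have int: "integrable M (\<lambda>w. \<Psi> (k w))" if "k \<in> K" for k
    using that KL by (intro integrable_continuous_bounded[OF cont]) auto
  have "(\<integral>w. (f w - g w)\<^sup>2 \<partial>M) \<le> (\<integral>w. 2 * (\<Psi> (f w) + \<Psi> (g w) - 2 * \<Psi> (?h w)) \<partial>M)"
  proof (rule integral_mono')
    show "(f w - g w)\<^sup>2 \<le> 2 * (\<Psi> (f w) + \<Psi> (g w) - 2 * \<Psi> (?h w))" for w
      using strongly_convex_potential_midpoint[OF pot, of "f w" "g w"] by simp
    then show "0 \<le> 2 * (\<Psi> (f w) + \<Psi> (g w) - 2 * \<Psi> (?h w))" for w
      using zero_le_power2 order_trans by blast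
  qed (use int[OF f] int[OF g] int[OF h] in auto)
  also have "\<dots> = 2 * ((\<integral>w. \<Psi> (f w) \<partial>M) + (\<integral>w. \<Psi> (g w) \<partial>M) - 2 * (\<integral>w. \<Psi> (?h w) \<partial>M))"
    using int[OF f] int[OF g] int[OF h] by simp
  also have "\<dots> \<le> 2 * ((\<integral>w. \<Psi> (f w) \<partial>M) + (\<integral>w. \<Psi> (g w) \<partial>M) - 2 * m)"
    using m[OF h] by simp
  finally show ?thesis .
qed

text \<open>The direct method: strong convexity makes minimizing sequences Cauchy, and the uniform
  bound \<open>c\<close> both keeps the limit in \<open>K\<close> and lets the integral pass to the
  limit by dominated convergence.\<close>

lemma potential_minimizer:
  assumes pot: "strongly_convex_potential \<Psi> \<psi>" and K: "bounded_closed_convex M K"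
    and bnd: "\<And>f. f \<in> K \<Longrightarrow> AE w in M. \<bar>f w\<bar> \<le> c" and "K \<noteq> {}"
  obtains f where "f \<in> K" "\<And>g. g \<in> K \<Longrightarrow> (\<integral>w. \<Psi> (f w) \<partial>M) \<le> (\<integral>w. \<Psi> (g w) \<partial>M)"
proof -
  let ?J = "\<lambda>f. \<integral>w. \<Psi> (f w) \<partial>M"
  have cont: "continuous_on UNIV \<Psi>" and nn: "\<And>x. 0 \<le> \<Psi> x"
    using pot by (auto simp: strongly_convex_potential_def)
  have KL: "K \<subseteq> Linfty M M" using K by (simp add: bounded_closed_convex_def)
  define m where "m = Inf (?J ` K)"
  have bdd: "bdd_below (?J ` K)" by (rule bdd_belowI[of _ 0]) (auto intro!: Bochner_Integration.integral_nonneg nn)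
  have m: "m \<le> ?J f" if "f \<in> K" for f
    unfolding m_def using bdd that by (intro cInf_lower) auto
  have "\<exists>f\<in>K. ?J f < m + 1 / real (Suc n)" for n
    using cInf_lessD[of "?J ` K" "m + 1 / real (Suc n)"] \<open>K \<noteq> {}\<close> by (auto simp: m_def)
  then obtain fs where fs: "\<And>n. fs n \<in> K" "\<And>n. ?J (fs n) < m + 1 / real (Suc n)" by metis
  have L2: "(\<integral>w. (fs i w - fs j w)\<^sup>2 \<partial>M) \<le> 2 / real (Suc i) + 2 / real (Suc j)" for i j
    using integral_potential_midpoint[OF pot K fs(1) fs(1) m, of i j] fs(2)[of i] fs(2)[of j] by simp
  have null: "(\<lambda>n. 2 / real (Suc n)) \<longlonglongrightarrow> 0"
    using tendsto_mult[OF tendsto_const[of 2] LIMSEQ_inverse_real_of_nat] by (simp add: divide_inverse)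
  have fsL: "fs n \<in> Linfty M M" for n using fs(1) KL by auto
  obtain r f where r: "strict_mono r" "f \<in> borel_measurable M"
      "AE w in M. (\<lambda>n. fs (r n) w) \<longlonglongrightarrow> f w"
    by (rule L2_Cauchy_AE_subseq[where fs=fs and e="\<lambda>n. 2 / real (Suc n)", OF fsL null L2])
  have "f \<in> K"
    using r(2,3) fs(1) bnd[OF fs(1)] by - (rule bounded_closed_convexD(3)[OF K, of "\<lambda>n. fs (r n)" c], auto)
  have lim_J: "(\<lambda>n. ?J (fs (r n))) \<longlonglongrightarrow> ?J f"
    using fs(1) KL r bnd by (intro tendsto_integral_continuous_bounded[OF cont, of _ c]) (auto simp: Linfty_def)
  have lim_m: "(\<lambda>n. m + 1 / real (Suc (r n))) \<longlonglongrightarrow> m + 0"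
    using LIMSEQ_subseq_LIMSEQ[OF LIMSEQ_inverse_real_of_nat r(1)]
    by (intro tendsto_add tendsto_const) (simp add: o_def divide_inverse)
  have le: "?J f \<le> m + 0"
    by (rule LIMSEQ_le[OF lim_J lim_m]) (use fs(2) less_imp_le in blast)
  show thesis
  proof (rule that[OF \<open>f \<in> K\<close>])
    show "?J f \<le> ?J g" if "g \<in> K" for g using le m[OF that] by simp
  qed
qed

lemma bounded_closed_convex_AE_cong:
  assumes K: "bounded_closed_convex M K" and f: "f \<in> K"
    and g: "g \<in> borel_measurable M" "AE w in M. f w = g w"
  shows "g \<in> K"
proof -
  obtain c where "AE w in M. \<bar>f w\<bar> \<le> c"
    using bounded_closed_convexD(1)[OF K f] by (auto simp: Linfty_def)
  then show ?thesis
    using f g by - (rule bounded_closed_convexD(3)[OF K, of "\<lambda>_. f" c], auto)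
qed

text \<open>If no penalty \<open>a\<close> worked, the minimizers for \<open>a = 0, 1, 2, \<dots>\<close> would be Cauchy in \<open>L\<^sup>2\<close>, and
  their limit, bounded by \<open>n\<close>, would violate the hypothesis.\<close>

lemma potential_step:
  assumes pot: "strongly_convex_potential \<Psi> \<psi>" and K: "bounded_closed_convex M K" and "0 \<le> n"
    and gt: "\<And>X. X \<in> K \<Longrightarrow> AE w in M. \<bar>X w\<bar> \<le> n \<Longrightarrow> 1 < (\<integral>w. \<Psi> (X w) \<partial>M)"
  shows "\<exists>a\<ge>0. \<forall>X\<in>K. (AE w in M. \<bar>X w\<bar> \<le> N) \<longrightarrow> 1 < (\<integral>w. \<Psi> (X w) + a * trunc_sq n (X w) \<partial>M)"
proof (rule ccontr)
  define L where "L = {f\<in>K. AE w in M. \<bar>f w\<bar> \<le> N}"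
  define \<Phi> where "\<Phi> j x = \<Psi> x + real j * trunc_sq n x" for j x
  define J where "J j f = (\<integral>w. \<Phi> j (f w) \<partial>M)" for j :: nat and f
  assume neg: "\<not> ?thesis"
  have L: "bounded_closed_convex M L" unfolding L_def by (rule bounded_closed_convex_cut[OF K])
  have LD: "f \<in> borel_measurable M" "AE w in M. \<bar>f w\<bar> \<le> N" "f \<in> Linfty M M" if "f \<in> L" for f
    using that bounded_closed_convexD(1)[OF L that] by (auto simp: L_def Linfty_def)
  have pot\<Phi>: "strongly_convex_potential (\<Phi> j) (\<lambda>x. \<psi> x + real j * trunc_sq' n x)" for j
    unfolding \<Phi>_def by (rule strongly_convex_potential_add_trunc_sq[OF pot]) (use \<open>0 \<le> n\<close> in auto)
  have cont\<Psi>: "continuous_on UNIV \<Psi>" and nn\<Psi>: "\<And>x. 0 \<le> \<Psi> x"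
    using pot by (auto simp: strongly_convex_potential_def)
  have cont\<Phi>: "continuous_on UNIV (\<Phi> j)" for j
    using pot\<Phi>[of j] by (simp add: strongly_convex_potential_def)
  have int\<Psi>: "integrable M (\<lambda>w. \<Psi> (f w))" and int\<Phi>: "integrable M (\<lambda>w. \<Phi> j (f w))"
    and intw: "integrable M (\<lambda>w. trunc_sq n (f w))" if "f \<in> L" for f j
    by (rule integrable_continuous_bounded[OF _ LD(3)[OF that]] cont\<Psi> cont\<Phi> continuous_on_trunc_sq)+
  have ex: "\<exists>X\<in>L. J j X \<le> 1" for j
  proof -
    have "\<not> (\<forall>X\<in>K. (AE w in M. \<bar>X w\<bar> \<le> N) \<longrightarrow> 1 < (\<integral>w. \<Psi> (X w) + real j * trunc_sq n (X w) \<partial>M))"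
      using neg of_nat_0_le_iff by blast
    then show ?thesis by (auto simp: L_def J_def \<Phi>_def not_less)
  qed
  then have "L \<noteq> {}" by blast
  have "\<exists>f\<in>L. \<forall>g\<in>L. J j f \<le> J j g" for j
    unfolding J_def by (rule potential_minimizer[OF pot\<Phi>[of j] L LD(2) \<open>L \<noteq> {}\<close>]) blast+
  then obtain F where F: "\<And>j. F j \<in> L" "\<And>j g. g \<in> L \<Longrightarrow> J j (F j) \<le> J j g" by metis
  define c where "c j = J j (F j)" for j
  have c1: "c j \<le> 1" for j
  proof -
    obtain X where "X \<in> L" "J j X \<le> 1" using ex by blast
    then show ?thesis using F(2)[of X j] by (simp add: c_def)
  qed
  have J_split: "J j f = (\<integral>w. \<Psi> (f w) \<partial>M) + real j * (\<integral>w. trunc_sq n (f w) \<partial>M)" if "f \<in> L" for j f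
    using int\<Psi>[OF that] intw[OF that] by (simp add: J_def \<Phi>_def)
  have w_nonneg: "0 \<le> (\<integral>w. trunc_sq n (f w) \<partial>M)" for f
    by (rule Bochner_Integration.integral_nonneg) (rule trunc_sq_nonneg)
  have J_mono: "J i f \<le> J j f" if "i \<le> j" "f \<in> L" for i j f
    using that w_nonneg by (simp add: J_split mult_right_mono)
  have "c i \<le> c j" if "i \<le> j" for i j
    using F(2)[OF F(1), of i j] J_mono[OF that F(1)] by (auto simp: c_def intro: order_trans)
  then have "incseq c" by (simp add: incseq_def)
  then obtain l where l: "c \<longlonglongrightarrow> l" "\<And>i. c i \<le> l"
    using incseq_convergent[of c 1] c1 by metis
  \<comment> \<open>Both minimizers are compared through the smaller functional \<open>J i\<close>:
    the midpoint costs at least \<open>c i\<close>, and \<open>J i\<close> of the later minimizer is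
    at most \<open>c j\<close>. Since \<open>c\<close> increases and is bounded by 1, these
    distances tend to 0.\<close>
  have L2': "(\<integral>w. (F i w - F j w)\<^sup>2 \<partial>M) \<le> 2 * (c j - c i)" if "i \<le> j" for i j
  proof -
    have "(\<integral>w. (F i w - F j w)\<^sup>2 \<partial>M) \<le> 2 * (J i (F i) + J i (F j) - 2 * c i)"
      using integral_potential_midpoint[OF pot\<Phi>[of i] L F(1) F(1), of "c i" i j] F(2)
      by (simp add: J_def c_def)
    then show ?thesis using J_mono[OF that F(1)[of j]] by (simp add: c_def)
  qed
  have L2: "(\<integral>w. (F i w - F j w)\<^sup>2 \<partial>M) \<le> 2 * (l - c i) + 2 * (l - c j)" for i j
  proof (cases "i \<le> j")
    case True
    then show ?thesis using L2'[OF True] l(2)[of i] l(2)[of j] by argo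
  next
    case False
    then have "j \<le> i" by simp
    from L2'[OF this] show ?thesis using l(2)[of i] l(2)[of j] by (simp add: power2_commute)
  qed
  have "(\<lambda>i. 2 * (l - c i)) \<longlonglongrightarrow> 2 * (l - l)" by (intro tendsto_intros l(1))
  then have null: "(\<lambda>i. 2 * (l - c i)) \<longlonglongrightarrow> 0" by simp
  obtain r f where r: "strict_mono r" and f: "f \<in> borel_measurable M" "AE w in M. (\<lambda>k. F (r k) w) \<longlonglongrightarrow> f w"
    by (rule L2_Cauchy_AE_subseq[where fs=F and e="\<lambda>i. 2 * (l - c i)", OF LD(3)[OF F(1)] null L2])
  have "f \<in> L"
    using F(1) LD(2)[OF F(1)] f by - (rule bounded_closed_convexD(3)[OF L, of "\<lambda>k. F (r k)" N], auto)
  have lim: "(\<lambda>k. \<integral>w. g (F (r k) w) \<partial>M) \<longlonglongrightarrow> (\<integral>w. g (f w) \<partial>M)" if "continuous_on UNIV g" for g :: "real \<Rightarrow> real"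
    using tendsto_integral_continuous_bounded[OF that LD(1)[OF F(1)] LD(2)[OF F(1)] f] .
  have \<Psi>_le: "(\<integral>w. \<Psi> (F k w) \<partial>M) \<le> 1" and w_le: "real k * (\<integral>w. trunc_sq n (F k w) \<partial>M) \<le> 1" for k
  proof -
    have "(\<integral>w. \<Psi> (F k w) \<partial>M) + real k * (\<integral>w. trunc_sq n (F k w) \<partial>M) \<le> 1"
      using c1[of k] J_split[OF F(1)] by (simp add: c_def)
    moreover have "0 \<le> real k * (\<integral>w. trunc_sq n (F k w) \<partial>M)" using w_nonneg by simp
    moreover have "0 \<le> (\<integral>w. \<Psi> (F k w) \<partial>M)" by (rule Bochner_Integration.integral_nonneg) (rule nn\<Psi>)
    ultimately show "(\<integral>w. \<Psi> (F k w) \<partial>M) \<le> 1" "real k * (\<integral>w. trunc_sq n (F k w) \<partial>M) \<le> 1"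
      by linarith+
  qed
  have "(\<integral>w. \<Psi> (f w) \<partial>M) \<le> 1"
    by (rule LIMSEQ_le_const2[OF lim[OF cont\<Psi>]]) (use \<Psi>_le in blast)
  \<comment> \<open>As \<open>k\<close> times the penalty integral of \<open>F k\<close> is at most
    1, the limit carries no penalty and takes values in \<open>[-n, n]\<close>. The shift by one
    keeps the divisor \<open>Suc k\<close> positive.\<close>
  moreover have "(\<integral>w. trunc_sq n (f w) \<partial>M) \<le> 0"
  proof (rule LIMSEQ_le[OF LIMSEQ_Suc[OF lim[OF continuous_on_trunc_sq(1)]] LIMSEQ_inverse_real_of_nat])
    have "(\<integral>w. trunc_sq n (F (r (Suc k)) w) \<partial>M) \<le> inverse (real (Suc k))" for k
    proof -
      let ?w = "\<integral>w. trunc_sq n (F (r (Suc k)) w) \<partial>M"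
      have "real (Suc k) * ?w \<le> real (r (Suc k)) * ?w"
        using strict_mono_imp_increasing[OF r, of "Suc k"] w_nonneg by (intro mult_right_mono) auto
      then have "real (Suc k) * ?w \<le> 1" using w_le[of "r (Suc k)"] by linarith
      then show ?thesis by (simp add: field_simps)
    qed
    then show "\<exists>N. \<forall>k\<ge>N. (\<integral>w. trunc_sq n (F (r (Suc k)) w) \<partial>M) \<le> inverse (real (Suc k))"
      by blast
  qed
  ultimately have le: "(\<integral>w. \<Psi> (f w) \<partial>M) \<le> 1" "(\<integral>w. trunc_sq n (f w) \<partial>M) = 0"
    using w_nonneg[of f] by auto
  have "AE w in M. trunc_sq n (f w) = 0"
    using integral_nonneg_eq_0_iff_AE[OF intw[OF \<open>f \<in> L\<close>]] le(2) by (simp add: trunc_sq_nonneg)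
  then have "AE w in M. \<bar>f w\<bar> \<le> n"
    by eventually_elim (simp add: trunc_sq_eq_0_iff \<open>0 \<le> n\<close>)
  then show False using gt[of f] le(1) \<open>f \<in> L\<close> by (simp add: L_def)
qed

text \<open>Stage \<open>n\<close> secures the bound for the elements of \<open>K\<close> bounded by
  \<open>n\<close>; the next penalty leaves the potential untouched on \<open>[-n, n]\<close> and so
  preserves what has been achieved. The growth of the glued potential is dictated by
  \<open>K\<close>.\<close>

lemma exists_separating_potential:
  assumes K: "bounded_closed_convex M K" and 0: "(\<lambda>_. 0) \<notin> K"
  obtains \<Psi> \<psi> where "strongly_convex_potential \<Psi> \<psi>" "\<And>X. X \<in> K \<Longrightarrow> 1 < (\<integral>w. \<Psi> (X w) \<partial>M)"
proof -
  define ok where "ok n p \<longleftrightarrow> strongly_convex_potential (fst p) (snd p) \<and>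
      (\<forall>X\<in>K. (AE w in M. \<bar>X w\<bar> \<le> real n) \<longrightarrow> 1 < (\<integral>w. fst p (X w) \<partial>M))"
    for n and p :: "(real \<Rightarrow> real) \<times> (real \<Rightarrow> real)"
  define step where "step n p q \<longleftrightarrow>
      (\<forall>x. \<bar>x\<bar> \<le> real n \<longrightarrow> fst q x = fst p x \<and> snd q x = snd p x)"
    for n :: nat and p q :: "(real \<Rightarrow> real) \<times> (real \<Rightarrow> real)"
  have "\<exists>f. \<forall>n. ok n (f n) \<and> step n (f n) (f (Suc n))"
  proof (rule dependent_nat_choice)
    \<comment> \<open>Stage 0 holds vacuously: an element bounded by 0 vanishes almost surely, and
      then the zero function would belong to \<open>K\<close>.\<close>
    have "\<not> (AE w in M. \<bar>X w\<bar> \<le> 0)" if "X \<in> K" for X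
      using bounded_closed_convex_AE_cong[OF K that, of "\<lambda>_. 0"] 0 by auto
    then have "ok 0 (\<lambda>x. x\<^sup>2, \<lambda>x. 2 * x)"
      using strongly_convex_potential_square by (auto simp: ok_def)
    then show "\<exists>p. ok 0 p" ..
  next
    fix p and n :: nat assume p: "ok n p"
    then obtain a where a: "0 \<le> a" "\<forall>X\<in>K. (AE w in M. \<bar>X w\<bar> \<le> real (Suc n)) \<longrightarrow>
        1 < (\<integral>w. fst p (X w) + a * trunc_sq (real n) (X w) \<partial>M)"
      using potential_step[of "fst p" "snd p" K "real n" "real (Suc n)"] K by (auto simp: ok_def)
    define q where "q = (\<lambda>x. fst p x + a * trunc_sq (real n) x, \<lambda>x. snd p x + a * trunc_sq' (real n) x)"
    have "ok (Suc n) q"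
      using p a strongly_convex_potential_add_trunc_sq[of "fst p" "snd p" a "real n"]
      by (simp add: ok_def q_def)
    moreover have "step n p q" by (simp add: step_def q_def trunc_sq_eq_0)
    ultimately show "\<exists>q. ok (Suc n) q \<and> step n p q" by blast
  qed
  then obtain f where f: "\<And>n. ok n (f n)" "\<And>n. step n (f n) (f (Suc n))" by blast
  obtain \<Phi> \<phi> where \<Phi>: "strongly_convex_potential \<Phi> \<phi>" "\<And>n x. \<bar>x\<bar> \<le> real n \<Longrightarrow> \<Phi> x = fst (f n) x"
    by (rule strongly_convex_potential_glue[of "\<lambda>n. fst (f n)" "\<lambda>n. snd (f n)"])
      (use f in \<open>auto simp: ok_def step_def\<close>)
  have "1 < (\<integral>w. \<Phi> (X w) \<partial>M)" if X: "X \<in> K" for X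
  proof -
    have XL: "X \<in> Linfty M M" using bounded_closed_convexD(1)[OF K X] .
    then obtain c where c: "AE w in M. \<bar>X w\<bar> \<le> c" by (auto simp: Linfty_def)
    obtain n where n: "c \<le> real n" using real_arch_simple by blast
    have Xn: "AE w in M. \<bar>X w\<bar> \<le> real n" using c n by auto
    have cont: "continuous_on UNIV \<Phi>" "continuous_on UNIV (fst (f n))"
      using \<Phi>(1) f(1)[of n] by (auto simp: strongly_convex_potential_def ok_def)
    have "(\<integral>w. \<Phi> (X w) \<partial>M) = (\<integral>w. fst (f n) (X w) \<partial>M)"
      using Xn cont XL
      by (intro integral_cong_AE borel_measurable_integrable integrable_continuous_bounded)
        (auto simp: \<Phi>(2))
    then show ?thesis using f(1)[of n] X Xn by (simp add: ok_def)
  qed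
  then show thesis using that \<Phi>(1) by blast
qed

text \<open>The variational inequality at a constrained minimum, obtained by moving from
  \<open>f\<close> a fraction \<open>s n\<close> of the way to \<open>g\<close> inside the convex
  set.\<close>

lemma potential_minimizer_first_order:
  assumes pot: "strongly_convex_potential \<Psi> \<psi>" and K: "bounded_closed_convex M K"
    and f: "f \<in> K" and min: "\<And>g. g \<in> K \<Longrightarrow> (\<integral>w. \<Psi> (f w) \<partial>M) \<le> (\<integral>w. \<Psi> (g w) \<partial>M)"
    and g: "g \<in> K"
  shows "0 \<le> (\<integral>w. \<psi> (f w) * (g w - f w) \<partial>M)"
proof -
  have cont: "continuous_on UNIV \<Psi>" "continuous_on UNIV \<psi>"
    using pot by (auto simp: strongly_convex_potential_def)
  have [measurable]: "f \<in> borel_measurable M" "g \<in> borel_measurable M"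
    using bounded_closed_convexD(1)[OF K] f g by (auto simp: Linfty_def)
  have [measurable]: "\<psi> \<in> borel_measurable borel" using cont(2) by (rule borel_measurable_continuous_onI)
  obtain c where c: "0 \<le> c" "AE w in M. \<bar>f w\<bar> \<le> c" "AE w in M. \<bar>g w\<bar> \<le> c"
  proof -
    obtain a where a: "0 \<le> a" "AE w in M. \<bar>f w\<bar> \<le> a"
      by (rule Linfty_boundE[OF bounded_closed_convexD(1)[OF K f]])
    obtain b where b: "a \<le> b" "AE w in M. \<bar>g w\<bar> \<le> b"
      by (rule Linfty_boundE[OF bounded_closed_convexD(1)[OF K g]])
    have "AE w in M. \<bar>f w\<bar> \<le> b" using a(2) by eventually_elim (use b(1) in simp)
    then show ?thesis using that[of b] a(1) b by simp
  qed
  obtain B where B: "\<And>x. \<bar>x\<bar> \<le> c \<Longrightarrow> \<bar>\<psi> x\<bar> \<le> B"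
    using continuous_bounded_on_interval[OF cont(2), of c] by blast
  define s where "s n = inverse (real (Suc n))" for n
  have s: "0 < s n" "s n \<le> 1" for n by (auto simp: s_def inverse_le_1_iff)
  have s0: "s \<longlonglongrightarrow> 0" unfolding s_def by (rule LIMSEQ_inverse_real_of_nat)
  define h where "h n w = s n * g w + (1 - s n) * f w" for n w
  have hK: "h n \<in> K" for n
    unfolding h_def using bounded_closed_convexD(2)[OF K g f, of "s n"] s[of n] by simp
  have [measurable]: "h n \<in> borel_measurable M" for n unfolding h_def by measurable
  have hc: "AE w in M. \<bar>h n w\<bar> \<le> c" for n
    using c(2,3)
  proof eventually_elim
    case (elim w)
    have "\<bar>h n w\<bar> \<le> s n * \<bar>g w\<bar> + (1 - s n) * \<bar>f w\<bar>"
      using s[of n] by (simp add: h_def abs_mult order_trans[OF abs_triangle_ineq])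
    also have "\<dots> \<le> s n * c + (1 - s n) * c" using s[of n] elim by (intro add_mono mult_left_mono) auto
    finally show ?case by (simp add: algebra_simps)
  qed
  have bd: "AE w in M. norm (\<psi> (h n w) * (g w - f w)) \<le> B * (2 * c)" for n
    using c(2,3) hc[of n]
  proof eventually_elim
    case (elim w)
    have "\<bar>\<psi> (h n w)\<bar> * \<bar>g w - f w\<bar> \<le> B * (2 * c)"
      using B[OF elim(3)] elim(1,2) by (intro mult_mono) auto
    then show ?case by (simp add: abs_mult)
  qed
  have pos: "0 \<le> (\<integral>w. \<psi> (h n w) * (g w - f w) \<partial>M)" for n
  proof -
    have int: "integrable M (\<lambda>w. \<Psi> (k w))" if "k \<in> K" for k
      by (rule integrable_continuous_bounded[OF cont(1) bounded_closed_convexD(1)[OF K that]])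
    have intp: "integrable M (\<lambda>w. \<psi> (h n w) * (g w - f w))"
      by (rule integrable_const_bound[OF bd]) measurable
    \<comment> \<open>The subgradient is taken at the perturbed point \<open>h n\<close>, not at
      \<open>f\<close>. This bounds the increment of \<open>\<Psi>\<close> from above, so minimality
      gives the sign before any limit, and the limit uses continuity of \<open>\<psi>\<close>
      instead of difference quotients.\<close>
    have "\<Psi> (h n w) - \<Psi> (f w) \<le> s n * (\<psi> (h n w) * (g w - f w))" for w
    proof -
      have "\<Psi> (h n w) + \<psi> (h n w) * (f w - h n w) + (f w - h n w)\<^sup>2 \<le> \<Psi> (f w)"
        using pot by (auto simp: strongly_convex_potential_def)
      moreover have "f w - h n w = - s n * (g w - f w)" by (simp add: h_def algebra_simps)
      then have "\<psi> (h n w) * (f w - h n w) = - (s n * (\<psi> (h n w) * (g w - f w)))" by simp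
      ultimately show ?thesis
        using zero_le_power2[of "f w - h n w"] by linarith
    qed
    then have "(\<integral>w. \<Psi> (h n w) - \<Psi> (f w) \<partial>M) \<le> (\<integral>w. s n * (\<psi> (h n w) * (g w - f w)) \<partial>M)"
      using int[OF hK] int[OF f] intp by (intro integral_mono) auto
    then have "0 \<le> s n * (\<integral>w. \<psi> (h n w) * (g w - f w) \<partial>M)"
      using int[OF hK] int[OF f] min[OF hK, of n] by simp
    then show ?thesis using s(1)[of n] by (simp add: zero_le_mult_iff)
  qed
  have lim: "(\<lambda>n. \<integral>w. \<psi> (h n w) * (g w - f w) \<partial>M) \<longlonglongrightarrow> (\<integral>w. \<psi> (f w) * (g w - f w) \<partial>M)"
  proof (rule integral_dominated_convergence[where w="\<lambda>_. B * (2 * c)"])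
    have "(\<lambda>n. \<psi> (h n w)) \<longlonglongrightarrow> \<psi> (f w)" for w
    proof (rule isCont_tendsto_compose[of _ \<psi>])
      show "isCont \<psi> (f w)" using cont(2) by (simp add: continuous_on_eq_continuous_at)
      have "(\<lambda>n. h n w) \<longlonglongrightarrow> 0 * g w + (1 - 0) * f w"
        unfolding h_def by (intro tendsto_intros s0)
      then show "(\<lambda>n. h n w) \<longlonglongrightarrow> f w" by simp
    qed
    then show "AE w in M. (\<lambda>n. \<psi> (h n w) * (g w - f w)) \<longlonglongrightarrow> \<psi> (f w) * (g w - f w)"
      by (intro AE_I2 tendsto_mult tendsto_const)
  qed (use bd in auto)
  show ?thesis by (rule LIMSEQ_le_const[OF lim]) (use pos in blast)
qed

text \<open>Uniform integrability in the style of de la Vallee Poussin: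
  \<open>\<bar>\<psi> x\<bar> \<le> \<psi> x * x / R\<close> once
  \<open>R \<le> \<bar>x\<bar>\<close>, so a bound on the integrals of
  \<open>\<psi> (X k) * X k\<close> controls the tails of all \<open>\<psi> (X k)\<close> at
  once.\<close>

lemma tendsto_integral_superlinear:
  fixes \<psi> :: "real \<Rightarrow> real"
  assumes cont: "continuous_on UNIV \<psi>" and nn: "\<And>x. 0 \<le> \<psi> x * x"
    and X: "\<And>k. X k \<in> Linfty M M" and f[measurable]: "f \<in> borel_measurable M"
    and lim: "AE w in M. (\<lambda>k::nat. X k w) \<longlonglongrightarrow> f w"
    and B: "\<And>k. (\<integral>w. \<psi> (X k w) * X k w \<partial>M) \<le> B"
  shows "integrable M (\<lambda>w. \<psi> (f w))"
    and "h \<in> Linfty M M \<Longrightarrow> (\<lambda>k. \<integral>w. \<psi> (X k w) * h w \<partial>M) \<longlonglongrightarrow> (\<integral>w. \<psi> (f w) * h w \<partial>M)"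
proof -
  have X_meas [measurable]: "X k \<in> borel_measurable M" for k using X by (simp add: Linfty_def)
  have [measurable]: "\<psi> \<in> borel_measurable borel" using cont by (rule borel_measurable_continuous_onI)
  have cont_at: "isCont \<psi> x" for x using cont by (simp add: continuous_on_eq_continuous_at)
  have lim\<psi>: "AE w in M. (\<lambda>k. \<psi> (X k w)) \<longlonglongrightarrow> \<psi> (f w)"
    using lim by eventually_elim (rule isCont_tendsto_compose[OF cont_at])
  have intXX: "integrable M (\<lambda>w. \<psi> (X k w) * X k w)" and intX: "integrable M (\<lambda>w. \<psi> (X k w))" for k
    by (rule integrable_continuous_bounded[OF continuous_on_mult[OF cont continuous_on_id] X]
        integrable_continuous_bounded[OF cont X])+
  have "0 \<le> B" by (rule order_trans[OF Bochner_Integration.integral_nonneg B[of 0]]) (rule nn)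
  \<comment> \<open>Fatou's lemma carries the bound \<open>B\<close> over to the limit, so that the
    tail estimate below applies to \<open>f\<close> as well.\<close>
  have "(\<integral>\<^sup>+w. ennreal (\<psi> (f w) * f w) \<partial>M) \<le> (\<integral>\<^sup>+w. liminf (\<lambda>k. ennreal (\<psi> (X k w) * X k w)) \<partial>M)"
  proof (rule nn_integral_mono_AE)
    show "AE w in M. ennreal (\<psi> (f w) * f w) \<le> liminf (\<lambda>k. ennreal (\<psi> (X k w) * X k w))"
      using lim lim\<psi>
    proof eventually_elim
      case (elim w)
      then have "(\<lambda>k. ennreal (\<psi> (X k w) * X k w)) \<longlonglongrightarrow> ennreal (\<psi> (f w) * f w)"
        by (intro tendsto_ennrealI tendsto_mult)
      then show ?case by (simp add: lim_imp_Liminf)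
    qed
  qed
  also have "\<dots> \<le> liminf (\<lambda>k. \<integral>\<^sup>+w. ennreal (\<psi> (X k w) * X k w) \<partial>M)"
    by (rule nn_integral_liminf) measurable
  also have "\<dots> \<le> liminf (\<lambda>k. ennreal B)"
  proof (rule Liminf_mono, rule always_eventually, rule allI)
    show "(\<integral>\<^sup>+w. ennreal (\<psi> (X k w) * X k w) \<partial>M) \<le> ennreal B" for k
      using B[of k] by (subst nn_integral_eq_integral[OF intXX]) (auto simp: nn ennreal_leI)
  qed
  finally have nnB: "(\<integral>\<^sup>+w. ennreal (\<psi> (f w) * f w) \<partial>M) \<le> ennreal B" by (simp add: Liminf_const)
  have intff: "integrable M (\<lambda>w. \<psi> (f w) * f w)"
    by (rule integrableI_nonneg) (use nnB nn in \<open>auto simp: le_less_trans\<close>)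
  have Bf: "(\<integral>w. \<psi> (f w) * f w \<partial>M) \<le> B"
    using nnB \<open>0 \<le> B\<close> by (subst (asm) nn_integral_eq_integral[OF intff]) (auto simp: nn)
  obtain S where S: "0 \<le> S" "\<And>x. \<bar>x\<bar> \<le> 1 \<Longrightarrow> \<bar>\<psi> x\<bar> \<le> S"
    using continuous_bounded_on_interval[OF cont, of 1] by blast
  have bound: "\<bar>\<psi> x\<bar> \<le> S + \<psi> x * x" for x
  proof (cases "\<bar>x\<bar> \<le> 1")
    case True
    then show ?thesis using S(2)[of x] nn[of x] by linarith
  next
    case False
    have "\<bar>\<psi> x\<bar> * 1 \<le> \<bar>\<psi> x\<bar> * \<bar>x\<bar>" using False by (intro mult_left_mono) auto
    also have "\<dots> = \<psi> x * x" using nn[of x] by (simp add: abs_mult[symmetric])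
    finally show ?thesis using S(1) by simp
  qed
  show intf: "integrable M (\<lambda>w. \<psi> (f w))"
    by (rule Bochner_Integration.integrable_bound[of M "\<lambda>w. S + \<psi> (f w) * f w"])
      (use intff bound in \<open>auto intro!: AE_I2 order_trans[OF bound abs_ge_self]\<close>)
  assume h: "h \<in> Linfty M M"
  then have [measurable]: "h \<in> borel_measurable M" by (simp add: Linfty_def)
  obtain c where c: "0 \<le> c" "AE w in M. \<bar>h w\<bar> \<le> c" by (rule Linfty_boundE[OF h])
  note int_h = integrable_Linfty_mult[OF _ h]
  show "(\<lambda>k. \<integral>w. \<psi> (X k w) * h w \<partial>M) \<longlonglongrightarrow> (\<integral>w. \<psi> (f w) * h w \<partial>M)"
  proof (rule LIMSEQ_I)
    fix e :: real assume "0 < e"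
    \<comment> \<open>Chosen so that the tail error \<open>c * B / R\<close> stays below
      \<open>e / 4\<close>; the added 1 keeps \<open>R\<close> positive when
      \<open>c * B = 0\<close>.\<close>
    define R where "R = 4 * (c * B + 1) / e"
    have "0 < R" using \<open>0 < e\<close> \<open>0 \<le> B\<close> c(1) by (simp add: R_def add_nonneg_pos)
    have R: "c * B / R < e / 4"
    proof -
      have "e / 4 * R = c * B + 1" using \<open>0 < e\<close> by (simp add: R_def)
      then show ?thesis using \<open>0 < R\<close> by (simp add: pos_divide_less_eq)
    qed
    \<comment> \<open>A continuous cutoff, 1 on \<open>[-R, R]\<close> and 0 outside
      \<open>[-2 * R, 2 * R]\<close>. It makes \<open>\<psi> x * \<tau> x\<close> bounded and
      continuous, so the main part converges by dominated convergence.\<close>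
    define \<tau> where "\<tau> x = max 0 (min 1 (2 - \<bar>x\<bar> / R))" for x
    have cont\<tau>: "continuous_on UNIV (\<lambda>x. \<psi> x * \<tau> x)"
      unfolding \<tau>_def using \<open>0 < R\<close> by (intro continuous_intros cont) auto
    then have [measurable]: "(\<lambda>x. \<psi> x * \<tau> x) \<in> borel_measurable borel" by (rule borel_measurable_continuous_onI)
    have cont\<tau>_at: "isCont (\<lambda>x. \<psi> x * \<tau> x) x" for x using cont\<tau> by (simp add: continuous_on_eq_continuous_at)
    obtain S' where S': "0 \<le> S'" "\<And>x. \<bar>x\<bar> \<le> 2 * R \<Longrightarrow> \<bar>\<psi> x\<bar> \<le> S'"
      using continuous_bounded_on_interval[OF cont, of "2 * R"] by blast
    have \<tau>01: "0 \<le> \<tau> x" "\<tau> x \<le> 1" for x by (auto simp: \<tau>_def)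
    have \<tau>_bd: "\<bar>\<psi> x * \<tau> x\<bar> \<le> S'" for x
    proof (cases "\<bar>x\<bar> \<le> 2 * R")
      case True
      have "\<bar>\<psi> x\<bar> * \<bar>\<tau> x\<bar> \<le> S' * 1" using S' True \<tau>01[of x] by (intro mult_mono) auto
      then show ?thesis by (simp add: abs_mult)
    next
      case False
      then have "2 - \<bar>x\<bar> / R \<le> 0" using \<open>0 < R\<close> by (simp add: field_simps)
      then have "\<tau> x = 0" by (simp add: \<tau>_def)
      then show ?thesis using S' by simp
    qed
    have \<tau>_tail: "\<bar>\<psi> x - \<psi> x * \<tau> x\<bar> \<le> \<psi> x * x / R" for x
    proof -
      have "1 - \<tau> x \<le> \<bar>x\<bar> / R"
      proof (cases "\<bar>x\<bar> \<le> R")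
        case True
        then have "\<bar>x\<bar> / R \<le> 1" using \<open>0 < R\<close> by simp
        then show ?thesis using \<open>0 < R\<close> by (simp add: \<tau>_def)
      next
        case False
        then have "1 \<le> \<bar>x\<bar> / R" using \<open>0 < R\<close> by simp
        then show ?thesis using \<tau>01[of x] by linarith
      qed
      then have "\<bar>\<psi> x\<bar> * (1 - \<tau> x) \<le> \<bar>\<psi> x\<bar> * (\<bar>x\<bar> / R)" by (intro mult_left_mono) auto
      also have "\<dots> = \<bar>\<psi> x * x\<bar> / R" by (simp add: abs_mult)
      also have "\<dots> = \<psi> x * x / R" using nn[of x] by simp
      also have "\<bar>\<psi> x\<bar> * (1 - \<tau> x) = \<bar>\<psi> x - \<psi> x * \<tau> x\<bar>"
        using \<tau>01[of x] abs_mult[of "\<psi> x" "1 - \<tau> x"] by (simp add: right_diff_distrib)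
      finally show ?thesis .
    qed
    have tail: "\<bar>(\<integral>w. \<psi> (Y w) * h w \<partial>M) - (\<integral>w. \<psi> (Y w) * \<tau> (Y w) * h w \<partial>M)\<bar> < e / 4"
      if Y[measurable]: "Y \<in> borel_measurable M" and intY: "integrable M (\<lambda>w. \<psi> (Y w))"
        and intYY: "integrable M (\<lambda>w. \<psi> (Y w) * Y w)" and YB: "(\<integral>w. \<psi> (Y w) * Y w \<partial>M) \<le> B" for Y
    proof -
      have intT: "integrable M (\<lambda>w. \<psi> (Y w) * \<tau> (Y w))"
        by (rule integrable_const_bound[of _ S']) (use \<tau>_bd in auto)
      have "(\<integral>w. \<psi> (Y w) * h w \<partial>M) - (\<integral>w. \<psi> (Y w) * \<tau> (Y w) * h w \<partial>M)
          = (\<integral>w. \<psi> (Y w) * h w - \<psi> (Y w) * \<tau> (Y w) * h w \<partial>M)"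
        using int_h[OF intY] int_h[OF intT] by simp
      also have "\<bar>\<dots>\<bar> \<le> (\<integral>w. \<bar>\<psi> (Y w) * h w - \<psi> (Y w) * \<tau> (Y w) * h w\<bar> \<partial>M)"
        by (rule integral_abs_bound)
      also have "\<dots> \<le> (\<integral>w. c / R * (\<psi> (Y w) * Y w) \<partial>M)"
      proof (rule integral_mono_AE)
        show "AE w in M. \<bar>\<psi> (Y w) * h w - \<psi> (Y w) * \<tau> (Y w) * h w\<bar> \<le> c / R * (\<psi> (Y w) * Y w)"
          using c(2)
        proof eventually_elim
          case (elim w)
          have "\<bar>\<psi> (Y w) - \<psi> (Y w) * \<tau> (Y w)\<bar> * \<bar>h w\<bar> \<le> \<psi> (Y w) * Y w / R * c"
            using elim \<tau>_tail nn \<open>0 < R\<close> by (intro mult_mono) auto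
          then show ?case
            by (simp add: abs_mult[symmetric] left_diff_distrib[of _ _ "h w"] mult.commute[of c])
        qed
      qed (use int_h[OF intY] int_h[OF intT] intYY in auto)
      also have "\<dots> = c / R * (\<integral>w. \<psi> (Y w) * Y w \<partial>M)" by simp
      also have "\<dots> \<le> c / R * B" using YB c(1) \<open>0 < R\<close> by (intro mult_left_mono) auto
      also have "\<dots> < e / 4" using R by simp
      finally show ?thesis .
    qed
    have "(\<lambda>k. \<integral>w. \<psi> (X k w) * \<tau> (X k w) * h w \<partial>M) \<longlonglongrightarrow> (\<integral>w. \<psi> (f w) * \<tau> (f w) * h w \<partial>M)"
    proof (rule integral_dominated_convergence[where w="\<lambda>_. S' * c"])
      show "AE w in M. (\<lambda>k. \<psi> (X k w) * \<tau> (X k w) * h w) \<longlonglongrightarrow> \<psi> (f w) * \<tau> (f w) * h w"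
        using lim by eventually_elim (intro tendsto_mult[OF isCont_tendsto_compose[OF cont\<tau>_at] tendsto_const])
      show "AE w in M. norm (\<psi> (X k w) * \<tau> (X k w) * h w) \<le> S' * c" for k
        using c(2)
      proof eventually_elim
        case (elim w)
        have "\<bar>\<psi> (X k w) * \<tau> (X k w)\<bar> * \<bar>h w\<bar> \<le> S' * c"
          using elim \<tau>_bd S'(1) by (intro mult_mono) auto
        then show ?case by (simp add: abs_mult)
      qed
    qed measurable
    from LIMSEQ_D[OF this, of "e / 4"] \<open>0 < e\<close> obtain N where N: "\<And>k. k \<ge> N \<Longrightarrow>
        \<bar>(\<integral>w. \<psi> (X k w) * \<tau> (X k w) * h w \<partial>M) - (\<integral>w. \<psi> (f w) * \<tau> (f w) * h w \<partial>M)\<bar> < e / 4"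
      by auto
    have "norm ((\<integral>w. \<psi> (X k w) * h w \<partial>M) - (\<integral>w. \<psi> (f w) * h w \<partial>M)) < e" if "k \<ge> N" for k
      using N[OF that] tail[OF X_meas intX intXX B, of k] tail[OF f intf intff Bf] \<open>0 < e\<close>
      unfolding real_norm_def by linarith
    then show "\<exists>N. \<forall>k\<ge>N. norm ((\<integral>w. \<psi> (X k w) * h w \<partial>M) - (\<integral>w. \<psi> (f w) * h w \<partial>M)) < e" by blast
  qed
qed

text \<open>The density is the gradient of the potential at the limit of the minimizers over growing
  balls. The cone property enters twice: \<open>H0\<close> itself belongs to \<open>H0 - C\<close>,
  and arbitrarily large multiples of an element of \<open>C\<close> may be subtracted from
  \<open>H0\<close>.\<close>

theorem Linfty_cone_separation:
  assumes C: "bounded_closed_convex M C"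
    and cone: "\<And>f t. f \<in> C \<Longrightarrow> 0 \<le> t \<Longrightarrow> (\<lambda>w. t * f w) \<in> C" and ne: "C \<noteq> {}"
    and H0: "H0 \<in> Linfty M M" "H0 \<notin> C"
  obtains \<xi> where "integrable M \<xi>" "\<And>H. H \<in> C \<Longrightarrow> (\<integral>w. \<xi> w * H w \<partial>M) \<le> 0"
    "0 < (\<integral>w. \<xi> w * H0 w \<partial>M)"
proof -
  have [measurable]: "H0 \<in> borel_measurable M" using H0 by (simp add: Linfty_def)
  obtain c0 where c0: "0 \<le> c0" "AE w in M. \<bar>H0 w\<bar> \<le> c0" by (rule Linfty_boundE[OF H0(1)])
  obtain f0 where "f0 \<in> C" using ne by blast
  from cone[OF this, of 0] have zero: "(\<lambda>_. 0) \<in> C" by simp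
  define K where "K = {X \<in> Linfty M M. (\<lambda>w. H0 w - X w) \<in> C}"
  have K: "bounded_closed_convex M K"
    unfolding bounded_closed_convex_def
  proof (intro conjI ballI allI impI)
    show "K \<subseteq> Linfty M M" by (auto simp: K_def)
    fix f g and u :: real assume fg: "f \<in> K" "g \<in> K" and u: "0 \<le> u \<and> u \<le> 1"
    have "(\<lambda>w. u * (H0 w - f w) + (1 - u) * (H0 w - g w)) \<in> C"
      using fg u by (intro bounded_closed_convexD(2)[OF C]) (auto simp: K_def)
    then have "(\<lambda>w. H0 w - (u * f w + (1 - u) * g w)) \<in> C" by (simp add: algebra_simps)
    then show "(\<lambda>w. u * f w + (1 - u) * g w) \<in> K"
      using fg by (auto simp: K_def intro!: Linfty_add Linfty_cmult)
  next
    fix fs :: "nat \<Rightarrow> 'a \<Rightarrow> real" and f c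
    assume fs: "\<forall>n. fs n \<in> K" "\<forall>n. AE w in M. \<bar>fs n w\<bar> \<le> c"
      and f: "f \<in> borel_measurable M" "AE w in M. (\<lambda>n. fs n w) \<longlonglongrightarrow> f w"
    have "AE w in M. \<bar>f w\<bar> \<le> c" using fs f by - (rule AE_bounded_limit[where fs=fs], auto)
    moreover have "(\<lambda>w. H0 w - f w) \<in> C"
    proof (rule bounded_closed_convexD(3)[OF C, of "\<lambda>n w. H0 w - fs n w" "c0 + c"])
      show "(\<lambda>w. H0 w - fs n w) \<in> C" for n using fs by (simp add: K_def)
      show "AE w in M. \<bar>H0 w - fs n w\<bar> \<le> c0 + c" for n
        using c0(2) fs(2)[rule_format, of n] by eventually_elim linarith
      show "AE w in M. (\<lambda>n. H0 w - fs n w) \<longlonglongrightarrow> H0 w - f w"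
        using f(2) by eventually_elim (intro tendsto_diff tendsto_const)
    qed (use f in measurable)
    ultimately show "f \<in> K" using f by (auto simp: K_def Linfty_def)
  qed
  have zeroK: "(\<lambda>_. 0) \<notin> K" using H0(2) by (simp add: K_def)
  obtain \<Psi> \<psi> where pot: "strongly_convex_potential \<Psi> \<psi>"
    and gt: "\<And>X. X \<in> K \<Longrightarrow> 1 < (\<integral>w. \<Psi> (X w) \<partial>M)"
    using exists_separating_potential[OF K zeroK] by blast
  have cont: "continuous_on UNIV \<Psi>" "continuous_on UNIV \<psi>"
    using pot by (auto simp: strongly_convex_potential_def)
  have [measurable]: "\<psi> \<in> borel_measurable borel" using cont(2) by (rule borel_measurable_continuous_onI)
  \<comment> \<open>The extra radius \<open>c0\<close> accommodates \<open>H0\<close>, which leaves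
    the full \<open>n\<close> for a multiple of an element of \<open>C\<close>.\<close>
  define Kn where "Kn n = {f\<in>K. AE w in M. \<bar>f w\<bar> \<le> c0 + real n}" for n
  have Kn: "bounded_closed_convex M (Kn n)" for n
    unfolding Kn_def by (rule bounded_closed_convex_cut[OF K])
  have Kn_mono: "Kn i \<subseteq> Kn j" if "i \<le> j" for i j
    using that by (fastforce simp: Kn_def elim: eventually_mono)
  have in_Kn: "(\<lambda>w. H0 w - t * H w) \<in> Kn n"
    if "H \<in> C" "0 \<le> t" "AE w in M. \<bar>H w\<bar> \<le> c" "t * c \<le> real n" for H t c n
  proof -
    have [measurable]: "H \<in> borel_measurable M"
      using bounded_closed_convexD(1)[OF C that(1)] by (simp add: Linfty_def)
    have "AE w in M. \<bar>H0 w - t * H w\<bar> \<le> c0 + real n"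
      using c0(2) that(3)
    proof eventually_elim
      case (elim w)
      have "\<bar>t * H w\<bar> \<le> t * c" using elim that(2) by (simp add: abs_mult mult_left_mono)
      then show ?case using elim that(4) by linarith
    qed
    then show ?thesis using cone[OF that(1,2)] by (auto simp: Kn_def K_def Linfty_def)
  qed
  have H0n: "H0 \<in> Kn n" for n using in_Kn[OF zero, of 0 0 n] by simp
  have "\<exists>f\<in>Kn n. \<forall>g\<in>Kn n. (\<integral>w. \<Psi> (f w) \<partial>M) \<le> (\<integral>w. \<Psi> (g w) \<partial>M)" for n
    by (rule potential_minimizer[OF pot Kn[of n], of "c0 + real n"]) (use H0n[of n] in \<open>auto simp: Kn_def\<close>)
  then obtain F where F: "\<And>n. F n \<in> Kn n"
    and F_min: "\<And>n g. g \<in> Kn n \<Longrightarrow> (\<integral>w. \<Psi> (F n w) \<partial>M) \<le> (\<integral>w. \<Psi> (g w) \<partial>M)" by metis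
  have FK: "F n \<in> K" for n using F[of n] by (simp add: Kn_def)
  have FL: "F n \<in> Linfty M M" for n using FK by (simp add: K_def)
  define J where "J n = (\<integral>w. \<Psi> (F n w) \<partial>M)" for n
  have J_anti: "J j \<le> J i" if "i \<le> j" for i j
    using F_min[of "F i" j] Kn_mono[OF that] F[of i] by (auto simp: J_def)
  have J1: "1 < J n" for n unfolding J_def by (rule gt[OF FK])
  obtain l where l: "J \<longlonglongrightarrow> l" "\<And>n. l \<le> J n"
    using decseq_convergent[of J 1] J_anti J1 by (metis decseq_def less_imp_le)
  have L2': "(\<integral>w. (F i w - F j w)\<^sup>2 \<partial>M) \<le> 2 * (J i - J j)" if "i \<le> j" for i j
    using integral_potential_midpoint[OF pot Kn[of j] _ F[of j], of "F i" "J j"]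
      Kn_mono[OF that] F[of i] F_min[of _ j] by (auto simp: J_def)
  have L2: "(\<integral>w. (F i w - F j w)\<^sup>2 \<partial>M) \<le> 2 * (J i - l) + 2 * (J j - l)" for i j
  proof (cases "i \<le> j")
    case True
    then show ?thesis using L2'[OF True] l(2)[of i] l(2)[of j] by argo
  next
    case False
    then have "j \<le> i" by simp
    from L2'[OF this] show ?thesis using l(2)[of i] l(2)[of j] by (simp add: power2_commute)
  qed
  have "(\<lambda>i. 2 * (J i - l)) \<longlonglongrightarrow> 2 * (l - l)" by (intro tendsto_intros l(1))
  then have null: "(\<lambda>i. 2 * (J i - l)) \<longlonglongrightarrow> 0" by simp
  obtain r f where r: "strict_mono r" and f: "f \<in> borel_measurable M" "AE w in M. (\<lambda>k. F (r k) w) \<longlonglongrightarrow> f w"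
    by (rule L2_Cauchy_AE_subseq[where fs=F and e="\<lambda>i. 2 * (J i - l)", OF FL null L2])
  have int\<psi>: "integrable M (\<lambda>w. \<psi> (F n w))" for n by (rule integrable_continuous_bounded[OF cont(2) FL])
  have [measurable]: "F n \<in> borel_measurable M" for n using FL by (simp add: Linfty_def)
  note int_h = integrable_Linfty_mult[OF int\<psi>]
  define E where "E n h = (\<integral>w. \<psi> (F n w) * h w \<partial>M)" for n and h :: "'a \<Rightarrow> real"
  have E_F: "1 < E n (F n)" for n
  proof -
    have "J n \<le> E n (F n)"
      unfolding J_def E_def
      by (rule integral_mono[OF integrable_continuous_bounded[OF cont(1) FL] int_h[OF FL]])
        (rule strongly_convex_potential_gradient(1)[OF pot])
    then show ?thesis using J1[of n] by simp
  qed
  have first_order: "E n (F n) \<le> E n g" if "g \<in> Kn n" for n g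
  proof -
    have "g \<in> Linfty M M" using that by (simp add: Kn_def K_def)
    then show ?thesis
      using potential_minimizer_first_order[OF pot Kn F F_min that] int_h FL
      by (simp add: E_def right_diff_distrib)
  qed
  obtain S where S: "0 \<le> S" "\<And>x. \<bar>x\<bar> \<le> 2 * c0 + 1 \<Longrightarrow> \<bar>\<psi> x\<bar> \<le> S"
    using continuous_bounded_on_interval[OF cont(2), of "2 * c0 + 1"] by blast
  \<comment> \<open>An absorption argument. With \<open>?R = 2 * c0 + 1\<close>, the L1 norm
    \<open>?A\<close> of the gradient satisfies \<open>?A \<le> S + c0 * ?A / ?R\<close>, where
    \<open>c0 / ?R\<close> is below \<open>1 / 2\<close>; hence \<open>?A \<le> 2 * S\<close> for
    every \<open>n\<close>.\<close>
  have E_H0: "E n H0 \<le> c0 * (2 * S)" for n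
  proof -
    let ?R = "2 * c0 + 1"
    let ?A = "\<integral>w. \<bar>\<psi> (F n w)\<bar> \<partial>M"
    have pointwise: "\<bar>\<psi> x\<bar> \<le> S + \<psi> x * x / ?R" for x
    proof (cases "\<bar>x\<bar> \<le> ?R")
      case True
      have "0 \<le> \<psi> x * x / ?R" using strongly_convex_potential_gradient(2)[OF pot] c0(1) by simp
      then show ?thesis using S(2)[OF True] by linarith
    next
      case False
      have "\<bar>\<psi> x\<bar> * ?R \<le> \<bar>\<psi> x\<bar> * \<bar>x\<bar>" using False by (intro mult_left_mono) auto
      also have "\<dots> = \<psi> x * x"
        using strongly_convex_potential_gradient(2)[OF pot, of x] by (simp add: abs_mult[symmetric])
      finally have "\<bar>\<psi> x\<bar> \<le> \<psi> x * x / ?R" using c0(1) by (simp add: pos_le_divide_eq)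
      then show ?thesis using S(1) by simp
    qed
    have "E n H0 \<le> (\<integral>w. c0 * \<bar>\<psi> (F n w)\<bar> \<partial>M)"
      unfolding E_def
    proof (rule integral_mono_AE)
      show "AE w in M. \<psi> (F n w) * H0 w \<le> c0 * \<bar>\<psi> (F n w)\<bar>"
        using c0(2)
      proof eventually_elim
        case (elim w)
        then have "\<bar>\<psi> (F n w)\<bar> * \<bar>H0 w\<bar> \<le> \<bar>\<psi> (F n w)\<bar> * c0" by (intro mult_left_mono) auto
        then show ?case
          using abs_ge_self[of "\<psi> (F n w) * H0 w"] by (simp add: abs_mult mult.commute)
      qed
    qed (use int_h[OF H0(1)] int\<psi> in auto)
    then have le: "E n H0 \<le> c0 * ?A" by simp
    have "?A \<le> (\<integral>w. S + \<psi> (F n w) * F n w / ?R \<partial>M)"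
      by (rule integral_mono) (use int\<psi> int_h[OF FL] pointwise in auto)
    also have "\<dots> = S + E n (F n) / ?R"
      using int_h[OF FL] by (simp add: E_def prob_space)
    also have "\<dots> \<le> S + c0 * ?A / ?R"
      using first_order[OF H0n, of n] le c0(1) by (intro add_left_mono divide_right_mono) auto
    finally have "?A * ?R \<le> S * ?R + c0 * ?A"
      using c0(1) by (simp add: field_simps)
    moreover have "0 \<le> ?A" by simp
    then have "0 \<le> c0 * ?A" using c0(1) by simp
    ultimately have "?A * (c0 + 1) \<le> S * (2 * c0 + 1)" by (simp add: algebra_simps)
    also have "\<dots> \<le> (2 * S) * (c0 + 1)" using S(1) by (simp add: algebra_simps)
    finally have "?A \<le> 2 * S" using c0(1) by (simp add: mult_le_cancel_right)
    then have "c0 * ?A \<le> c0 * (2 * S)" using c0(1) by (rule mult_left_mono)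
    then show ?thesis using le by simp
  qed
  have B: "E n (F n) \<le> c0 * (2 * S)" for n
    using first_order[OF H0n, of n] E_H0[of n] by simp
  note lim = tendsto_integral_superlinear[OF cont(2) strongly_convex_potential_gradient(2)[OF pot], of "\<lambda>k. F (r k)" f "c0 * (2 * S)"]
  have BI: "(\<integral>w. \<psi> (F (r k) w) * F (r k) w \<partial>M) \<le> c0 * (2 * S)" for k
    using B[of "r k"] by (simp add: E_def)
  have int\<xi>: "integrable M (\<lambda>w. \<psi> (f w))" by (rule lim(1)[OF FL f BI])
  have lim_E: "(\<lambda>k. E (r k) h) \<longlonglongrightarrow> (\<integral>w. \<psi> (f w) * h w \<partial>M)" if "h \<in> Linfty M M" for h
    unfolding E_def by (rule lim(2)[OF FL f BI that])
  have "(\<integral>w. \<psi> (f w) * H w \<partial>M) \<le> 0" if H: "H \<in> C" for H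
  proof -
    have HL: "H \<in> Linfty M M" by (rule bounded_closed_convexD(1)[OF C H])
    obtain c where c: "1 \<le> c" "AE w in M. \<bar>H w\<bar> \<le> c" by (rule Linfty_boundE[OF HL])
    \<comment> \<open>Testing the first-order condition with \<open>H0 - (n / c) * H\<close>, which
      lies in the \<open>n\<close>-th set, bounds \<open>n * E n H\<close> independently of
      \<open>n\<close>. As \<open>n\<close> grows, only a nonpositive limit is possible.\<close>
    have bound: "real n * E n H \<le> c0 * (2 * S) * c" for n
    proof -
      have "(\<lambda>w. H0 w - (real n / c) * H w) \<in> Kn n"
        using c by (intro in_Kn[OF H _ c(2)]) auto
      from first_order[OF this] have "E n (F n) \<le> E n (\<lambda>w. H0 w - (real n / c) * H w)" .
      moreover have "E n (\<lambda>w. H0 w - (real n / c) * H w) = E n H0 - (real n / c) * E n H"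
      proof -
        have "E n (\<lambda>w. H0 w - (real n / c) * H w)
            = (\<integral>w. \<psi> (F n w) * H0 w - (real n / c) * (\<psi> (F n w) * H w) \<partial>M)"
          by (simp add: E_def algebra_simps)
        then show ?thesis
          using int_h[OF H0(1), of n] int_h[OF HL, of n] by (simp add: E_def)
      qed
      ultimately have "(real n / c) * E n H \<le> c0 * (2 * S)" using E_F[of n] E_H0[of n] by linarith
      then show ?thesis using c(1) by (simp add: pos_divide_le_eq)
    qed
    have "(\<lambda>k. c0 * (2 * S) * c * inverse (real (Suc k))) \<longlonglongrightarrow> c0 * (2 * S) * c * 0"
      by (intro tendsto_intros LIMSEQ_inverse_real_of_nat)
    then have lim0: "(\<lambda>k. c0 * (2 * S) * c * inverse (real (Suc k))) \<longlonglongrightarrow> 0" by simp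
    have le: "E (r (Suc k)) H \<le> c0 * (2 * S) * c * inverse (real (Suc k))" for k
    proof -
      have rk: "real (Suc k) \<le> real (r (Suc k))"
        using strict_mono_imp_increasing[OF r, of "Suc k"] by simp
      have "E (r (Suc k)) H \<le> c0 * (2 * S) * c / real (r (Suc k))"
        using bound[of "r (Suc k)"] rk by (simp add: pos_le_divide_eq mult.commute)
      also have "\<dots> \<le> c0 * (2 * S) * c / real (Suc k)"
        using rk c0(1) S(1) c(1) by (intro divide_left_mono) auto
      finally show ?thesis by (simp add: divide_inverse)
    qed
    show ?thesis
      by (rule LIMSEQ_le[OF LIMSEQ_Suc[OF lim_E[OF HL]] lim0]) (use le in blast)
  qed
  \<comment> \<open>The gap of the potential survives the limit: \<open>E n H0\<close> dominates
    \<open>E n (F n)\<close>, which in turn dominates the minimal cost.\<close>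
  moreover have "1 \<le> (\<integral>w. \<psi> (f w) * H0 w \<partial>M)"
  proof (rule LIMSEQ_le_const[OF lim_E[OF H0(1)]])
    have "1 \<le> E (r n) H0" for n using E_F[of "r n"] first_order[OF H0n, of "r n"] by simp
    then show "\<exists>N. \<forall>n\<ge>N. 1 \<le> E (r n) H0" by blast
  qed
  ultimately show thesis using that[OF int\<xi>] by simp
qed

end

section \<open>Conditional expectation\<close>

lemma (in finite_measure) sigma_finite_subalgebraI:
  assumes "subalgebra M A"
  shows "sigma_finite_subalgebra M A"
  by (intro finite_measure_subalgebra_is_sigma_finite)
    (simp add: finite_measure_subalgebra_def finite_measure_subalgebra_axioms_def assms finite_measure_axioms)

text \<open>The test event is the set where \<open>g < f\<close>, which lies in \<open>A\<close>
  because both functions are measurable there.\<close>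

lemma AE_le_if_integral_le:
  fixes f g :: "'a \<Rightarrow> real"
  assumes A: "subalgebra M A" and f: "integrable M f" "f \<in> borel_measurable A"
    and g: "integrable M g" "g \<in> borel_measurable A"
    and le: "\<And>B. B \<in> sets A \<Longrightarrow> (\<integral>w. f w * indicator B w \<partial>M) \<le> (\<integral>w. g w * indicator B w \<partial>M)"
  shows "AE w in M. f w \<le> g w"
proof -
  have [simp]: "space A = space M" using A by (simp add: subalgebra_def)
  note [measurable] = f(2) g(2)
  define B where "B = {w \<in> space A. g w < f w}"
  have B: "B \<in> sets A" unfolding B_def by measurable
  then have B': "(indicator B :: 'a \<Rightarrow> real) \<in> Linfty M M"
    using A by (intro Linfty_indicator) (auto simp: subalgebra_def)
  have int: "integrable M (\<lambda>w. (f w - g w) * indicator B w)"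
    using f g by (intro integrable_Linfty_mult[OF _ B']) auto
  have "(\<integral>w. (f w - g w) * indicator B w \<partial>M) \<le> 0"
    using le[OF B] integrable_Linfty_mult[OF f(1) B'] integrable_Linfty_mult[OF g(1) B']
    by (simp add: left_diff_distrib)
  moreover have nn: "0 \<le> (f w - g w) * indicator B w" for w
    by (auto simp: B_def split: split_indicator)
  moreover have "0 \<le> (\<integral>w. (f w - g w) * indicator B w \<partial>M)"
    by (rule Bochner_Integration.integral_nonneg) (rule nn)
  ultimately have "AE w in M. (f w - g w) * indicator B w = 0"
    using integral_nonneg_eq_0_iff_AE[OF int] by simp
  then show ?thesis
    using AE_space by eventually_elim (auto simp: B_def indicator_def split: if_splits)
qed

context sigma_finite_subalgebra
begin

lemma integral_real_cond_exp_indicator: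
  assumes "integrable M f" "B \<in> sets F"
  shows "(\<integral>w. real_cond_exp M F f w * indicator B w \<partial>M) = (\<integral>w. f w * indicator B w \<partial>M)"
  using real_cond_exp_intA[OF assms] by (simp add: set_lebesgue_integral_def mult.commute)

lemma real_cond_exp_le_if_integral_le:
  assumes f: "integrable M f" and g: "integrable M g" "g \<in> borel_measurable F"
    and le: "\<And>B. B \<in> sets F \<Longrightarrow> (\<integral>w. f w * indicator B w \<partial>M) \<le> (\<integral>w. g w * indicator B w \<partial>M)"
  shows "AE w in M. real_cond_exp M F f w \<le> g w"
  by (rule AE_le_if_integral_le[OF subalg real_cond_exp_int(1)[OF f] _ g])
    (simp_all add: integral_real_cond_exp_indicator[OF f] le)

lemma integral_le_if_real_cond_exp_le:
  assumes f: "integrable M f" and g: "integrable M g"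
    and le: "AE w in M. real_cond_exp M F f w \<le> g w" and B: "B \<in> sets F"
  shows "(\<integral>w. f w * indicator B w \<partial>M) \<le> (\<integral>w. g w * indicator B w \<partial>M)"
proof -
  have B': "(indicator B :: 'a \<Rightarrow> real) \<in> Linfty M M"
    using B subalg by (intro Linfty_indicator) (auto simp: subalgebra_def)
  have "(\<integral>w. f w * indicator B w \<partial>M) = (\<integral>w. real_cond_exp M F f w * indicator B w \<partial>M)"
    by (rule integral_real_cond_exp_indicator[OF f B, symmetric])
  also have "\<dots> \<le> (\<integral>w. g w * indicator B w \<partial>M)"
    using le by (intro integral_mono_AE integrable_Linfty_mult[OF _ B'] real_cond_exp_int(1)[OF f] g)
      (auto elim!: eventually_mono split: split_indicator)
  finally show ?thesis .
qed

text \<open>The positive and negative parts are conditioned in \<open>ennreal\<close>, where a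
  nonnegative factor comes out without any integrability. This covers \<open>\<xi> / D\<close>,
  whose integrability is not known.\<close>

lemma real_cond_exp_mult_nonneg:
  assumes f[measurable]: "f \<in> borel_measurable F" and g[measurable]: "g \<in> borel_measurable M"
    and nn: "AE w in M. 0 \<le> f w"
  shows "AE w in M. real_cond_exp M F (\<lambda>w. f w * g w) w = f w * real_cond_exp M F g w"
proof -
  have [measurable]: "f \<in> borel_measurable M" using measurable_from_subalg[OF subalg f] .
  have 1: "AE w in M. ennreal (f w) * nn_cond_exp M F (\<lambda>w. ennreal (g w)) w
      = nn_cond_exp M F (\<lambda>w. ennreal (f w) * ennreal (g w)) w"
    by (rule nn_cond_exp_prod) measurable
  have 2: "AE w in M. ennreal (f w) * nn_cond_exp M F (\<lambda>w. ennreal (- g w)) w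
      = nn_cond_exp M F (\<lambda>w. ennreal (f w) * ennreal (- g w)) w"
    by (rule nn_cond_exp_prod) measurable
  have 3: "AE w in M. nn_cond_exp M F (\<lambda>w. ennreal (f w * g w)) w
      = nn_cond_exp M F (\<lambda>w. ennreal (f w) * ennreal (g w)) w"
    using nn by (intro nn_cond_exp_cong) (auto simp: ennreal_mult' elim!: eventually_mono)
  have 4: "AE w in M. nn_cond_exp M F (\<lambda>w. ennreal (- (f w * g w))) w
      = nn_cond_exp M F (\<lambda>w. ennreal (f w) * ennreal (- g w)) w"
    using nn by (intro nn_cond_exp_cong) (auto simp: ennreal_mult'[symmetric] elim!: eventually_mono)
  show ?thesis
    using 1 2 3 4 nn
  proof eventually_elim
    case (elim w)
    show ?case
      using elim(5)
      by (simp add: real_cond_exp_def elim(3,4) elim(1,2)[symmetric] enn2real_mult right_diff_distrib)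
  qed
qed

end

text \<open>\<open>W n\<close> is the infimum of the later \<open>X m\<close>, clipped from above by
  \<open>Y\<close>. Clipping traps it between \<open>min Y (- b)\<close> and \<open>Y\<close>, so
  its integrals converge by dominated convergence; the integrated and the conditional Fatou
  inequality both follow from this.\<close>

lemma monotone_minorant:
  fixes X :: "nat \<Rightarrow> 'a \<Rightarrow> real"
  assumes X: "\<And>n. integrable M (X n)" and Y: "integrable M Y" and b: "integrable M b"
    and lb: "\<And>n. AE w in M. - b w \<le> X n w"
    and le: "AE w in M. ereal (Y w) \<le> liminf (\<lambda>n. ereal (X n w))"
  obtains W :: "nat \<Rightarrow> 'a \<Rightarrow> real" where "\<And>n. integrable M (W n)" "\<And>n. AE w in M. W n w \<le> Y w"
    "\<And>n m. n \<le> m \<Longrightarrow> AE w in M. W n w \<le> X m w"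
    "(\<lambda>n. \<integral>w. W n w \<partial>M) \<longlonglongrightarrow> (\<integral>w. Y w \<partial>M)"
proof -
  note [measurable] = borel_measurable_integrable[OF X] borel_measurable_integrable[OF Y]
    borel_measurable_integrable[OF b]
  \<comment> \<open>The infimum is formed in the extended reals because it is known to be finite
    only almost surely.\<close>
  define V where "V n w = (INF m\<in>{n..}. ereal (min (Y w) (X m w)))" for n w
  define W where "W n w = real_of_ereal (V n w)" for n w
  have [measurable]: "W n \<in> borel_measurable M" for n unfolding W_def V_def by measurable
  have "AE w in M. \<forall>n. - b w \<le> X n w" using lb by (simp add: AE_all_countable)
  then have V: "AE w in M. \<forall>n. ereal (W n w) = V n w \<and> min (Y w) (- b w) \<le> W n w \<and> W n w \<le> Y w"
  proof eventually_elim
    case (elim w)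
    show ?case
    proof
      fix n
      have lo: "ereal (min (Y w) (- b w)) \<le> V n w"
        unfolding V_def using elim by (intro INF_greatest) (simp add: min.coboundedI2)
      have up: "V n w \<le> ereal (Y w)"
        unfolding V_def by (rule INF_lower2[of n]) auto
      obtain v where "V n w = ereal v" using lo up by (cases "V n w") (auto simp del: ereal_min)
      then show "ereal (W n w) = V n w \<and> min (Y w) (- b w) \<le> W n w \<and> W n w \<le> Y w"
        using lo up by (simp add: W_def del: ereal_min)
    qed
  qed
  have WX: "AE w in M. W n w \<le> X m w" if "n \<le> m" for n m
    using V
  proof eventually_elim
    case (elim w)
    have "V n w \<le> ereal (X m w)" unfolding V_def using that by (intro INF_lower2[of m]) auto
    then show ?case using elim[rule_format, of n] by (metis ereal_less_eq(3))
  qed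
  have bound: "AE w in M. norm (W n w) \<le> \<bar>Y w\<bar> + \<bar>b w\<bar>" for n
    using V by eventually_elim (auto simp: min_def abs_le_iff split: if_splits dest!: spec[of _ n])
  have lim: "AE w in M. (\<lambda>n. W n w) \<longlonglongrightarrow> Y w"
    using V le
  proof eventually_elim
    case (elim w)
    show ?case
    proof (rule LIMSEQ_I)
      fix e :: real assume "0 < e"
      then have "ereal (Y w - e / 2) < liminf (\<lambda>n. ereal (X n w))"
        using elim(2) by (intro less_le_trans[OF _ elim(2)]) simp
      from less_LiminfD[OF this] obtain N where N: "\<And>n. n \<ge> N \<Longrightarrow> Y w - e / 2 < X n w"
        by (auto simp: eventually_sequentially)
      have "norm (W n w - Y w) < e" if "n \<ge> N" for n
      proof -
        have "ereal (Y w - e / 2) \<le> V n w"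
          unfolding V_def using N that \<open>0 < e\<close> by (intro INF_greatest) (auto intro: less_imp_le)
        then have "Y w - e / 2 \<le> W n w" using elim(1)[rule_format, of n] by (metis ereal_less_eq(3))
        then show ?thesis using elim(1)[rule_format, of n] \<open>0 < e\<close> by (simp add: abs_if)
      qed
      then show "\<exists>N. \<forall>n\<ge>N. norm (W n w - Y w) < e" by blast
    qed
  qed
  have intW: "integrable M (W n)" for n
    by (rule Bochner_Integration.integrable_bound[of M "\<lambda>w. \<bar>Y w\<bar> + \<bar>b w\<bar>"])
      (use bound Y b in \<open>auto elim!: eventually_mono\<close>)
  have "(\<lambda>n. \<integral>w. W n w \<partial>M) \<longlonglongrightarrow> (\<integral>w. Y w \<partial>M)"
    by (rule integral_dominated_convergence[OF _ _ _ lim bound]) (use Y b in auto)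
  moreover have "AE w in M. W n w \<le> Y w" for n using V by eventually_elim simp
  ultimately show thesis using that[of W] intW WX by blast
qed

text \<open>Since \<open>W n \<le> Y\<close>, the L1 distance of the conditional expectations is
  just the difference of the integrals, which tends to 0. An almost surely convergent subsequence of
  the minorants then carries the inequality through the conditioning.\<close>

lemma (in sigma_finite_subalgebra) real_cond_exp_Fatou:
  fixes X :: "nat \<Rightarrow> 'a \<Rightarrow> real"
  assumes X: "\<And>n. integrable M (X n)" and Y: "integrable M Y" and b: "integrable M b"
    and lb: "\<And>n. AE w in M. - b w \<le> X n w"
    and le: "AE w in M. ereal (Y w) \<le> liminf (\<lambda>n. ereal (X n w))"
  shows "AE w in M. ereal (real_cond_exp M F Y w) \<le> liminf (\<lambda>n. ereal (real_cond_exp M F (X n) w))"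
proof -
  obtain W where W: "\<And>n. integrable M (W n)" "\<And>n. AE w in M. W n w \<le> Y w"
    "\<And>n m. n \<le> m \<Longrightarrow> AE w in M. W n w \<le> X m w" "(\<lambda>n. \<integral>w. W n w \<partial>M) \<longlonglongrightarrow> (\<integral>w. Y w \<partial>M)"
    by (rule monotone_minorant[OF X Y b lb le]) blast
  let ?D = "\<lambda>n w. real_cond_exp M F (W n) w - real_cond_exp M F Y w"
  have int: "integrable M (?D n)" for n using real_cond_exp_int(1)[OF W(1)] real_cond_exp_int(1)[OF Y] by simp
  have "(\<integral>w. norm (?D n w) \<partial>M) = (\<integral>w. Y w \<partial>M) - (\<integral>w. W n w \<partial>M)" for n
  proof -
    have "(\<integral>w. norm (?D n w) \<partial>M) = (\<integral>w. real_cond_exp M F Y w - real_cond_exp M F (W n) w \<partial>M)"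
      using real_cond_exp_mono[OF W(2) W(1) Y, of n]
      by (intro integral_cong_AE) (auto elim!: eventually_mono)
    then show ?thesis
      using real_cond_exp_int[OF W(1)] real_cond_exp_int[OF Y] by simp
  qed
  moreover have "(\<lambda>n. (\<integral>w. Y w \<partial>M) - (\<integral>w. W n w \<partial>M)) \<longlonglongrightarrow> (\<integral>w. Y w \<partial>M) - (\<integral>w. Y w \<partial>M)"
    by (intro tendsto_diff tendsto_const W(4))
  ultimately have "(\<lambda>n. \<integral>w. norm (?D n w) \<partial>M) \<longlonglongrightarrow> 0" by simp
  from tendsto_L1_AE_subseq[OF int this] obtain r
    where r: "strict_mono r" "AE w in M. (\<lambda>n. ?D (r n) w) \<longlonglongrightarrow> 0" by blast
  have "AE w in M. \<forall>n. \<forall>m. n \<le> m \<longrightarrow> real_cond_exp M F (W n) w \<le> real_cond_exp M F (X m) w"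
    using real_cond_exp_mono[OF W(3) W(1) X] by (simp add: AE_all_countable AE_conjI)
  with r(2) show ?thesis
  proof eventually_elim
    case (elim w)
    have "(\<lambda>n. ?D (r n) w + real_cond_exp M F Y w) \<longlonglongrightarrow> 0 + real_cond_exp M F Y w"
      by (intro tendsto_add elim(1) tendsto_const)
    then have lim: "(\<lambda>n. ereal (real_cond_exp M F (W (r n)) w)) \<longlonglongrightarrow> ereal (real_cond_exp M F Y w)"
      by (intro tendsto_ereal) simp
    have "ereal (real_cond_exp M F (W k) w) \<le> liminf (\<lambda>n. ereal (real_cond_exp M F (X n) w))" for k
      using elim(2) by (intro Liminf_bounded) (auto simp: eventually_sequentially)
    then show ?case by - (rule LIMSEQ_le_const2[OF lim], blast)
  qed
qed

section \<open>Coherent evaluations\<close>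

text \<open>There are two instances: \<open>PG\<close> on \<open>G\<close> with weight 1, and
  \<open>PF\<close> on \<open>FS\<close> with weight \<open>D\<close>. Integrability of
  \<open>D * P H\<close> is all that is known of the values of \<open>PF\<close> in general.\<close>

locale weighted_coherent_evaluation = prob_space M for M :: "'a measure" +
  fixes A :: "'a measure" and D :: "'a \<Rightarrow> real" and P :: "('a \<Rightarrow> real) \<Rightarrow> ('a \<Rightarrow> real)"
  assumes subalg: "subalgebra M A"
    and D_meas: "D \<in> borel_measurable A" and D_int: "integrable M D" and D_pos: "AE w in M. 0 < D w"
    and coherent: "coherent_evaluation M A (L1_density M A D) P"
begin

sublocale A: sigma_finite_subalgebra M A
  by (rule sigma_finite_subalgebraI[OF subalg])

lemma space_A [simp]: "space A = space M"
  using subalg by (simp add: subalgebra_def)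

lemma sets_A: "B \<in> sets A \<Longrightarrow> B \<in> sets M"
  using subalg by (auto simp: subalgebra_def)

lemma P_meas_A: "H \<in> Linfty M M \<Longrightarrow> P H \<in> borel_measurable A"
  using coherent
  by (auto simp: coherent_evaluation_def cond_evaluation_def Linfty_map_def L1_density_def)

lemma P_meas: "H \<in> Linfty M M \<Longrightarrow> P H \<in> borel_measurable M"
  using measurable_from_subalg[OF subalg P_meas_A] .

lemma integrable_P: "H \<in> Linfty M M \<Longrightarrow> integrable M (\<lambda>w. D w * P H w)"
  using coherent
  by (auto simp: coherent_evaluation_def cond_evaluation_def Linfty_map_def L1_density_def)

lemma DP_meas_A: "H \<in> Linfty M M \<Longrightarrow> (\<lambda>w. D w * P H w) \<in> borel_measurable A"
  using P_meas_A D_meas by (intro borel_measurable_times)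

lemma P_cong:
  "H \<in> Linfty M M \<Longrightarrow> H' \<in> Linfty M M \<Longrightarrow> AE w in M. H w = H' w \<Longrightarrow> AE w in M. P H w = P H' w"
  using coherent by (auto simp: coherent_evaluation_def cond_evaluation_def Linfty_map_def)

lemma P_cash:
  "H \<in> Linfty M M \<Longrightarrow> m \<in> Linfty M A \<Longrightarrow> AE w in M. P (\<lambda>w. H w + m w) w = P H w + m w"
  using coherent by (auto simp: coherent_evaluation_def cond_evaluation_def cash_invariant_def)

lemma P_scale:
  "H \<in> Linfty M M \<Longrightarrow> l \<in> Linfty M A \<Longrightarrow> AE w in M. 0 \<le> l w \<Longrightarrow>
    AE w in M. P (\<lambda>w. l w * H w) w = l w * P H w"
  using coherent by (auto simp: coherent_evaluation_def)

lemma P_zero: "AE w in M. P (\<lambda>_. 0) w = 0"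
  using coherent by (auto simp: coherent_evaluation_def cond_evaluation_def normalized_def)

lemma P_convex:
  assumes "H1 \<in> Linfty M M" "H2 \<in> Linfty M M" "0 \<le> u" "u \<le> 1"
  shows "AE w in M. P (\<lambda>w. u * H1 w + (1 - u) * H2 w) w \<le> u * P H1 w + (1 - u) * P H2 w"
proof -
  have C: "cond_convex M A P" using coherent by (simp add: coherent_evaluation_def cond_evaluation_def)
  show ?thesis
    by (rule C[unfolded cond_convex_def, rule_format, of H1 H2 "\<lambda>_. u"]) (use assms Linfty_const in auto)
qed

lemma P_Fatou:
  assumes "\<And>n. Hs n \<in> borel_measurable M" "\<And>n. AE w in M. \<bar>Hs n w\<bar> \<le> c"
    "H \<in> Linfty M M" "AE w in M. (\<lambda>n::nat. Hs n w) \<longlonglongrightarrow> H w"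
  shows "AE w in M. ereal (P H w) \<le> liminf (\<lambda>n. ereal (P (Hs n) w))"
proof -
  have F: "fatou_property M P" using coherent by (simp add: coherent_evaluation_def cond_evaluation_def)
  show ?thesis
    by (rule F[unfolded fatou_property_def, rule_format, of H Hs]) (use assms in auto)
qed

section \<open>Sublinearity, locality and pasting\<close>

lemma P_const:
  assumes "0 \<le> c" "H \<in> Linfty M M"
  shows "AE w in M. P (\<lambda>w. c * H w) w = c * P H w"
  using P_scale[OF assms(2) Linfty_const, of c] assms(1) by simp

text \<open>Convexity with weight 1/2, followed by homogeneity with factor 2.\<close>

lemma P_add_le:
  assumes H: "H1 \<in> Linfty M M" "H2 \<in> Linfty M M"
  shows "AE w in M. P (\<lambda>w. H1 w + H2 w) w \<le> P H1 w + P H2 w"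
proof -
  let ?H = "\<lambda>w. (1/2) * H1 w + (1 - 1/2) * H2 w"
  have "AE w in M. P (\<lambda>w. 2 * ?H w) w = 2 * P ?H w"
    by (intro P_const Linfty_intros H) simp
  moreover have "(\<lambda>w. 2 * ?H w) = (\<lambda>w. H1 w + H2 w)" by auto
  ultimately have "AE w in M. P (\<lambda>w. H1 w + H2 w) w = 2 * P ?H w" by simp
  moreover have "AE w in M. P ?H w \<le> 1/2 * P H1 w + (1 - 1/2) * P H2 w"
    by (rule P_convex[OF H]) simp_all
  ultimately show ?thesis by eventually_elim simp
qed

text \<open>In the absence of monotonicity, lower bounds for \<open>P H\<close> are obtained from
  upper bounds for the opposite payoff.\<close>

lemma P_minus:
  assumes H: "H \<in> Linfty M M"
  shows "AE w in M. - P (\<lambda>w. - H w) w \<le> P H w"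
  using P_add_le[OF H Linfty_minus[OF H]] P_zero by eventually_elim simp

lemma P_indicator:
  assumes H: "H \<in> Linfty M M" and B: "B \<in> sets A"
  shows "AE w in M. P (\<lambda>w. indicator B w * H w) w = indicator B w * P H w"
  by (rule P_scale[OF H Linfty_indicator[OF B]]) simp

lemma P_local:
  assumes H: "H \<in> Linfty M M" "H' \<in> Linfty M M" and B: "B \<in> sets A"
    and eq: "\<And>w. w \<in> B \<Longrightarrow> H w = H' w"
  shows "AE w in M. w \<in> B \<longrightarrow> P H w = P H' w"
proof -
  have "(\<lambda>w. indicator B w * H w) = (\<lambda>w. indicator B w * H' w)"
    using eq by (auto split: split_indicator)
  with P_indicator[OF H(1) B] have "AE w in M. P (\<lambda>w. indicator B w * H' w) w = indicator B w * P H w"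
    by simp
  with P_indicator[OF H(2) B] show ?thesis by eventually_elim auto
qed

text \<open>An index chosen measurably in \<open>A\<close> splits the space into countably many
  events of \<open>A\<close>; locality holds on each, and countably many null sets are harmless.
  This permits selecting, point by point, a payoff from a sequence.\<close>

lemma P_paste:
  assumes Hs: "\<And>n. Hs n \<in> borel_measurable M" "\<And>n. AE w in M. \<bar>Hs n w\<bar> \<le> c"
    and N: "N \<in> measurable A (count_space (UNIV :: nat set))"
  shows "(\<lambda>w. Hs (N w) w) \<in> borel_measurable M" "AE w in M. \<bar>Hs (N w) w\<bar> \<le> c"
    "AE w in M. P (\<lambda>w. Hs (N w) w) w = P (Hs (N w)) w"
proof -
  have N' [measurable]: "N \<in> measurable M (count_space UNIV)" using measurable_from_subalg[OF subalg N] .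
  note Hs(1) [measurable]
  show meas: "(\<lambda>w. Hs (N w) w) \<in> borel_measurable M" by measurable
  have "AE w in M. \<forall>n. \<bar>Hs n w\<bar> \<le> c" using Hs(2) by (simp add: AE_all_countable)
  then show bd: "AE w in M. \<bar>Hs (N w) w\<bar> \<le> c" by eventually_elim simp
  have "(\<lambda>w. Hs (N w) w) \<in> Linfty M M" "\<And>n. Hs n \<in> Linfty M M"
    using meas bd Hs by (auto simp: Linfty_def)
  moreover have "N -` {n} \<inter> space A \<in> sets A" for n by (rule measurable_sets[OF N]) simp
  ultimately have "AE w in M. w \<in> N -` {n} \<inter> space A \<longrightarrow> P (\<lambda>w. Hs (N w) w) w = P (Hs n) w" for n
    by (intro P_local) auto
  then have "AE w in M. \<forall>n. w \<in> N -` {n} \<inter> space A \<longrightarrow> P (\<lambda>w. Hs (N w) w) w = P (Hs n) w"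
    unfolding AE_all_countable by blast
  then show "AE w in M. P (\<lambda>w. Hs (N w) w) w = P (Hs (N w)) w"
    using AE_space by eventually_elim auto
qed

text \<open>A Baire category argument in the sup norm: the sets \<open>{x. prob {w \<in> B. n < P x w} > prob B / 2}\<close>
  are open by the Fatou property and dense by sublinearity.\<close>

lemma P_not_unbounded_on:
  assumes B: "B \<in> sets A" and pos: "0 < prob B"
  shows "\<exists>K::nat. \<forall>h\<in>borel_measurable M. (\<forall>w. \<bar>h w\<bar> \<le> 1) \<longrightarrow>
    \<not> (AE w in M. w \<in> B \<longrightarrow> real K \<le> P h w)"
proof (rule ccontr)
  assume neg: "\<not> ?thesis"
  have [measurable]: "B \<in> sets M" by (rule sets_A[OF B])
  \<comment> \<open>Genuinely bounded functions instead of classes, so that distances and limits in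
    the sup norm are pointwise statements.\<close>
  define X :: "('a \<Rightarrow> real) set" where "X = {x \<in> borel_measurable M. \<exists>c. \<forall>w. \<bar>x w\<bar> \<le> c}"
  have XL: "x \<in> Linfty M M" if "x \<in> X" for x
    using that by (auto simp: X_def Linfty_def)
  define good where "good n x \<longleftrightarrow> prob B / 2 < prob {w \<in> B. real n < P x w}" for n :: nat and x
  have meas: "{w \<in> B. real n < P x w} \<in> sets M" "{w \<in> B. P x w \<le> real n} \<in> sets M" if "x \<in> X" for n x
    using P_meas[OF XL[OF that]] by measurable
  \<comment> \<open>Density and openness in one stroke: every ball contains a smaller one, of at
    most half the radius, all of whose members are good at level \<open>n\<close>.\<close>
  have step: "\<exists>x'\<in>X. \<exists>r'. 0 < r' \<and> r' \<le> r / 2 \<and> (\<forall>w. \<bar>x' w - x w\<bar> \<le> r / 2) \<and>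
      (\<forall>y\<in>X. (\<forall>w. \<bar>y w - x' w\<bar> \<le> r') \<longrightarrow> good n y)"
    if x: "x \<in> X" and r: "0 < r" for x r n
  proof -
    have mx: "(\<lambda>w. - x w) \<in> X" using x by (auto simp: X_def)
    have "(\<lambda>k. prob {w \<in> B. P (\<lambda>w. - x w) w \<le> real k}) \<longlonglongrightarrow> prob (\<Union>k. {w \<in> B. P (\<lambda>w. - x w) w \<le> real k})"
      by (rule finite_Lim_measure_incseq) (use meas[OF mx] in \<open>auto simp: incseq_def\<close>)
    moreover have "(\<Union>k. {w \<in> B. P (\<lambda>w. - x w) w \<le> real k}) = B"
      using real_arch_simple by auto
    ultimately have "(\<lambda>k. prob {w \<in> B. P (\<lambda>w. - x w) w \<le> real k}) \<longlonglongrightarrow> prob B" by simp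
    from order_tendstoD(1)[OF this, of "prob B / 2"] pos
    obtain k where k: "prob B / 2 < prob {w \<in> B. P (\<lambda>w. - x w) w \<le> real k}"
      by (auto simp: eventually_sequentially)
    \<comment> \<open>With this \<open>K\<close>, subadditivity gives
      \<open>P x' \<ge> r / 2 * K - k \<ge> n + 1\<close> on the part of \<open>B\<close> where
      \<open>P (- x) \<le> k\<close>, and that part has more than half the probability of
      \<open>B\<close>.\<close>
    obtain K :: nat where K: "(real n + 1 + real k) * (2 / r) \<le> real K" using real_arch_simple by blast
    then obtain h where h: "h \<in> borel_measurable M" "\<forall>w. \<bar>h w\<bar> \<le> 1"
      "AE w in M. w \<in> B \<longrightarrow> real K \<le> P h w"
      using neg by blast
    have hX: "h \<in> X" using h by (auto simp: X_def)
    define x' where "x' w = x w + r / 2 * h w" for w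
    have dist: "\<bar>x' w - x w\<bar> \<le> r / 2" for w
      using h(2)[rule_format, of w] r by (simp add: x'_def abs_mult mult_left_le)
    have x'X: "x' \<in> X"
    proof -
      obtain c where c: "\<And>w. \<bar>x w\<bar> \<le> c" using x by (auto simp: X_def)
      have "\<bar>x' w\<bar> \<le> c + r / 2" for w using c[of w] dist[of w] by linarith
      moreover have "x' \<in> borel_measurable M"
        unfolding x'_def using x h(1) by (auto simp: X_def)
      ultimately show ?thesis by (auto simp: X_def)
    qed
    have "AE w in M. w \<in> B \<longrightarrow> P (\<lambda>w. - x w) w \<le> real k \<longrightarrow> real n < P x' w"
    proof -
      have "(\<lambda>w. x' w + - x w) = (\<lambda>w. r / 2 * h w)" by (simp add: x'_def)
      then have "AE w in M. P (\<lambda>w. r / 2 * h w) w \<le> P x' w + P (\<lambda>w. - x w) w"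
        using P_add_le[OF XL[OF x'X] XL[OF mx]] by simp
      moreover have "AE w in M. P (\<lambda>w. r / 2 * h w) w = r / 2 * P h w"
        using r by (intro P_const XL[OF hX]) simp
      ultimately show ?thesis
        using h(3)
      proof eventually_elim
        case (elim w)
        have "real n + 1 + real k \<le> r / 2 * real K" using K r by (simp add: field_simps)
        moreover have "r / 2 * real K \<le> r / 2 * P h w" if "w \<in> B"
          using elim(3) that r by (intro mult_left_mono) auto
        ultimately show ?case using elim(1,2) by linarith
      qed
    qed
    then have "prob {w \<in> B. P (\<lambda>w. - x w) w \<le> real k} \<le> prob {w \<in> B. real n < P x' w}"
      by (intro finite_measure_mono_AE meas x'X) (auto elim!: eventually_mono)
    then have good': "prob B / 2 < prob {w \<in> B. real n < P x' w}" using k by simp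
    \<comment> \<open>If no radius worked, bad functions would converge uniformly to
      \<open>x'\<close>; the Fatou property, followed by Fatou's lemma for the indicators, would
      then make \<open>x'\<close> bad as well.\<close>
    have "\<exists>j::nat. \<forall>y\<in>X. (\<forall>w. \<bar>y w - x' w\<bar> \<le> min (r / 2) (inverse (real (Suc j)))) \<longrightarrow> good n y"
    proof (rule ccontr)
      assume "\<not> ?thesis"
      then have "\<forall>j::nat. \<exists>y. y \<in> X \<and> (\<forall>w. \<bar>y w - x' w\<bar> \<le> min (r / 2) (inverse (real (Suc j)))) \<and> \<not> good n y"
        by blast
      from choice[OF this] obtain y where y: "\<And>j. y j \<in> X"
        "\<And>j w. \<bar>y j w - x' w\<bar> \<le> min (r / 2) (inverse (real (Suc j)))" "\<And>j. \<not> good n (y j)"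
        by blast
      obtain c where c: "\<And>w. \<bar>x' w\<bar> \<le> c" using x'X by (auto simp: X_def)
      have lim: "(\<lambda>j. y j w) \<longlonglongrightarrow> x' w" for w
      proof (rule LIM_zero_cancel, rule Lim_null_comparison[OF _ LIMSEQ_inverse_real_of_nat])
        show "\<forall>\<^sub>F j in sequentially. norm (y j w - x' w) \<le> inverse (real (Suc j))"
          using y(2)[of _ w] by (intro always_eventually) simp
      qed
      have "AE w in M. ereal (P x' w) \<le> liminf (\<lambda>j. ereal (P (y j) w))"
      proof (rule P_Fatou[of y "c + r / 2"])
        show "y j \<in> borel_measurable M" for j using y(1) by (simp add: X_def)
        show "AE w in M. \<bar>y j w\<bar> \<le> c + r / 2" for j
        proof (rule AE_I2)
          fix w
          show "\<bar>y j w\<bar> \<le> c + r / 2" using c[of w] y(2)[of j w] by linarith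
        qed
      qed (use lim XL[OF x'X] in auto)
      then have "AE w in M. indicator {w \<in> B. real n < P x' w} w
          \<le> liminf (\<lambda>j. indicator {w \<in> B. real n < P (y j) w} w :: ennreal)"
      proof eventually_elim
        case (elim w)
        show ?case
        proof (cases "w \<in> B \<and> real n < P x' w")
          case True
          then have "ereal (real n) < liminf (\<lambda>j. ereal (P (y j) w))"
            using elim by (meson ereal_less_le ereal_less(1) less_ereal.simps(1) less_le_trans)
          from less_LiminfD[OF this]
          have "\<forall>\<^sub>F j in sequentially. (1::ennreal) \<le> indicator {w \<in> B. real n < P (y j) w} w"
            by eventually_elim (use True in simp)
          then have "(1::ennreal) \<le> liminf (\<lambda>j. indicator {w \<in> B. real n < P (y j) w} w)"
            by (rule Liminf_bounded)
          then show ?thesis using True by simp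
        qed auto
      qed
      then have "(\<integral>\<^sup>+w. indicator {w \<in> B. real n < P x' w} w \<partial>M)
          \<le> (\<integral>\<^sup>+w. liminf (\<lambda>j. indicator {w \<in> B. real n < P (y j) w} w) \<partial>M)"
        by (rule nn_integral_mono_AE)
      also have "\<dots> \<le> liminf (\<lambda>j. \<integral>\<^sup>+w. indicator {w \<in> B. real n < P (y j) w} w \<partial>M)"
        by (rule nn_integral_liminf) (use meas(1)[OF y(1)] in measurable)
      also have "\<dots> \<le> liminf (\<lambda>j. ennreal (prob B / 2))"
      proof (rule Liminf_mono, rule always_eventually, rule allI)
        fix j
        show "(\<integral>\<^sup>+w. indicator {w \<in> B. real n < P (y j) w} w \<partial>M) \<le> ennreal (prob B / 2)"
          using y(3)[of j] meas(1)[OF y(1), of n j]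
          by (simp add: good_def emeasure_eq_measure ennreal_leI)
      qed
      finally have "prob {w \<in> B. real n < P x' w} \<le> prob B / 2"
        using meas(1)[OF x'X, of n] by (simp add: emeasure_eq_measure Liminf_const)
      then show False using good' by simp
    qed
    then obtain j :: nat where j:
      "\<forall>y\<in>X. (\<forall>w. \<bar>y w - x' w\<bar> \<le> min (r / 2) (inverse (real (Suc j)))) \<longrightarrow> good n y" ..
    show ?thesis
      by (intro bexI[OF _ x'X] exI[of _ "min (r / 2) (inverse (real (Suc j)))"]) (use r dist j in auto)
  qed
  define ok where "ok n p \<longleftrightarrow> fst p \<in> X \<and> 0 < snd p \<and> (\<forall>y\<in>X. (\<forall>w. \<bar>y w - fst p w\<bar> \<le> snd p) \<longrightarrow> good n y)"
    for n and p :: "('a \<Rightarrow> real) \<times> real"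
  define succ where "succ p q \<longleftrightarrow> snd q \<le> snd p / 2 \<and> (\<forall>w. \<bar>fst q w - fst p w\<bar> \<le> snd p / 2)"
    for p q :: "('a \<Rightarrow> real) \<times> real"
  have next_ok: "\<exists>q. ok n q \<and> succ p q" if p: "fst p \<in> X" "0 < snd p" for n p
  proof -
    obtain x' r' where "x' \<in> X" "0 < r'" "r' \<le> snd p / 2" "\<forall>w. \<bar>x' w - fst p w\<bar> \<le> snd p / 2"
      "\<forall>y\<in>X. (\<forall>w. \<bar>y w - x' w\<bar> \<le> r') \<longrightarrow> good n y"
      using step[OF p, of n] by blast
    then show ?thesis by (intro exI[of _ "(x', r')"]) (simp add: ok_def succ_def)
  qed
  have "\<exists>f. \<forall>n. ok n (f n) \<and> succ (f n) (f (Suc n))"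
  proof (rule dependent_nat_choice)
    have "(\<lambda>_. 0) \<in> X" by (auto simp: X_def)
    then show "\<exists>p. ok 0 p" using next_ok[of "(\<lambda>_. 0, 1)" 0] by auto
    show "\<exists>q. ok (Suc n) q \<and> succ p q" if "ok n p" for p n
      using next_ok[of p "Suc n"] that by (auto simp: ok_def)
  qed
  then obtain f where f: "\<And>n. ok n (f n)" "\<And>n. succ (f n) (f (Suc n))" by blast
  define x where "x n = fst (f n)" for n
  define r where "r n = snd (f n)" for n
  have xX: "x n \<in> X" and r_pos: "0 < r n"
    and ball: "\<And>y. y \<in> X \<Longrightarrow> (\<And>w. \<bar>y w - x n w\<bar> \<le> r n) \<Longrightarrow> good n y" for n
    using f(1)[of n] by (auto simp: ok_def x_def r_def)
  have r_Suc: "r (Suc n) \<le> r n / 2" and x_Suc: "\<bar>x (Suc n) w - x n w\<bar> \<le> r n / 2" for n w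
    using f(2)[of n] by (auto simp: succ_def x_def r_def)
  \<comment> \<open>Telescoping: each step is at most \<open>r m / 2 \<le> r m - r (Suc m)\<close>.
    Hence all later centres, and their limit \<open>z\<close>, stay in the closed ball of radius
    \<open>r n\<close>.\<close>
  have x_dist: "\<bar>x m w - x n w\<bar> \<le> r n - r m" if "n \<le> m" for n m w
    using that
  proof (induction rule: dec_induct)
    case (step m)
    then show ?case using r_Suc[of m] x_Suc[of m w] by linarith
  qed simp
  have r_le: "r n \<le> r 0 * (1 / 2) ^ n" for n
  proof (induction n)
    case (Suc n)
    then show ?case using r_Suc[of n] by simp
  qed simp
  have "(\<lambda>n. r 0 * (1 / 2) ^ n) \<longlonglongrightarrow> r 0 * 0"
    by (intro tendsto_intros LIMSEQ_power_zero) simp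
  then have r_lim: "r \<longlonglongrightarrow> 0"
    by (intro tendsto_sandwich[OF _ _ tendsto_const[of 0], of r _ "\<lambda>n. r 0 * (1 / 2) ^ n"])
      (use r_le r_pos less_imp_le in \<open>auto intro!: always_eventually\<close>)
  have "Cauchy (\<lambda>n. x n w)" for w
  proof (rule metric_CauchyI)
    fix e :: real assume "0 < e"
    then obtain N where N: "r N < e / 2"
      using order_tendstoD(2)[OF r_lim, of "e / 2"] by (auto simp: eventually_sequentially)
    have near: "\<bar>x m w - x N w\<bar> < e / 2" if "m \<ge> N" for m
      using x_dist[OF that, of w] r_pos[of m] N by linarith
    have "dist (x m w) (x n w) < e" if "m \<ge> N" "n \<ge> N" for m n
      using near[OF that(1)] near[OF that(2)] unfolding dist_real_def by linarith
    then show "\<exists>N. \<forall>m\<ge>N. \<forall>n\<ge>N. dist (x m w) (x n w) < e" by blast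
  qed
  then have x_lim: "(\<lambda>n. x n w) \<longlonglongrightarrow> lim (\<lambda>n. x n w)" for w
    by (simp add: Cauchy_convergent_iff convergent_LIMSEQ_iff)
  define z where "z w = lim (\<lambda>n. x n w)" for w
  have z_dist: "\<bar>z w - x n w\<bar> \<le> r n" for n w
  proof (rule LIMSEQ_le_const2[of "\<lambda>m. \<bar>x m w - x n w\<bar>"])
    show "(\<lambda>m. \<bar>x m w - x n w\<bar>) \<longlonglongrightarrow> \<bar>z w - x n w\<bar>"
      unfolding z_def by (intro tendsto_rabs tendsto_diff tendsto_const x_lim)
    show "\<exists>N. \<forall>m\<ge>N. \<bar>x m w - x n w\<bar> \<le> r n"
    proof (intro exI[of _ n] allI impI)
      fix m assume "n \<le> m"
      then show "\<bar>x m w - x n w\<bar> \<le> r n" using x_dist[of n m w] r_pos[of m] by linarith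
    qed
  qed
  have zX: "z \<in> X"
  proof -
    obtain c where c: "\<And>w. \<bar>x 0 w\<bar> \<le> c" using xX[of 0] by (auto simp: X_def)
    have "\<bar>z w\<bar> \<le> c + r 0" for w using c[of w] z_dist[of w 0] by linarith
    moreover have "z \<in> borel_measurable M"
      unfolding z_def using xX by (intro borel_measurable_lim_metric) (simp add: X_def)
    ultimately show ?thesis by (auto simp: X_def)
  qed
  \<comment> \<open>\<open>z\<close> is good at every level, yet the events where
    \<open>n < P z\<close> shrink to the empty set because \<open>P z\<close> is
    real-valued.\<close>
  have gt: "prob B / 2 < prob {w \<in> B. real n < P z w}" for n
    using ball[OF zX z_dist] by (simp add: good_def)
  have "(\<lambda>n. prob {w \<in> B. real n < P z w}) \<longlonglongrightarrow> prob (\<Inter>n. {w \<in> B. real n < P z w})"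
    by (rule finite_Lim_measure_decseq) (use meas[OF zX] in \<open>auto simp: decseq_def\<close>)
  moreover have "\<exists>n. \<not> real n < P z w" for w
    using real_arch_simple[of "P z w"] by (simp add: not_less)
  then have "(\<Inter>n. {w \<in> B. real n < P z w}) = {}" by blast
  ultimately have lim: "(\<lambda>n. prob {w \<in> B. real n < P z w}) \<longlonglongrightarrow> 0" by simp
  have "prob B / 2 \<le> 0"
    by (rule LIMSEQ_le_const[OF lim]) (use gt less_imp_le in blast)
  then show False using pos by simp
qed

text \<open>Pasting, at each point, the first payoff whose value is within 1 of all the others gives
  \<open>H\<close>. Such an index exists where the values are bounded above, and the Baire argument
  shows that this is almost everywhere.\<close>

lemma near_maximum:
  assumes Hs: "\<And>n::nat. Hs n \<in> borel_measurable M" "\<And>n. AE w in M. \<bar>Hs n w\<bar> \<le> 1"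
  obtains H where "H \<in> borel_measurable M" "AE w in M. \<bar>H w\<bar> \<le> 1"
    "\<And>n. AE w in M. P (Hs n) w \<le> P H w + 1"
proof -
  have HsL: "Hs n \<in> Linfty M M" for n by (rule LinftyI[OF Hs])
  have [measurable]: "P (Hs n) \<in> borel_measurable A" for n by (rule P_meas_A[OF HsL])
  define B where "B = {w \<in> space A. \<forall>k::nat. \<exists>n. real k \<le> P (Hs n) w}"
  have B: "B \<in> sets A" unfolding B_def by measurable
  have "prob B = 0"
  proof (rule ccontr)
    assume "prob B \<noteq> 0"
    then have "0 < prob B" using measure_nonneg[of M B] by linarith
    then obtain K :: nat where K: "\<And>h. h \<in> borel_measurable M \<Longrightarrow> (\<And>w. \<bar>h w\<bar> \<le> 1) \<Longrightarrow>
        \<not> (AE w in M. w \<in> B \<longrightarrow> real K \<le> P h w)"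
      using P_not_unbounded_on[OF B] by blast
    define N where "N w = (LEAST n. real K \<le> P (Hs n) w)" for w
    have N: "N \<in> measurable A (count_space UNIV)" unfolding N_def by measurable
    note paste = P_paste[where Hs=Hs and N=N, OF Hs N]
    \<comment> \<open>The pasted payoff is bounded by 1 only almost surely; clipping makes the bound
      hold everywhere, as the Baire lemma requires, without leaving the class.\<close>
    define h where "h w = max (- 1) (min 1 (Hs (N w) w))" for w
    have h_meas: "h \<in> borel_measurable M" unfolding h_def using paste(1) by measurable
    have h1: "\<bar>h w\<bar> \<le> 1" for w by (auto simp: h_def)
    have "AE w in M. P h w = P (\<lambda>w. Hs (N w) w) w"
    proof (rule P_cong)
      show "h \<in> Linfty M M" using h_meas h1 by (auto simp: Linfty_def)
      show "(\<lambda>w. Hs (N w) w) \<in> Linfty M M" by (rule LinftyI[OF paste(1,2)])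
      show "AE w in M. h w = Hs (N w) w"
        using paste(2) by eventually_elim (auto simp: h_def)
    qed
    then have "AE w in M. w \<in> B \<longrightarrow> real K \<le> P h w"
      using paste(3)
    proof eventually_elim
      case (elim w)
      have "real K \<le> P (Hs (N w)) w" if "w \<in> B"
        unfolding N_def by (rule LeastI_ex) (use that in \<open>simp add: B_def\<close>)
      then show ?case using elim by simp
    qed
    then show False using K[OF h_meas h1] by blast
  qed
  then have "AE w in M. w \<notin> B"
    using sets_A[OF B] by (simp add: prob_eq_0)
  then have bdd: "AE w in M. \<exists>k::nat. \<forall>n. P (Hs n) w < real k"
    using AE_space by eventually_elim (auto simp: B_def not_le)
  define N where "N w = (LEAST n. \<forall>m. P (Hs m) w \<le> P (Hs n) w + 1)" for w
  have N: "N \<in> measurable A (count_space UNIV)" unfolding N_def by measurable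
  note paste = P_paste[where Hs=Hs and N=N, OF Hs N]
  have "AE w in M. \<forall>n. P (Hs n) w \<le> P (\<lambda>w. Hs (N w) w) w + 1"
    using bdd paste(3)
  proof eventually_elim
    case (elim w)
    then obtain k :: nat where k: "\<And>n. P (Hs n) w < real k" by blast
    have bd: "bdd_above (range (\<lambda>n. P (Hs n) w))"
      by (rule bdd_aboveI[of _ "real k"]) (use k less_imp_le in auto)
    have "(SUP n. P (Hs n) w) - 1 < (SUP n. P (Hs n) w)" by simp
    then obtain n where n: "(SUP n. P (Hs n) w) - 1 < P (Hs n) w"
      using less_cSUP_iff[OF _ bd] by blast
    have "P (Hs m) w \<le> P (Hs n) w + 1" for m
      using cSUP_upper[OF UNIV_I bd, of m] n by linarith
    then have "\<forall>m. P (Hs m) w \<le> P (Hs (N w)) w + 1"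
      unfolding N_def by (intro LeastI_ex[of "\<lambda>n. \<forall>m. P (Hs m) w \<le> P (Hs n) w + 1"]) blast
    then show ?case using elim(2) by simp
  qed
  then have "AE w in M. P (Hs n) w \<le> P (\<lambda>w. Hs (N w) w) w + 1" for n
    by eventually_elim blast
  then show thesis using that paste(1,2) by blast
qed

text \<open>A near maximum of the normalized opposite payoffs bounds all \<open>P (- Hs n)\<close>
  from above at once, and \<open>P_minus\<close> turns this into one integrable lower bound. Both
  Fatou inequalities below depend on it.\<close>

lemma integrable_lower_bound:
  assumes Hs: "\<And>n::nat. Hs n \<in> borel_measurable M" "\<And>n. AE w in M. \<bar>Hs n w\<bar> \<le> c"
  obtains b where "integrable M b" "\<And>n. AE w in M. - b w \<le> D w * P (Hs n) w"
proof -
  define c' where "c' = max 1 c"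
  have c': "0 < c'" "c \<le> c'" by (auto simp: c'_def)
  define Gs where "Gs n w = inverse c' * - Hs n w" for n w
  have Gs: "Gs n \<in> borel_measurable M" "AE w in M. \<bar>Gs n w\<bar> \<le> 1" for n
  proof -
    show "Gs n \<in> borel_measurable M" unfolding Gs_def using Hs(1) by measurable
    show "AE w in M. \<bar>Gs n w\<bar> \<le> 1"
      using Hs(2)[of n]
    proof eventually_elim
      case (elim w)
      then have "inverse c' * \<bar>Hs n w\<bar> \<le> inverse c' * c'" using c' by (intro mult_left_mono) auto
      then show ?case using c' by (simp add: Gs_def abs_mult)
    qed
  qed
  obtain H where H: "H \<in> borel_measurable M" "AE w in M. \<bar>H w\<bar> \<le> 1"
      "\<And>n. AE w in M. P (Gs n) w \<le> P H w + 1"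
    using near_maximum[of Gs, OF Gs] by blast
  have HL: "H \<in> Linfty M M" "Hs n \<in> Linfty M M" "Gs n \<in> Linfty M M" for n
    by (rule LinftyI[OF H(1,2)] LinftyI[OF Hs] LinftyI[OF Gs])+
  have "integrable M (\<lambda>w. c' * (D w * P H w + D w))"
    using integrable_P[OF HL(1)] D_int by simp
  moreover have "AE w in M. - (c' * (D w * P H w + D w)) \<le> D w * P (Hs n) w" for n
  proof -
    have eq: "(\<lambda>w. c' * Gs n w) = (\<lambda>w. - Hs n w)" using c'(1) by (intro ext) (simp add: Gs_def mult.assoc[symmetric])
    have "AE w in M. P (\<lambda>w. - Hs n w) w = c' * P (Gs n) w"
      using P_const[OF less_imp_le[OF c'(1)] HL(3), of n] unfolding eq .
    with H(3)[of n] P_minus[OF HL(2), of n] D_pos show ?thesis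
    proof eventually_elim
      case (elim w)
      have "c' * P (Gs n) w \<le> c' * (P H w + 1)" using elim(1) c'(1) by simp
      then have "- (c' * (P H w + 1)) \<le> P (Hs n) w" using elim(2,4) by linarith
      then have "D w * - (c' * (P H w + 1)) \<le> D w * P (Hs n) w"
        using elim(3) by (intro mult_left_mono) auto
      then show ?case by (simp add: algebra_simps)
    qed
  qed
  ultimately show thesis by (rule that)
qed

lemma weighted_Fatou:
  assumes "\<And>n::nat. Hs n \<in> borel_measurable M" "\<And>n. AE w in M. \<bar>Hs n w\<bar> \<le> c"
    "H \<in> Linfty M M" "AE w in M. (\<lambda>n. Hs n w) \<longlonglongrightarrow> H w"
  shows "AE w in M. ereal (D w * P H w) \<le> liminf (\<lambda>n. ereal (D w * P (Hs n) w))"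
  using P_Fatou[OF assms] D_pos
proof eventually_elim
  case (elim w)
  then have "ereal (D w) * ereal (P H w) \<le> ereal (D w) * liminf (\<lambda>n. ereal (P (Hs n) w))"
    by (intro ereal_mult_left_mono) auto
  also have "\<dots> = liminf (\<lambda>n. ereal (D w) * ereal (P (Hs n) w))"
    using elim by (intro Liminf_ereal_mult_left[symmetric]) auto
  finally show ?case by simp
qed

lemma integral_Fatou:
  assumes Hs: "\<And>n::nat. Hs n \<in> borel_measurable M" "\<And>n. AE w in M. \<bar>Hs n w\<bar> \<le> c"
    and H: "H \<in> Linfty M M" and lim: "AE w in M. (\<lambda>n. Hs n w) \<longlonglongrightarrow> H w"
    and le: "\<And>n. (\<integral>w. D w * P (Hs n) w \<partial>M) \<le> a"
  shows "(\<integral>w. D w * P H w \<partial>M) \<le> a"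
proof -
  have HsL: "Hs n \<in> Linfty M M" for n by (rule LinftyI[OF Hs])
  obtain b where b: "integrable M b" "\<And>n. AE w in M. - b w \<le> D w * P (Hs n) w"
    using integrable_lower_bound[of Hs c, OF Hs] by blast
  obtain W where W: "\<And>n. integrable M (W n)" "\<And>n. AE w in M. W n w \<le> D w * P H w"
    "\<And>n m. n \<le> m \<Longrightarrow> AE w in M. W n w \<le> D w * P (Hs m) w"
    "(\<lambda>n. \<integral>w. W n w \<partial>M) \<longlonglongrightarrow> (\<integral>w. D w * P H w \<partial>M)"
    by (rule monotone_minorant[OF integrable_P[OF HsL] integrable_P[OF H] b weighted_Fatou[OF Hs H lim]]) blast
  have "(\<integral>w. W n w \<partial>M) \<le> a" for n
    using integral_mono_AE[OF W(1) integrable_P[OF HsL] W(3)[of n n]] le[of n] by simp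
  then show ?thesis by - (rule LIMSEQ_le_const2[OF W(4)], blast)
qed

text \<open>Here \<open>F\<close> may differ from \<open>A\<close>: an evaluation conditional on
  \<open>FS\<close> will be conditioned further on \<open>G\<close>.\<close>

lemma real_cond_exp_weighted_Fatou:
  assumes F: "subalgebra M F"
    and Hs: "\<And>n::nat. Hs n \<in> borel_measurable M" "\<And>n. AE w in M. \<bar>Hs n w\<bar> \<le> c"
    and H: "H \<in> Linfty M M" and lim: "AE w in M. (\<lambda>n. Hs n w) \<longlonglongrightarrow> H w"
  shows "AE w in M. ereal (real_cond_exp M F (\<lambda>w. D w * P H w) w)
    \<le> liminf (\<lambda>n. ereal (real_cond_exp M F (\<lambda>w. D w * P (Hs n) w) w))"
proof -
  interpret F: sigma_finite_subalgebra M F by (rule sigma_finite_subalgebraI[OF F])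
  have HsL: "Hs n \<in> Linfty M M" for n by (rule LinftyI[OF Hs])
  obtain b where b: "integrable M b" "\<And>n. AE w in M. - b w \<le> D w * P (Hs n) w"
    using integrable_lower_bound[of Hs c, OF Hs] by blast
  show ?thesis
    by (rule F.real_cond_exp_Fatou[OF integrable_P[OF HsL] integrable_P[OF H] b weighted_Fatou[OF Hs H lim]])
qed

text \<open>Separation yields a density only for the integrated functional \<open>\<phi>\<close> and
  only up to a factor. Cash invariance fixes the factor, and inserting indicators from
  \<open>A\<close> into the payoff localizes the integrated inequality.\<close>

theorem exists_density_dominated_by_evaluation:
  assumes H0: "H0 \<in> Linfty M M" and e: "0 < e"
  obtains \<xi> where "integrable M \<xi>"
    "\<And>H. H \<in> Linfty M M \<Longrightarrow> AE w in M. real_cond_exp M A (\<lambda>w. \<xi> w * H w) w \<le> D w * P H w"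
    "(\<integral>w. D w * P H0 w \<partial>M) - e \<le> (\<integral>w. \<xi> w * H0 w \<partial>M)"
proof -
  define \<phi> where "\<phi> H = (\<integral>w. D w * P H w \<partial>M)" for H
  define d where "d = (\<integral>w. D w \<partial>M)"
  have d: "0 < d"
  proof -
    have nn: "AE w in M. 0 \<le> D w" using D_pos by eventually_elim simp
    then have "0 \<le> d" unfolding d_def by (rule integral_nonneg_AE)
    moreover have "d \<noteq> 0"
    proof
      assume "d = 0"
      then have "AE w in M. D w = 0"
        using integral_nonneg_eq_0_iff_AE[OF D_int nn] by (simp add: d_def)
      with D_pos have "AE w in M. False" by eventually_elim simp
      then show False by simp
    qed
    ultimately show ?thesis by simp
  qed
  have \<phi>_cash: "\<phi> (\<lambda>w. H w + c) = \<phi> H + c * d" if H: "H \<in> Linfty M M" for H c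
  proof -
    have "(\<integral>w. D w * P (\<lambda>w. H w + c) w \<partial>M) = (\<integral>w. D w * P H w + c * D w \<partial>M)"
      using P_cash[OF H Linfty_const, of c] integrable_P[OF H] D_int
        integrable_P[OF Linfty_add[OF H Linfty_const], of c]
      by (intro integral_cong_AE) (auto elim!: eventually_mono simp: algebra_simps)
    then show ?thesis using integrable_P[OF H] D_int by (simp add: \<phi>_def d_def)
  qed
  have \<phi>_zero: "\<phi> (\<lambda>_. 0) = 0"
    unfolding \<phi>_def by (rule integral_eq_zero_AE) (use P_zero in \<open>auto elim: eventually_mono\<close>)
  have \<phi>_const: "\<phi> (\<lambda>w. t * H w) = t * \<phi> H" if H: "H \<in> Linfty M M" and t: "0 \<le> t" for H t
  proof -
    have "\<phi> (\<lambda>w. t * H w) = (\<integral>w. t * (D w * P H w) \<partial>M)"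
      unfolding \<phi>_def
      using P_const[OF t H] integrable_P[OF H] integrable_P[OF Linfty_cmult[OF H], of t]
      by (intro integral_cong_AE) (auto elim!: eventually_mono)
    then show ?thesis by (simp add: \<phi>_def)
  qed
  define C where "C = {H \<in> Linfty M M. \<phi> H \<le> 0}"
  have C: "bounded_closed_convex M C"
    unfolding bounded_closed_convex_def
  proof (intro conjI ballI allI impI)
    show "C \<subseteq> Linfty M M" by (auto simp: C_def)
    fix f g and u :: real assume fg: "f \<in> C" "g \<in> C" and u: "0 \<le> u \<and> u \<le> 1"
    let ?h = "\<lambda>w. u * f w + (1 - u) * g w"
    have L: "f \<in> Linfty M M" "g \<in> Linfty M M" "?h \<in> Linfty M M"
      using fg by (auto simp: C_def intro!: Linfty_add Linfty_cmult)
    have "AE w in M. P ?h w \<le> u * P f w + (1 - u) * P g w"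
      by (rule P_convex) (use L u in auto)
    then have "\<phi> ?h \<le> (\<integral>w. u * (D w * P f w) + (1 - u) * (D w * P g w) \<partial>M)"
      unfolding \<phi>_def
    proof (intro integral_mono_AE)
      assume "AE w in M. P ?h w \<le> u * P f w + (1 - u) * P g w"
      with D_pos show "AE w in M. D w * P ?h w \<le> u * (D w * P f w) + (1 - u) * (D w * P g w)"
      proof eventually_elim
        case (elim w)
        then have "D w * P ?h w \<le> D w * (u * P f w + (1 - u) * P g w)" by (intro mult_left_mono) auto
        then show ?case by (simp add: algebra_simps)
      qed
    qed (use integrable_P L in auto)
    also have "\<dots> = u * \<phi> f + (1 - u) * \<phi> g"
      using integrable_P L by (simp add: \<phi>_def)
    also have "\<dots> \<le> 0"
      using fg u by (simp add: C_def add_nonpos_nonpos mult_nonneg_nonpos)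
    finally show "?h \<in> C" using L by (simp add: C_def)
  next
    fix fs :: "nat \<Rightarrow> 'a \<Rightarrow> real" and f c
    assume fs: "\<forall>n. fs n \<in> C" "\<forall>n. AE w in M. \<bar>fs n w\<bar> \<le> c"
      and f: "f \<in> borel_measurable M" "AE w in M. (\<lambda>n. fs n w) \<longlonglongrightarrow> f w"
    have "AE w in M. \<bar>f w\<bar> \<le> c" using fs f by - (rule AE_bounded_limit[where fs=fs], auto)
    then have fL: "f \<in> Linfty M M" by (rule LinftyI[OF f(1)])
    moreover have "\<phi> f \<le> 0"
      unfolding \<phi>_def
      by (rule integral_Fatou[of fs c, OF _ _ fL f(2)]) (use fs in \<open>auto simp: C_def \<phi>_def Linfty_def\<close>)
    ultimately show "f \<in> C" by (simp add: C_def)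
  qed
  \<comment> \<open>A constant shift brings the value of \<open>\<phi>\<close> to exactly
    \<open>e\<close>, just outside the cone.\<close>
  define H1 where "H1 w = H0 w + - ((\<phi> H0 - e) / d)" for w
  have H1L: "H1 \<in> Linfty M M" unfolding H1_def by (intro Linfty_add H0 Linfty_const)
  have "\<phi> H1 = e" unfolding H1_def \<phi>_cash[OF H0] using d by simp
  then have H1C: "H1 \<notin> C" using e by (simp add: C_def)
  have cone: "(\<lambda>w. t * f w) \<in> C" if "f \<in> C" "0 \<le> t" for f t
    using that \<phi>_const[of f t] by (auto simp: C_def mult_nonneg_nonpos intro: Linfty_cmult)
  have "(\<lambda>_. 0) \<in> C" using \<phi>_zero by (simp add: C_def Linfty_const)
  then have ne: "C \<noteq> {}" by blast
  obtain \<zeta> where \<zeta>: "integrable M \<zeta>" "\<And>H. H \<in> C \<Longrightarrow> (\<integral>w. \<zeta> w * H w \<partial>M) \<le> 0"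
    "0 < (\<integral>w. \<zeta> w * H1 w \<partial>M)"
    by (rule Linfty_cone_separation[OF C cone ne H1L H1C]) blast+
  define z where "z = (\<integral>w. \<zeta> w \<partial>M)"
  have \<zeta>_add: "(\<integral>w. \<zeta> w * (H w + c) \<partial>M) = (\<integral>w. \<zeta> w * H w \<partial>M) + c * z"
    if H: "H \<in> Linfty M M" for H c
  proof -
    have "(\<integral>w. \<zeta> w * (H w + c) \<partial>M) = (\<integral>w. \<zeta> w * H w + c * \<zeta> w \<partial>M)" by (simp add: algebra_simps)
    then show ?thesis using integrable_Linfty_mult[OF \<zeta>(1) H] \<zeta>(1) by (simp add: z_def)
  qed
  have \<zeta>_le: "(\<integral>w. \<zeta> w * H w \<partial>M) \<le> \<phi> H / d * z" if H: "H \<in> Linfty M M" for H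
  proof -
    have "\<phi> (\<lambda>w. H w + - (\<phi> H / d)) = 0" unfolding \<phi>_cash[OF H] using d by simp
    then have "(\<lambda>w. H w + - (\<phi> H / d)) \<in> C"
      using Linfty_add[OF H Linfty_const, of "- (\<phi> H / d)"] by (simp add: C_def)
    from \<zeta>(2)[OF this] show ?thesis unfolding \<zeta>_add[OF H] by simp
  qed
  \<comment> \<open>The constant payoff -1 lies in \<open>C\<close>, which gives the sign. If
    \<open>z\<close> were 0, the separating functional would be nonpositive on all bounded payoffs,
    in particular on \<open>H1\<close>.\<close>
  have z_pos: "0 < z"
  proof -
    have "\<phi> (\<lambda>w. 0 + - 1) = - d" using \<phi>_cash[OF Linfty_const, of 0 "-1"] \<phi>_zero by simp
    then have "(\<lambda>w. 0 + - 1) \<in> C" using d by (simp add: C_def Linfty_const)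
    from \<zeta>(2)[OF this] have "0 \<le> z" unfolding \<zeta>_add[OF Linfty_const] by simp
    moreover have "z \<noteq> 0" using \<zeta>_le[OF H1L] \<zeta>(3) by auto
    ultimately show ?thesis by simp
  qed
  \<comment> \<open>Normalized so that the integral of \<open>\<xi>\<close> is \<open>d\<close>, the
    value of \<open>\<phi>\<close> at the constant 1.\<close>
  define \<xi> where "\<xi> w = d / z * \<zeta> w" for w
  have \<xi>_int: "integrable M \<xi>" unfolding \<xi>_def using \<zeta>(1) by simp
  have \<xi>_eq: "(\<integral>w. \<xi> w * H w \<partial>M) = d / z * (\<integral>w. \<zeta> w * H w \<partial>M)" for H
    by (simp add: \<xi>_def mult.assoc del: times_divide_eq_left)
  have \<xi>_le: "(\<integral>w. \<xi> w * H w \<partial>M) \<le> \<phi> H" if H: "H \<in> Linfty M M" for H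
  proof -
    have "d / z * (\<integral>w. \<zeta> w * H w \<partial>M) \<le> d / z * (\<phi> H / d * z)"
      using \<zeta>_le[OF H] d z_pos by (intro mult_left_mono) auto
    then show ?thesis using d z_pos by (simp add: \<xi>_eq)
  qed
  show thesis
  proof (rule that[OF \<xi>_int])
    show "AE w in M. real_cond_exp M A (\<lambda>w. \<xi> w * H w) w \<le> D w * P H w" if H: "H \<in> Linfty M M" for H
    proof (rule A.real_cond_exp_le_if_integral_le[OF integrable_Linfty_mult[OF \<xi>_int H] integrable_P[OF H] DP_meas_A[OF H]])
      fix B assume B: "B \<in> sets A"
      have BL: "(indicator B :: 'a \<Rightarrow> real) \<in> Linfty M M" by (rule Linfty_indicator[OF sets_A[OF B]])
      have "(\<integral>w. \<xi> w * H w * indicator B w \<partial>M) = (\<integral>w. \<xi> w * (indicator B w * H w) \<partial>M)"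
        by (simp add: ac_simps)
      also have "\<dots> \<le> \<phi> (\<lambda>w. indicator B w * H w)"
        by (rule \<xi>_le[OF Linfty_mult[OF BL H]])
      also have "\<dots> = (\<integral>w. D w * P H w * indicator B w \<partial>M)"
        unfolding \<phi>_def
        using P_indicator[OF H B] integrable_P[OF Linfty_mult[OF BL H]]
          integrable_Linfty_mult[OF integrable_P[OF H] BL]
        by (intro integral_cong_AE) (auto elim!: eventually_mono)
      finally show "(\<integral>w. \<xi> w * H w * indicator B w \<partial>M) \<le> (\<integral>w. D w * P H w * indicator B w \<partial>M)" .
    qed
    have "0 < (\<integral>w. \<zeta> w * H0 w \<partial>M) - (\<phi> H0 - e) / d * z"
      using \<zeta>(3) unfolding H1_def \<zeta>_add[OF H0] by simp
    then have "d / z * ((\<phi> H0 - e) / d * z) \<le> d / z * (\<integral>w. \<zeta> w * H0 w \<partial>M)"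
      using d z_pos by (intro mult_left_mono) auto
    then show "(\<integral>w. D w * P H0 w \<partial>M) - e \<le> (\<integral>w. \<xi> w * H0 w \<partial>M)"
      using d z_pos by (simp add: \<xi>_eq flip: \<phi>_def)
  qed
qed

end

lemma coherent_evaluation_change_codomain:
  assumes "coherent_evaluation M A K P" "\<And>H. H \<in> Linfty M M \<Longrightarrow> P H \<in> K'"
  shows "coherent_evaluation M A K' P"
  using assms by (simp add: coherent_evaluation_def cond_evaluation_def Linfty_map_def)

text \<open>Convexity comes from subadditivity and homogeneity with the factors \<open>l\<close> and
  \<open>1 - l\<close>; locality comes from homogeneity with indicators, after multiplying the
  pasted payoff by the indicator of each half.\<close>

lemma coherent_evaluationI:
  assumes A: "subalgebra M A" and map: "Linfty_map M K P"
    and add: "\<And>H1 H2. H1 \<in> Linfty M M \<Longrightarrow> H2 \<in> Linfty M M \<Longrightarrow>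
      AE w in M. P (\<lambda>w. H1 w + H2 w) w \<le> P H1 w + P H2 w"
    and scale: "\<And>H l. H \<in> Linfty M M \<Longrightarrow> l \<in> Linfty M A \<Longrightarrow> AE w in M. 0 \<le> l w \<Longrightarrow>
      AE w in M. P (\<lambda>w. l w * H w) w = l w * P H w"
    and cash: "\<And>H m. H \<in> Linfty M M \<Longrightarrow> m \<in> Linfty M A \<Longrightarrow>
      AE w in M. P (\<lambda>w. H w + m w) w = P H w + m w"
    and Fatou: "\<And>Hs H c. (\<And>n::nat. Hs n \<in> borel_measurable M) \<Longrightarrow>
      (\<And>n. AE w in M. \<bar>Hs n w\<bar> \<le> c) \<Longrightarrow> H \<in> Linfty M M \<Longrightarrow>
      AE w in M. (\<lambda>n. Hs n w) \<longlonglongrightarrow> H w \<Longrightarrow>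
      AE w in M. ereal (P H w) \<le> liminf (\<lambda>n. ereal (P (Hs n) w))"
  shows "coherent_evaluation M A K P"
proof -
  have spA: "space A = space M" using A by (simp add: subalgebra_def)
  have AM: "f \<in> Linfty M M" if "f \<in> Linfty M A" for f using Linfty_subalgebra[OF A] that by blast
  have "normalized M P"
    using scale[OF Linfty_const Linfty_const[of 0], of 0] by (simp add: normalized_def)
  moreover have "cash_invariant M A P" using cash by (simp add: cash_invariant_def)
  moreover have "cond_convex M A P"
    unfolding cond_convex_def
  proof (intro ballI impI)
    fix H1 H2 l
    assume H: "H1 \<in> Linfty M M" "H2 \<in> Linfty M M" and l: "l \<in> Linfty M A"
      and l01: "AE w in M. 0 \<le> l w \<and> l w \<le> 1"
    have l': "(\<lambda>w. 1 - l w) \<in> Linfty M A" using Linfty_diff[OF Linfty_const l] .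
    have nn: "AE w in M. 0 \<le> l w" "AE w in M. 0 \<le> 1 - l w"
      using l01 by (eventually_elim, simp)+
    from scale[OF H(1) l nn(1)] scale[OF H(2) l' nn(2)]
      add[OF Linfty_mult[OF AM[OF l] H(1)] Linfty_mult[OF AM[OF l'] H(2)]]
    show "AE w in M. P (\<lambda>w. l w * H1 w + (1 - l w) * H2 w) w \<le> l w * P H1 w + (1 - l w) * P H2 w"
      by eventually_elim simp
  qed
  moreover have "cond_local M A P"
    unfolding cond_local_def
  proof (intro ballI)
    fix H1 H2 B assume H: "H1 \<in> Linfty M M" "H2 \<in> Linfty M M" and B: "B \<in> sets A"
    have B': "space M - B \<in> sets A" using sets.compl_sets[OF B] spA by simp
    let ?H = "\<lambda>w. indicator B w * H1 w + indicator (space M - B) w * H2 w"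
    have HL: "?H \<in> Linfty M M"
      using B B' by (intro Linfty_add Linfty_mult H AM Linfty_indicator)
    have eq: "(\<lambda>w. indicator B w * ?H w) = (\<lambda>w. indicator B w * H1 w)"
      "(\<lambda>w. indicator (space M - B) w * ?H w) = (\<lambda>w. indicator (space M - B) w * H2 w)"
      by (auto simp: fun_eq_iff split: split_indicator)
    have sc: "AE w in M. P (\<lambda>w. indicator C w * K w) w = indicator C w * P K w"
      if "K \<in> Linfty M M" "C \<in> sets A" for K C
      by (rule scale[OF that(1) Linfty_indicator[OF that(2)]]) simp
    from sc[OF HL B] sc[OF HL B'] sc[OF H(1) B] sc[OF H(2) B'] AE_space
    show "AE w in M. P ?H w = indicator B w * P H1 w + indicator (space M - B) w * P H2 w"
      unfolding eq by eventually_elim (auto split: split_indicator_asm split_indicator)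
  qed
  moreover have "fatou_property M P"
    unfolding fatou_property_def
  proof (intro ballI allI impI)
    fix H and Hs :: "nat \<Rightarrow> 'a \<Rightarrow> real"
    assume *: "H \<in> Linfty M M" "\<forall>n. Hs n \<in> borel_measurable M"
      "\<exists>c. \<forall>n. AE w in M. \<bar>Hs n w\<bar> \<le> c" "AE w in M. (\<lambda>n. Hs n w) \<longlonglongrightarrow> H w"
    then obtain c where c: "\<And>n. AE w in M. \<bar>Hs n w\<bar> \<le> c" by blast
    show "AE w in M. ereal (P H w) \<le> liminf (\<lambda>n. ereal (P (Hs n) w))"
      by (rule Fatou[OF *(2)[rule_format] c *(1) *(4)])
  qed
  ultimately show ?thesis
    using map scale by (simp add: coherent_evaluation_def cond_evaluation_def)
qed

text \<open>The supremum is the limit of an increasing sequence of members whose integrals approach \<open>s\<close>.\<close>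

lemma directed_ess_sup:
  fixes X :: "('a \<Rightarrow> real) set" and s :: real
  assumes A: "subalgebra M A"
    and X: "\<And>f. f \<in> X \<Longrightarrow> integrable M f \<and> f \<in> borel_measurable A"
    and directed: "\<And>f g. f \<in> X \<Longrightarrow> g \<in> X \<Longrightarrow> \<exists>h\<in>X. AE w in M. f w \<le> h w \<and> g w \<le> h w"
    and le_s: "\<And>f. f \<in> X \<Longrightarrow> (\<integral>w. f w \<partial>M) \<le> s"
    and near_s: "\<And>e. 0 < e \<Longrightarrow> \<exists>f\<in>X. s - e \<le> (\<integral>w. f w \<partial>M)"
  obtains Y where "Y \<in> borel_measurable A" "integrable M Y" "is_ess_sup M X Y" "(\<integral>w. Y w \<partial>M) = s"
proof -
  have int: "integrable M f" and measA: "f \<in> borel_measurable A" if "f \<in> X" for f using X that by auto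
  have "\<forall>n. \<exists>f. f \<in> X \<and> s - inverse (real (Suc n)) \<le> (\<integral>w. f w \<partial>M)"
    using near_s by (metis inverse_positive_iff_positive of_nat_0_less_iff zero_less_Suc)
  from choice[OF this]
  obtain f where f: "\<And>n. f n \<in> X" "\<And>n. s - inverse (real (Suc n)) \<le> (\<integral>w. f n w \<partial>M)" by blast
  \<comment> \<open>Directedness turns the maximizing \<open>f n\<close> into a sequence
    \<open>g n\<close> that increases almost surely and still dominates \<open>f n\<close>.\<close>
  have "\<exists>g. \<forall>n. (g n \<in> X \<and> (AE w in M. f n w \<le> g n w)) \<and> (AE w in M. g n w \<le> g (Suc n) w)"
  proof (rule dependent_nat_choice)
    show "\<exists>g. g \<in> X \<and> (AE w in M. f 0 w \<le> g w)" using f(1)[of 0] by auto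
    fix g and n :: nat assume "g \<in> X \<and> (AE w in M. f n w \<le> g w)"
    then obtain h where h: "h \<in> X" "AE w in M. g w \<le> h w \<and> f (Suc n) w \<le> h w"
      using directed[of g "f (Suc n)"] f(1) by blast
    then show "\<exists>h. (h \<in> X \<and> (AE w in M. f (Suc n) w \<le> h w)) \<and> (AE w in M. g w \<le> h w)"
      by (intro exI[of _ h]) auto
  qed
  then obtain g where g: "\<And>n. g n \<in> X" and fg: "\<And>n. AE w in M. f n w \<le> g n w"
    and g_Suc: "\<And>n. AE w in M. g n w \<le> g (Suc n) w" by blast
  have "AE w in M. \<forall>n. g n w \<le> g (Suc n) w" using g_Suc by (simp add: AE_all_countable)
  then have g_mono: "AE w in M. incseq (\<lambda>n. g n w)" by eventually_elim (simp add: incseq_Suc_iff)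
  have g_int: "s - inverse (real (Suc n)) \<le> (\<integral>w. g n w \<partial>M)" for n
    using f(2)[of n] integral_mono_AE[OF int[OF f(1)] int[OF g] fg, of n] by simp
  have g_lim: "(\<lambda>n. \<integral>w. g n w \<partial>M) \<longlonglongrightarrow> s"
  proof (rule tendsto_sandwich[of "\<lambda>n. s - inverse (real (Suc n))" _ _ "\<lambda>_. s"])
    have "(\<lambda>n. s - inverse (real (Suc n))) \<longlonglongrightarrow> s - 0"
      by (intro tendsto_diff tendsto_const LIMSEQ_inverse_real_of_nat)
    then show "(\<lambda>n. s - inverse (real (Suc n))) \<longlonglongrightarrow> s" by simp
  qed (simp_all add: g_int le_s[OF g] del: of_nat_Suc)
  have L1: "(\<integral>w. norm (g i w - g j w) \<partial>M) \<le> inverse (real (Suc N))" if "i \<ge> N" "j \<ge> N" for i j N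
  proof -
    have *: "(\<integral>w. norm (g i w - g j w) \<partial>M) \<le> inverse (real (Suc N))" if "j \<le> i" "N \<le> j" for i j
    proof -
      have "(\<integral>w. norm (g i w - g j w) \<partial>M) = (\<integral>w. g i w - g j w \<partial>M)"
        using g_mono that(1) int[OF g]
        by (intro integral_cong_AE) (auto elim!: eventually_mono dest: incseqD)
      also have "\<dots> = (\<integral>w. g i w \<partial>M) - (\<integral>w. g j w \<partial>M)" using int[OF g] by simp
      also have "\<dots> \<le> inverse (real (Suc j))" using le_s[OF g, of i] g_int[of j] by simp
      also have "\<dots> \<le> inverse (real (Suc N))" using that(2) by simp
      finally show ?thesis .
    qed
    show ?thesis
    proof (cases "j \<le> i")
      case True
      then show ?thesis using *[of j i] that by simp
    next
      case False
      then have "(\<integral>w. norm (g j w - g i w) \<partial>M) \<le> inverse (real (Suc N))" using *[of i j] that by simp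
      then show ?thesis by (simp add: norm_minus_commute[of "g i _"] del: real_norm_def)
    qed
  qed
  have Cauchy_L1: "\<exists>N. \<forall>i\<ge>N. \<forall>j\<ge>N. (\<integral>w. norm (g i w - g j w) \<partial>M) < e" if e: "0 < e" for e :: real
  proof -
    obtain N where "inverse (real (Suc N)) < e" using reals_Archimedean[OF e] by blast
    then have "\<forall>i\<ge>N. \<forall>j\<ge>N. (\<integral>w. norm (g i w - g j w) \<partial>M) < e" using L1 le_less_trans by blast
    then show ?thesis ..
  qed
  obtain r where r: "strict_mono r" "AE w in M. Cauchy (\<lambda>i. g (r i) w)"
    by (rule cauchy_L1_AE_cauchy_subseq[OF int[OF g] Cauchy_L1])
  define Y where "Y w = lim (\<lambda>n. g (r n) w)" for w
  have Y_A: "Y \<in> borel_measurable A"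
    unfolding Y_def using measA[OF g] by (rule borel_measurable_lim_metric)
  have Y_M: "Y \<in> borel_measurable M" by (rule measurable_from_subalg[OF A Y_A])
  have Y_lim: "AE w in M. (\<lambda>n. g (r n) w) \<longlonglongrightarrow> Y w"
    using r(2) unfolding Y_def by eventually_elim (simp add: Cauchy_convergent_iff convergent_LIMSEQ_iff)
  have mono_r: "AE w in M. mono (\<lambda>n. g (r n) w)"
    using g_mono by eventually_elim (simp add: mono_def strict_mono_less_eq[OF r(1)])
  have g_lim_r: "(\<lambda>n. \<integral>w. g (r n) w \<partial>M) \<longlonglongrightarrow> s"
    using LIMSEQ_subseq_LIMSEQ[OF g_lim r(1)] by (simp add: o_def)
  have Y: "integrable M Y" "(\<integral>w. Y w \<partial>M) = s"
    using integrable_monotone_convergence[OF int[OF g] mono_r Y_lim g_lim_r Y_M]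
      integral_monotone_convergence[OF int[OF g] mono_r Y_lim g_lim_r Y_M] by simp_all
  have g_le_Y: "AE w in M. \<forall>n. g (r n) w \<le> Y w"
    using mono_r Y_lim by eventually_elim (auto intro: incseq_le)
  have "is_ess_sup M X Y"
    unfolding is_ess_sup_def
  proof (intro conjI ballI impI)
    show "Y \<in> borel_measurable M" by (rule Y_M)
  next
    fix k assume k: "k \<in> X"
    have int_pos: "integrable M (\<lambda>w. max 0 (k w - Y w))" using int[OF k] Y(1) by simp
    have "(\<integral>w. max 0 (k w - Y w) \<partial>M) \<le> s - (\<integral>w. g (r n) w \<partial>M)" for n
    proof -
      \<comment> \<open>An arbitrary member \<open>k\<close> and \<open>g (r n)\<close> have a
        common majorant \<open>h\<close> in the family. The excess of \<open>k\<close> over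
        \<open>Y\<close> is at most \<open>h - g (r n)\<close>, whose integral is at most
        \<open>s\<close> minus that of \<open>g (r n)\<close> and so tends to 0.\<close>
      obtain h where h: "h \<in> X" "AE w in M. k w \<le> h w \<and> g (r n) w \<le> h w"
        using directed[OF k g] by blast
      have "(\<integral>w. max 0 (k w - Y w) \<partial>M) \<le> (\<integral>w. h w - g (r n) w \<partial>M)"
      proof (rule integral_mono_AE[OF int_pos])
        show "AE w in M. max 0 (k w - Y w) \<le> h w - g (r n) w"
          using h(2) g_le_Y
        proof eventually_elim
          case (elim w)
          then show ?case by (auto dest!: spec[of _ n])
        qed
      qed (use int[OF h(1)] int[OF g] in simp)
      also have "\<dots> = (\<integral>w. h w \<partial>M) - (\<integral>w. g (r n) w \<partial>M)" using int[OF h(1)] int[OF g] by simp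
      also have "\<dots> \<le> s - (\<integral>w. g (r n) w \<partial>M)" using le_s[OF h(1)] by simp
      finally show ?thesis .
    qed
    note bound = this
    have "(\<lambda>n. s - (\<integral>w. g (r n) w \<partial>M)) \<longlonglongrightarrow> s - s" by (intro tendsto_diff tendsto_const g_lim_r)
    then have "(\<integral>w. max 0 (k w - Y w) \<partial>M) \<le> s - s"
      by (rule LIMSEQ_le_const) (use bound in blast)
    moreover have "0 \<le> (\<integral>w. max 0 (k w - Y w) \<partial>M)" by (rule Bochner_Integration.integral_nonneg) simp
    ultimately have "AE w in M. max 0 (k w - Y w) = 0"
      using integral_nonneg_eq_0_iff_AE[OF int_pos] by simp
    then show "AE w in M. k w \<le> Y w" by eventually_elim (simp add: max_def split: if_splits)
  next
    fix U assume U: "U \<in> borel_measurable M" "\<forall>f\<in>X. AE w in M. f w \<le> U w"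
    have "AE w in M. \<forall>n. g (r n) w \<le> U w" using U(2) g by (simp add: AE_all_countable)
    with Y_lim show "AE w in M. Y w \<le> U w"
      by eventually_elim (auto intro: LIMSEQ_le_const2)
  qed
  then show thesis by (rule that[OF Y_A Y(1) _ Y(2)])
qed

section \<open>Dual densities of a weighted coherent evaluation\<close>

context weighted_coherent_evaluation
begin

text \<open>The weight stays on the side of the evaluation. Cash invariance forces
  \<open>E[\<xi> | A] = D\<close>, so for weight 1 this set agrees with
  \<open>dual_set\<close>.\<close>

definition dual_densities :: "('a \<Rightarrow> real) set" where
  "dual_densities = {\<xi>. integrable M \<xi> \<and>
     (\<forall>H \<in> Linfty M M. AE w in M. real_cond_exp M A (\<lambda>w. \<xi> w * H w) w \<le> D w * P H w)}"

lemma dual_densitiesI: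
  assumes \<xi>: "integrable M \<xi>"
    and le: "\<And>H B. H \<in> Linfty M M \<Longrightarrow> B \<in> sets A \<Longrightarrow>
      (\<integral>w. \<xi> w * H w * indicator B w \<partial>M) \<le> (\<integral>w. D w * P H w * indicator B w \<partial>M)"
  shows "\<xi> \<in> dual_densities"
proof -
  have "AE w in M. real_cond_exp M A (\<lambda>w. \<xi> w * H w) w \<le> D w * P H w" if H: "H \<in> Linfty M M" for H
    by (rule A.real_cond_exp_le_if_integral_le[OF integrable_Linfty_mult[OF \<xi> H] integrable_P[OF H]
          DP_meas_A[OF H] le[OF H]])
  then show ?thesis using \<xi> by (simp add: dual_densities_def)
qed

lemma dual_densities_integrable: "\<xi> \<in> dual_densities \<Longrightarrow> integrable M \<xi>"
  by (simp add: dual_densities_def)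

lemma dual_densities_le:
  "\<xi> \<in> dual_densities \<Longrightarrow> H \<in> Linfty M M \<Longrightarrow>
    AE w in M. real_cond_exp M A (\<lambda>w. \<xi> w * H w) w \<le> D w * P H w"
  by (simp add: dual_densities_def)

lemma dual_densities_integral_le:
  assumes \<xi>: "\<xi> \<in> dual_densities" and H: "H \<in> Linfty M M" and B: "B \<in> sets A"
  shows "(\<integral>w. \<xi> w * H w * indicator B w \<partial>M) \<le> (\<integral>w. D w * P H w * indicator B w \<partial>M)"
  by (rule A.integral_le_if_real_cond_exp_le[OF integrable_Linfty_mult[OF dual_densities_integrable[OF \<xi>] H]
        integrable_P[OF H] dual_densities_le[OF \<xi> H] B])

lemma P_of_const: "AE w in M. P (\<lambda>_. c) w = c"
  using P_cash[OF Linfty_const Linfty_const, of 0 c] P_zero by eventually_elim simp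

text \<open>The constants 1 and -1 give the two opposite inequalities.\<close>

lemma dual_densities_cond_exp:
  assumes "\<xi> \<in> dual_densities"
  shows "AE w in M. real_cond_exp M A \<xi> w = D w"
proof -
  have "AE w in M. real_cond_exp M A (\<lambda>w. \<xi> w * 1) w \<le> D w * P (\<lambda>_. 1) w"
    "AE w in M. real_cond_exp M A (\<lambda>w. \<xi> w * - 1) w \<le> D w * P (\<lambda>_. - 1) w"
    by (rule dual_densities_le[OF assms Linfty_const])+
  moreover have "AE w in M. real_cond_exp M A (\<lambda>w. \<xi> w * - 1) w = - real_cond_exp M A \<xi> w"
    using A.real_cond_exp_cmult[OF dual_densities_integrable[OF assms], of "-1"] by simp
  ultimately show ?thesis
    using P_of_const[of 1] P_of_const[of "-1"] by eventually_elim simp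
qed

lemma exists_dual_density:
  assumes "H \<in> Linfty M M" "0 < e"
  shows "\<exists>\<xi>\<in>dual_densities. (\<integral>w. D w * P H w \<partial>M) - e \<le> (\<integral>w. \<xi> w * H w \<partial>M)"
proof -
  obtain \<xi> where "integrable M \<xi>"
    "\<And>H. H \<in> Linfty M M \<Longrightarrow> AE w in M. real_cond_exp M A (\<lambda>w. \<xi> w * H w) w \<le> D w * P H w"
    "(\<integral>w. D w * P H w \<partial>M) - e \<le> (\<integral>w. \<xi> w * H w \<partial>M)"
    by (rule exists_density_dominated_by_evaluation[OF assms]) blast
  then show ?thesis by (intro bexI[of _ \<xi>]) (simp_all add: dual_densities_def)
qed

text \<open>For an upper bound \<open>U\<close>, the positive part of \<open>D * P H - U\<close>
  lies below \<open>D * P H - E[\<xi> H | A]\<close>. A density that almost attains the expectation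
  makes the integral of this difference at most any given \<open>e\<close>.\<close>

lemma is_ess_sup_dual_densities:
  assumes H: "H \<in> Linfty M M"
  shows "is_ess_sup M ((\<lambda>\<xi>. real_cond_exp M A (\<lambda>w. \<xi> w * H w)) ` dual_densities) (\<lambda>w. D w * P H w)"
  unfolding is_ess_sup_def
proof (intro conjI ballI impI)
  show DP: "(\<lambda>w. D w * P H w) \<in> borel_measurable M"
    by (rule measurable_from_subalg[OF subalg DP_meas_A[OF H]])
  show "AE w in M. f w \<le> D w * P H w"
    if "f \<in> (\<lambda>\<xi>. real_cond_exp M A (\<lambda>w. \<xi> w * H w)) ` dual_densities" for f
    using that dual_densities_le[OF _ H] by auto
  fix U assume U [measurable]: "U \<in> borel_measurable M"
    and ub: "\<forall>f \<in> (\<lambda>\<xi>. real_cond_exp M A (\<lambda>w. \<xi> w * H w)) ` dual_densities. AE w in M. f w \<le> U w"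
  note [measurable] = DP
  let ?V = "\<lambda>w. max 0 (D w * P H w - U w)"
  have key: "integrable M ?V \<and> (\<integral>w. ?V w \<partial>M) \<le> e" if e: "0 < e" for e
  proof -
    obtain \<xi> where \<xi>: "\<xi> \<in> dual_densities" "(\<integral>w. D w * P H w \<partial>M) - e \<le> (\<integral>w. \<xi> w * H w \<partial>M)"
      using exists_dual_density[OF H e] by blast
    let ?E = "real_cond_exp M A (\<lambda>w. \<xi> w * H w)"
    have int\<xi>: "integrable M (\<lambda>w. \<xi> w * H w)"
      by (rule integrable_Linfty_mult[OF dual_densities_integrable[OF \<xi>(1)] H])
    have intd: "integrable M (\<lambda>w. D w * P H w - ?E w)"
      using integrable_P[OF H] A.real_cond_exp_int(1)[OF int\<xi>] by simp
    have "?E \<in> (\<lambda>\<xi>. real_cond_exp M A (\<lambda>w. \<xi> w * H w)) ` dual_densities" using \<xi>(1) by (rule imageI)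
    then have "AE w in M. ?E w \<le> U w" by (rule ub[rule_format])
    then have le: "AE w in M. ?V w \<le> D w * P H w - ?E w"
      using dual_densities_le[OF \<xi>(1) H] by eventually_elim simp
    then have "AE w in M. norm (?V w) \<le> norm (D w * P H w - ?E w)"
      unfolding real_norm_def by eventually_elim linarith
    then have intV: "integrable M ?V"
      by (rule Bochner_Integration.integrable_bound[OF intd, rotated]) measurable
    have "(\<integral>w. ?V w \<partial>M) \<le> (\<integral>w. D w * P H w - ?E w \<partial>M)" by (rule integral_mono_AE[OF intV intd le])
    also have "\<dots> = (\<integral>w. D w * P H w \<partial>M) - (\<integral>w. \<xi> w * H w \<partial>M)"
      using integrable_P[OF H] A.real_cond_exp_int[OF int\<xi>] by simp
    finally show ?thesis using \<xi>(2) intV by simp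
  qed
  have "(\<integral>w. ?V w \<partial>M) \<le> 0" by (rule field_le_epsilon) (use key in simp)
  moreover have "0 \<le> (\<integral>w. ?V w \<partial>M)" by (rule Bochner_Integration.integral_nonneg) simp
  ultimately have "AE w in M. ?V w = 0"
    using integral_nonneg_eq_0_iff_AE[of M ?V] key[of 1] by simp
  then show "AE w in M. D w * P H w \<le> U w" by eventually_elim (simp add: max_def split: if_splits)
qed

text \<open>Restated as inequalities between integrals over events, the conditions pair densities
  with bounded functions only, and such pairings pass to convex combinations and L1 limits.\<close>

lemma L1_closed_convex_dual_densities: "L1_closed_convex M dual_densities"
  unfolding L1_closed_convex_def
proof (intro conjI ballI allI impI)
  fix \<xi> \<eta> and u :: real
  assume \<xi>: "\<xi> \<in> dual_densities" and \<eta>: "\<eta> \<in> dual_densities" and u: "0 \<le> u \<and> u \<le> 1"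
  show "(\<lambda>w. u * \<xi> w + (1 - u) * \<eta> w) \<in> dual_densities"
  proof (rule dual_densitiesI)
    show "integrable M (\<lambda>w. u * \<xi> w + (1 - u) * \<eta> w)"
      using dual_densities_integrable \<xi> \<eta> by simp
    fix H B assume H: "H \<in> Linfty M M" and B: "B \<in> sets A"
    have BL: "(indicator B :: 'a \<Rightarrow> real) \<in> Linfty M M" by (rule Linfty_indicator[OF sets_A[OF B]])
    have int: "integrable M (\<lambda>w. \<zeta> w * H w * indicator B w)" if "\<zeta> \<in> dual_densities" for \<zeta>
      by (intro integrable_Linfty_mult[OF _ BL] integrable_Linfty_mult[OF _ H] dual_densities_integrable that)
    let ?c = "\<integral>w. D w * P H w * indicator B w \<partial>M"
    have "(\<integral>w. (u * \<xi> w + (1 - u) * \<eta> w) * H w * indicator B w \<partial>M)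
        = (\<integral>w. u * (\<xi> w * H w * indicator B w) + (1 - u) * (\<eta> w * H w * indicator B w) \<partial>M)"
      by (simp add: algebra_simps)
    also have "\<dots> = u * (\<integral>w. \<xi> w * H w * indicator B w \<partial>M) + (1 - u) * (\<integral>w. \<eta> w * H w * indicator B w \<partial>M)"
      using int[OF \<xi>] int[OF \<eta>] by simp
    also have "\<dots> \<le> u * ?c + (1 - u) * ?c"
      using u dual_densities_integral_le[OF _ H B] \<xi> \<eta> by (intro add_mono mult_left_mono) auto
    finally show "(\<integral>w. (u * \<xi> w + (1 - u) * \<eta> w) * H w * indicator B w \<partial>M) \<le> ?c"
      by (simp add: algebra_simps)
  qed
next
  fix \<xi> and \<xi>s :: "nat \<Rightarrow> 'a \<Rightarrow> real"
  assume \<xi>s: "\<forall>n. \<xi>s n \<in> dual_densities" and \<xi>: "integrable M \<xi>"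
    and lim: "(\<lambda>n. \<integral>w. \<bar>\<xi>s n w - \<xi> w\<bar> \<partial>M) \<longlonglongrightarrow> 0"
  show "\<xi> \<in> dual_densities"
  proof (rule dual_densitiesI[OF \<xi>])
    fix H B assume H: "H \<in> Linfty M M" and B: "B \<in> sets A"
    have BL: "(indicator B :: 'a \<Rightarrow> real) \<in> Linfty M M" by (rule Linfty_indicator[OF sets_A[OF B]])
    define h where "h w = H w * indicator B w" for w
    have hL: "h \<in> Linfty M M" unfolding h_def by (rule Linfty_mult[OF H BL])
    then obtain c where c: "AE w in M. \<bar>h w\<bar> \<le> c" by (auto simp: Linfty_def)
    have int: "integrable M (\<xi>s n)" for n using \<xi>s dual_densities_integrable by blast
    have "(\<lambda>n. (\<integral>w. \<xi>s n w * h w \<partial>M) - (\<integral>w. \<xi> w * h w \<partial>M)) \<longlonglongrightarrow> 0"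
    proof (rule Lim_null_comparison)
      show "(\<lambda>n. c * (\<integral>w. \<bar>\<xi>s n w - \<xi> w\<bar> \<partial>M)) \<longlonglongrightarrow> 0"
        using tendsto_mult[OF tendsto_const[of c] lim] by simp
      show "\<forall>\<^sub>F n in sequentially. norm ((\<integral>w. \<xi>s n w * h w \<partial>M) - (\<integral>w. \<xi> w * h w \<partial>M))
          \<le> c * (\<integral>w. \<bar>\<xi>s n w - \<xi> w\<bar> \<partial>M)"
      proof (rule always_eventually, rule allI)
        fix n
        have d: "integrable M (\<lambda>w. \<xi>s n w - \<xi> w)" using int \<xi> by simp
        have "(\<integral>w. \<xi>s n w * h w \<partial>M) - (\<integral>w. \<xi> w * h w \<partial>M) = (\<integral>w. (\<xi>s n w - \<xi> w) * h w \<partial>M)"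
          using integrable_Linfty_mult[OF int hL] integrable_Linfty_mult[OF \<xi> hL]
          by (simp add: left_diff_distrib)
        also have "norm \<dots> \<le> (\<integral>w. norm ((\<xi>s n w - \<xi> w) * h w) \<partial>M)"
          by (rule integral_norm_bound)
        also have "\<dots> \<le> (\<integral>w. c * \<bar>\<xi>s n w - \<xi> w\<bar> \<partial>M)"
        proof (rule integral_mono_AE)
          show "AE w in M. norm ((\<xi>s n w - \<xi> w) * h w) \<le> c * \<bar>\<xi>s n w - \<xi> w\<bar>"
            using c
          proof eventually_elim
            case (elim w)
            then have "\<bar>h w\<bar> * \<bar>\<xi>s n w - \<xi> w\<bar> \<le> c * \<bar>\<xi>s n w - \<xi> w\<bar>" by (intro mult_right_mono) auto
            then show ?case by (simp add: abs_mult mult.commute)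
          qed
        qed (use integrable_Linfty_mult[OF d hL] d in auto)
        finally show "norm ((\<integral>w. \<xi>s n w * h w \<partial>M) - (\<integral>w. \<xi> w * h w \<partial>M))
            \<le> c * (\<integral>w. \<bar>\<xi>s n w - \<xi> w\<bar> \<partial>M)" by simp
      qed
    qed
    then have L: "(\<lambda>n. \<integral>w. \<xi>s n w * h w \<partial>M) \<longlonglongrightarrow> (\<integral>w. \<xi> w * h w \<partial>M)" by (rule LIM_zero_cancel)
    have "(\<integral>w. \<xi>s n w * h w \<partial>M) \<le> (\<integral>w. D w * P H w * indicator B w \<partial>M)" for n
      using dual_densities_integral_le[OF \<xi>s[rule_format] H B, of n] by (simp add: h_def mult.assoc)
    then have "(\<integral>w. \<xi> w * h w \<partial>M) \<le> (\<integral>w. D w * P H w * indicator B w \<partial>M)"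
      by - (rule LIMSEQ_le_const2[OF L], blast)
    then show "(\<integral>w. \<xi> w * H w * indicator B w \<partial>M) \<le> (\<integral>w. D w * P H w * indicator B w \<partial>M)"
      by (simp add: h_def mult.assoc)
  qed
qed

end

section \<open>Evaluations conditional on the market\<close>

locale market_density = prob_space M for M :: "'a measure" +
  fixes G FS :: "'a measure" and D :: "'a \<Rightarrow> real"
  assumes FS_M: "subalgebra M FS" and G_FS: "subalgebra FS G"
    and D_meas: "D \<in> borel_measurable FS" and D_int: "integrable M D"
    and D_pos: "AE w in M. 0 < D w" and D_cond: "AE w in M. real_cond_exp M G D w = 1"
begin

lemma G_M: "subalgebra M G"
  using FS_M G_FS by (auto simp: subalgebra_def)

sublocale FS: sigma_finite_subalgebra M FS
  by (rule sigma_finite_subalgebraI[OF FS_M])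

sublocale G: sigma_finite_subalgebra M G
  by (rule sigma_finite_subalgebraI[OF G_M])

lemma space_FS [simp]: "space FS = space M"
  using FS_M by (simp add: subalgebra_def)

lemma sets_FS: "B \<in> sets FS \<Longrightarrow> B \<in> sets M"
  using FS_M by (auto simp: subalgebra_def)

lemma sets_G: "B \<in> sets G \<Longrightarrow> B \<in> sets FS"
  using G_FS by (auto simp: subalgebra_def)

lemma Linfty_FS: "f \<in> Linfty M FS \<Longrightarrow> f \<in> Linfty M M"
  using Linfty_subalgebra[OF FS_M] by blast

lemma Linfty_G: "f \<in> Linfty M G \<Longrightarrow> f \<in> Linfty M FS"
  using measurable_from_subalg[OF G_FS] by (auto simp: Linfty_def)

lemma Linfty_L1_density: "Linfty M FS \<subseteq> L1_density M FS D"
proof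
  fix f assume f: "f \<in> Linfty M FS"
  show "f \<in> L1_density M FS D"
    using integrable_Linfty_mult[OF D_int Linfty_FS[OF f]] f by (simp add: L1_density_def Linfty_def)
qed

lemma cond_exp_Q_mult:
  assumes "m \<in> Linfty M G"
  shows "AE w in M. cond_exp_Q M G D m w = m w"
proof -
  have [measurable]: "m \<in> borel_measurable G" using assms by (simp add: Linfty_def)
  have int: "integrable M (\<lambda>w. m w * D w)"
    using integrable_Linfty_mult[OF D_int Linfty_FS[OF Linfty_G[OF assms]]] by (simp add: mult.commute)
  have "AE w in M. real_cond_exp M G (\<lambda>w. m w * D w) w = m w * real_cond_exp M G D w"
    by (rule G.real_cond_exp_mult) (use int D_int in auto)
  with D_cond show ?thesis unfolding cond_exp_Q_def by eventually_elim (simp add: mult.commute)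
qed

text \<open>Each property of \<open>PG\<close> is one of \<open>PF\<close> seen through the
  conditioning: cash invariance over \<open>FS\<close> becomes market-consistency, homogeneity for
  indicators of \<open>FS\<close> becomes the market local property, and \<open>E[D | G] = 1\<close>
  returns cash invariance over \<open>G\<close>.\<close>

lemma evaluation_by_conditioning:
  assumes PF: "coherent_evaluation M FS (L1_density M FS D) PF"
    and map: "Linfty_map M (Linfty M G) PG"
    and PG: "\<And>H. H \<in> Linfty M M \<Longrightarrow> AE w in M. PG H w = cond_exp_Q M G D (PF H) w"
  shows "coherent_evaluation M G (Linfty M G) PG"
    and "market_consistent M G FS D PG"
    and "market_local M FS PG"
proof -
  interpret F: weighted_coherent_evaluation M FS D PF
    by unfold_locales (rule FS_M D_meas D_int D_pos PF)+
  have PG_eq: "AE w in M. PG H w = real_cond_exp M G f w"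
    if H: "H \<in> Linfty M M" and f: "integrable M f" and eq: "AE w in M. D w * PF H w = f w" for H f
  proof -
    have "AE w in M. real_cond_exp M G (\<lambda>w. D w * PF H w) w = real_cond_exp M G f w"
      using F.integrable_P[OF H] f by (intro G.real_cond_exp_cong eq) auto
    with PG[OF H] show ?thesis by eventually_elim (simp add: cond_exp_Q_def)
  qed
  have PG': "AE w in M. PG H w = real_cond_exp M G (\<lambda>w. D w * PF H w) w" if "H \<in> Linfty M M" for H
    using PG[OF that] by (simp add: cond_exp_Q_def)
  have consistent: "AE w in M. PG (\<lambda>w. H w + X w) w = PG H w + cond_exp_Q M G D X w"
    if H: "H \<in> Linfty M M" and X: "X \<in> Linfty M FS" for H X
  proof -
    have DX: "integrable M (\<lambda>w. D w * X w)" by (rule integrable_Linfty_mult[OF D_int Linfty_FS[OF X]])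
    have "AE w in M. PG (\<lambda>w. H w + X w) w = real_cond_exp M G (\<lambda>w. D w * PF H w + D w * X w) w"
    proof (rule PG_eq[OF Linfty_add[OF H Linfty_FS[OF X]]])
      show "AE w in M. D w * PF (\<lambda>w. H w + X w) w = D w * PF H w + D w * X w"
        using F.P_cash[OF H X] by eventually_elim (simp add: distrib_left)
    qed (use F.integrable_P[OF H] DX in simp)
    with G.real_cond_exp_add[OF F.integrable_P[OF H] DX] PG'[OF H] show ?thesis
      by eventually_elim (simp add: cond_exp_Q_def)
  qed
  show "market_consistent M G FS D PG"
    unfolding market_consistent_def
  proof (intro ballI)
    fix X H assume X: "X \<in> Linfty M FS" and H: "H \<in> Linfty M M"
    have eq: "(\<lambda>w. X w + H w) = (\<lambda>w. H w + X w)" by (simp add: add.commute)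
    show "AE w in M. PG (\<lambda>w. X w + H w) w = cond_exp_Q M G D X w + PG H w"
      unfolding eq using consistent[OF H X] by eventually_elim simp
  qed
  show "market_local M FS PG"
    unfolding market_local_def
  proof (intro ballI impI)
    fix B H assume B: "B \<in> sets FS" and H: "H \<in> Linfty M M"
    have B': "space M - B \<in> sets FS" using sets.compl_sets[OF B] by simp
    have L: "(\<lambda>w. indicator C w * H w) \<in> Linfty M M" if "C \<in> sets FS" for C
      by (intro Linfty_mult[OF Linfty_indicator H] sets_FS that)
    have int: "integrable M (\<lambda>w. D w * PF (\<lambda>w. indicator C w * H w) w)" if "C \<in> sets FS" for C
      by (rule F.integrable_P[OF L[OF that]])
    have "AE w in M. PG H w = real_cond_exp M G (\<lambda>w. D w * PF (\<lambda>w. indicator B w * H w) w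
        + D w * PF (\<lambda>w. indicator (space M - B) w * H w) w) w"
    proof (rule PG_eq[OF H])
      show "AE w in M. D w * PF H w = D w * PF (\<lambda>w. indicator B w * H w) w
        + D w * PF (\<lambda>w. indicator (space M - B) w * H w) w"
        using F.P_indicator[OF H B] F.P_indicator[OF H B'] AE_space
        by eventually_elim (auto split: split_indicator)
    qed (use int[OF B] int[OF B'] in simp)
    with G.real_cond_exp_add[OF int[OF B] int[OF B']] PG'[OF L[OF B]] PG'[OF L[OF B']]
    show "AE w in M. PG H w = PG (\<lambda>w. indicator B w * H w) w + PG (\<lambda>w. indicator (space M - B) w * H w) w"
      by eventually_elim simp
  qed
  show "coherent_evaluation M G (Linfty M G) PG"
  proof (rule coherent_evaluationI[OF G_M map])
    fix H1 H2 assume H: "H1 \<in> Linfty M M" "H2 \<in> Linfty M M"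
    note int = F.integrable_P[OF H(1)] F.integrable_P[OF H(2)] F.integrable_P[OF Linfty_add[OF H]]
    have "AE w in M. D w * PF (\<lambda>w. H1 w + H2 w) w \<le> D w * PF H1 w + D w * PF H2 w"
      using F.P_add_le[OF H] D_pos
    proof eventually_elim
      case (elim w)
      then have "D w * PF (\<lambda>w. H1 w + H2 w) w \<le> D w * (PF H1 w + PF H2 w)" by (intro mult_left_mono) auto
      then show ?case by (simp add: distrib_left)
    qed
    then have "AE w in M. real_cond_exp M G (\<lambda>w. D w * PF (\<lambda>w. H1 w + H2 w) w) w
        \<le> real_cond_exp M G (\<lambda>w. D w * PF H1 w + D w * PF H2 w) w"
      using int by (intro G.real_cond_exp_mono) auto
    with G.real_cond_exp_add[OF int(1,2)] PG'[OF H(1)] PG'[OF H(2)] PG'[OF Linfty_add[OF H]]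
    show "AE w in M. PG (\<lambda>w. H1 w + H2 w) w \<le> PG H1 w + PG H2 w"
      by eventually_elim simp
  next
    fix H l assume H: "H \<in> Linfty M M" and l: "l \<in> Linfty M G" and nn: "AE w in M. 0 \<le> l w"
    have lFS: "l \<in> Linfty M FS" by (rule Linfty_G[OF l])
    have int: "integrable M (\<lambda>w. l w * (D w * PF H w))"
      using integrable_Linfty_mult[OF F.integrable_P[OF H] Linfty_FS[OF lFS]] by (simp add: mult.commute)
    have "AE w in M. PG (\<lambda>w. l w * H w) w = real_cond_exp M G (\<lambda>w. l w * (D w * PF H w)) w"
    proof (rule PG_eq[OF Linfty_mult[OF Linfty_FS[OF lFS] H] int])
      show "AE w in M. D w * PF (\<lambda>w. l w * H w) w = l w * (D w * PF H w)"
        using F.P_scale[OF H lFS nn] by eventually_elim simp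
    qed
    moreover have "AE w in M. real_cond_exp M G (\<lambda>w. l w * (D w * PF H w)) w
        = l w * real_cond_exp M G (\<lambda>w. D w * PF H w) w"
      using l F.integrable_P[OF H] by (intro G.real_cond_exp_mult int) (auto simp: Linfty_def)
    ultimately show "AE w in M. PG (\<lambda>w. l w * H w) w = l w * PG H w"
      using PG'[OF H] by eventually_elim simp
  next
    fix H m assume H: "H \<in> Linfty M M" and m: "m \<in> Linfty M G"
    show "AE w in M. PG (\<lambda>w. H w + m w) w = PG H w + m w"
      using consistent[OF H Linfty_G[OF m]] cond_exp_Q_mult[OF m] by eventually_elim simp
  next
    fix H c and Hs :: "nat \<Rightarrow> 'a \<Rightarrow> real"
    assume Hs: "\<And>n. Hs n \<in> borel_measurable M" "\<And>n. AE w in M. \<bar>Hs n w\<bar> \<le> c"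
      and H: "H \<in> Linfty M M" and lim: "AE w in M. (\<lambda>n. Hs n w) \<longlonglongrightarrow> H w"
    have "AE w in M. PG (Hs n) w = real_cond_exp M G (\<lambda>w. D w * PF (Hs n) w) w" for n
      by (rule PG'[OF LinftyI[OF Hs]])
    then have "AE w in M. \<forall>n. PG (Hs n) w = real_cond_exp M G (\<lambda>w. D w * PF (Hs n) w) w"
      by (simp add: AE_all_countable)
    with F.real_cond_exp_weighted_Fatou[OF G_M Hs H lim] PG'[OF H]
    show "AE w in M. ereal (PG H w) \<le> liminf (\<lambda>n. ereal (PG (Hs n) w))"
      by eventually_elim simp
  qed
qed

end

section \<open>From a market-consistent evaluation to one conditional on the market\<close>

locale market_evaluation = market_density M G FS D for M :: "'a measure" and G FS D +
  fixes PG :: "('a \<Rightarrow> real) \<Rightarrow> ('a \<Rightarrow> real)"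
  assumes PG_coherent: "coherent_evaluation M G (Linfty M G) PG"
    and PG_consistent: "market_consistent M G FS D PG"
    and PG_local: "market_local M FS PG"
begin

lemma PG_Linfty: "H \<in> Linfty M M \<Longrightarrow> PG H \<in> Linfty M G"
  using PG_coherent by (simp add: coherent_evaluation_def cond_evaluation_def Linfty_map_def)

lemma PG_integrable:
  assumes "H \<in> Linfty M M"
  shows "integrable M (PG H)"
proof -
  have "PG H \<in> Linfty M M" by (rule Linfty_FS[OF Linfty_G[OF PG_Linfty[OF assms]]])
  from integrable_Linfty_mult[OF integrable_const[of 1] this] show ?thesis by simp
qed

sublocale E: weighted_coherent_evaluation M G "\<lambda>_. 1" PG
proof unfold_locales
  show "coherent_evaluation M G (L1_density M G (\<lambda>_. 1)) PG"
    by (rule coherent_evaluation_change_codomain[OF PG_coherent])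
      (use PG_Linfty PG_integrable in \<open>auto simp: L1_density_def Linfty_def\<close>)
qed (auto simp: G_M)

lemma PG_add_market:
  assumes "X \<in> Linfty M FS" "H \<in> Linfty M M"
  shows "AE w in M. PG (\<lambda>w. X w + H w) w = cond_exp_Q M G D X w + PG H w"
  using PG_consistent assms by (simp add: market_consistent_def)

lemma PG_market:
  assumes "X \<in> Linfty M FS"
  shows "AE w in M. PG X w = cond_exp_Q M G D X w"
  using PG_add_market[OF assms Linfty_const, of 0] E.P_zero by eventually_elim simp

lemma integral_PG_market:
  assumes X: "X \<in> Linfty M FS"
  shows "(\<integral>w. PG X w \<partial>M) = (\<integral>w. D w * X w \<partial>M)"
proof -
  have int: "integrable M (\<lambda>w. D w * X w)" by (rule integrable_Linfty_mult[OF D_int Linfty_FS[OF X]])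
  have "(\<integral>w. PG X w \<partial>M) = (\<integral>w. cond_exp_Q M G D X w \<partial>M)"
    using PG_market[OF X] PG_integrable[OF Linfty_FS[OF X]]
    by (intro integral_cong_AE) (auto simp: cond_exp_Q_def)
  also have "\<dots> = (\<integral>w. D w * X w \<partial>M)"
    unfolding cond_exp_Q_def by (rule G.real_cond_exp_int(2)[OF int])
  finally show ?thesis .
qed

text \<open>Adding a constant, which market-consistency prices, extends the market local property from
  nonnegative payoffs to all bounded ones.\<close>

lemma PG_split:
  assumes B: "B \<in> sets FS" and H: "H \<in> Linfty M M"
  shows "AE w in M. PG H w = PG (\<lambda>w. indicator B w * H w) w + PG (\<lambda>w. indicator (space M - B) w * H w) w"
proof -
  have B': "space M - B \<in> sets FS" using sets.compl_sets[OF B] by simp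
  obtain c where c: "AE w in M. \<bar>H w\<bar> \<le> c" using H by (auto simp: Linfty_def)
  let ?K = "\<lambda>w. c + H w"
  have nn: "AE w in M. 0 \<le> ?K w" using c by eventually_elim linarith
  have part: "AE w in M. PG (\<lambda>w. indicator C w * ?K w) w
      = cond_exp_Q M G D (\<lambda>w. indicator C w * c) w + PG (\<lambda>w. indicator C w * H w) w"
    if C: "C \<in> sets FS" for C
    using PG_add_market[OF Linfty_mult[OF Linfty_indicator[OF C] Linfty_const[of c]]
        Linfty_mult[OF Linfty_indicator[OF sets_FS[OF C]] H]]
    by (simp add: distrib_left)
  have "AE w in M. PG ?K w = PG (\<lambda>w. indicator B w * ?K w) w + PG (\<lambda>w. indicator (space M - B) w * ?K w) w"
    using PG_local B Linfty_add[OF Linfty_const H] nn by (simp add: market_local_def)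
  \<comment> \<open>The prices of \<open>c\<close> on \<open>B\<close> and on its complement add up
    to the price of \<open>c\<close>, so the shift cancels.\<close>
  moreover have "AE w in M. cond_exp_Q M G D (\<lambda>_. c) w = cond_exp_Q M G D (\<lambda>w. indicator B w * c) w
      + cond_exp_Q M G D (\<lambda>w. indicator (space M - B) w * c) w"
  proof -
    have int: "integrable M (\<lambda>w. D w * (indicator C w * c))" if "C \<in> sets FS" for C
      by (intro integrable_Linfty_mult[OF D_int] Linfty_mult Linfty_const Linfty_indicator sets_FS that)
    have "AE w in M. real_cond_exp M G (\<lambda>w. D w * c) w
        = real_cond_exp M G (\<lambda>w. D w * (indicator B w * c) + D w * (indicator (space M - B) w * c)) w"
    proof (rule G.real_cond_exp_cong)
      show "AE w in M. D w * c = D w * (indicator B w * c) + D w * (indicator (space M - B) w * c)"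
        using AE_space by eventually_elim (auto split: split_indicator)
    qed (use int[OF B] int[OF B'] D_int in auto)
    with G.real_cond_exp_add[OF int[OF B] int[OF B']] show ?thesis
      unfolding cond_exp_Q_def by eventually_elim simp
  qed
  ultimately show ?thesis
    using part[OF B] part[OF B'] PG_add_market[OF Linfty_const[of c] H] by eventually_elim simp
qed

lemma dual_integral_le:
  assumes \<xi>: "\<xi> \<in> E.dual_densities" and H: "H \<in> Linfty M M"
  shows "(\<integral>w. \<xi> w * H w \<partial>M) \<le> (\<integral>w. PG H w \<partial>M)"
proof -
  have int: "integrable M (\<lambda>w. \<xi> w * H w)"
    by (rule integrable_Linfty_mult[OF E.dual_densities_integrable[OF \<xi>] H])
  have "(\<integral>w. \<xi> w * H w \<partial>M) = (\<integral>w. real_cond_exp M G (\<lambda>w. \<xi> w * H w) w \<partial>M)"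
    using G.real_cond_exp_int(2)[OF int] by simp
  also have "\<dots> \<le> (\<integral>w. PG H w \<partial>M)"
    using E.dual_densities_le[OF \<xi> H]
    by (intro integral_mono_AE G.real_cond_exp_int(1)[OF int] PG_integrable[OF H]) simp
  finally show ?thesis .
qed

text \<open>Market-consistency prices the payoffs \<open>c * indicator B\<close> with
  \<open>B\<close> in \<open>FS\<close> linearly, so \<open>c = 1\<close> and \<open>c = -1\<close>
  turn the dual inequality into an equality of integrals over \<open>B\<close>.\<close>

lemma dual_cond_exp_FS:
  assumes \<xi>: "\<xi> \<in> E.dual_densities"
  shows "AE w in M. real_cond_exp M FS \<xi> w = D w"
proof (rule FS.real_cond_exp_charact)
  fix B assume B: "B \<in> sets FS"
  have L: "(\<lambda>w. c * indicator B w) \<in> Linfty M FS" for c :: real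
    by (intro Linfty_mult Linfty_const Linfty_indicator B)
  have le: "c * (\<integral>w. \<xi> w * indicator B w \<partial>M) \<le> c * (\<integral>w. D w * indicator B w \<partial>M)" for c :: real
    using dual_integral_le[OF \<xi> Linfty_FS[OF L], of c] integral_PG_market[OF L, of c]
    by (simp add: mult.left_commute[of _ c])
  show "(\<integral>w\<in>B. \<xi> w \<partial>M) = (\<integral>w\<in>B. D w \<partial>M)"
    using le[of 1] le[of "-1"] by (simp add: set_lebesgue_integral_def mult.commute)
qed (use E.dual_densities_integrable[OF \<xi>] D_int D_meas in auto)

text \<open>Each density is tested on its own part of the payoff, and the market local property
  recombines the two values of \<open>PG\<close> without loss; subadditivity alone would point in
  the wrong direction.\<close>

lemma dual_paste:
  assumes \<xi>: "\<xi> \<in> E.dual_densities" and \<eta>: "\<eta> \<in> E.dual_densities" and B: "B \<in> sets FS"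
  shows "(\<lambda>w. indicator B w * \<xi> w + indicator (space M - B) w * \<eta> w) \<in> E.dual_densities"
    (is "?\<zeta> \<in> _")
proof -
  have B': "space M - B \<in> sets FS" using sets.compl_sets[OF B] by simp
  have BL: "(indicator C :: 'a \<Rightarrow> real) \<in> Linfty M M" if "C \<in> sets FS" for C
    by (intro Linfty_indicator sets_FS that)
  have int: "integrable M (\<lambda>w. \<alpha> w * (indicator C w * H w))"
    if "\<alpha> \<in> E.dual_densities" "C \<in> sets FS" "H \<in> Linfty M M" for \<alpha> C H
    by (intro integrable_Linfty_mult[OF E.dual_densities_integrable] Linfty_mult BL that)
  have "integrable M ?\<zeta>"
    using int[OF \<xi> B Linfty_const, of 1] int[OF \<eta> B' Linfty_const, of 1] by (simp add: mult.commute)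
  moreover have "AE w in M. real_cond_exp M G (\<lambda>w. ?\<zeta> w * H w) w \<le> 1 * PG H w" if H: "H \<in> Linfty M M" for H
  proof -
    have eq: "(\<lambda>w. ?\<zeta> w * H w) = (\<lambda>w. \<xi> w * (indicator B w * H w) + \<eta> w * (indicator (space M - B) w * H w))"
      by (simp add: algebra_simps)
    from G.real_cond_exp_add[OF int[OF \<xi> B H] int[OF \<eta> B' H]]
      E.dual_densities_le[OF \<xi> Linfty_mult[OF BL[OF B] H]]
      E.dual_densities_le[OF \<eta> Linfty_mult[OF BL[OF B'] H]] PG_split[OF B H]
    show ?thesis unfolding eq by eventually_elim simp
  qed
  ultimately show ?thesis by (simp add: E.dual_densities_def)
qed

definition cond_values :: "('a \<Rightarrow> real) \<Rightarrow> ('a \<Rightarrow> real) set" where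
  "cond_values H = (\<lambda>\<xi>. real_cond_exp M FS (\<lambda>w. \<xi> w * H w)) ` E.dual_densities"

text \<open>Pasting along the event where one conditional expectation is at least the other gives a
  density whose conditional expectation is the pointwise maximum.\<close>

lemma cond_values_directed:
  assumes H: "H \<in> Linfty M M" and "f \<in> cond_values H" "g \<in> cond_values H"
  shows "\<exists>h\<in>cond_values H. AE w in M. f w \<le> h w \<and> g w \<le> h w"
proof -
  obtain \<xi> \<eta> where \<xi>: "\<xi> \<in> E.dual_densities" "f = real_cond_exp M FS (\<lambda>w. \<xi> w * H w)"
    and \<eta>: "\<eta> \<in> E.dual_densities" "g = real_cond_exp M FS (\<lambda>w. \<eta> w * H w)"
    using assms by (auto simp: cond_values_def)
  have [measurable]: "f \<in> borel_measurable FS" "g \<in> borel_measurable FS" using \<xi> \<eta> by simp_all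
  define B where "B = {w \<in> space FS. g w \<le> f w}"
  have B: "B \<in> sets FS" unfolding B_def by measurable
  have B': "space M - B \<in> sets FS" using sets.compl_sets[OF B] by simp
  have mult: "AE w in M. real_cond_exp M FS (\<lambda>w. indicator C w * (\<alpha> w * H w)) w
      = indicator C w * real_cond_exp M FS (\<lambda>w. \<alpha> w * H w) w"
    and int: "integrable M (\<lambda>w. indicator C w * (\<alpha> w * H w))"
    if C: "C \<in> sets FS" and \<alpha>: "\<alpha> \<in> E.dual_densities" for C \<alpha>
  proof -
    have i: "integrable M (\<lambda>w. \<alpha> w * H w)"
      by (rule integrable_Linfty_mult[OF E.dual_densities_integrable[OF \<alpha>] H])
    show i2: "integrable M (\<lambda>w. indicator C w * (\<alpha> w * H w))"
      using integrable_Linfty_mult[OF i Linfty_indicator[OF sets_FS[OF C]]] by (simp add: mult.commute)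
    show "AE w in M. real_cond_exp M FS (\<lambda>w. indicator C w * (\<alpha> w * H w)) w
      = indicator C w * real_cond_exp M FS (\<lambda>w. \<alpha> w * H w) w"
      using C i by (intro FS.real_cond_exp_mult i2) auto
  qed
  let ?\<zeta> = "\<lambda>w. indicator B w * \<xi> w + indicator (space M - B) w * \<eta> w"
  let ?h = "real_cond_exp M FS (\<lambda>w. ?\<zeta> w * H w)"
  have eq: "(\<lambda>w. ?\<zeta> w * H w) = (\<lambda>w. indicator B w * (\<xi> w * H w) + indicator (space M - B) w * (\<eta> w * H w))"
    by (simp add: algebra_simps)
  have "AE w in M. ?h w = indicator B w * f w + indicator (space M - B) w * g w"
    using FS.real_cond_exp_add[OF int[OF B \<xi>(1)] int[OF B' \<eta>(1)]] mult[OF B \<xi>(1)] mult[OF B' \<eta>(1)]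
    unfolding eq \<xi>(2) \<eta>(2) by eventually_elim simp
  then have "AE w in M. f w \<le> ?h w \<and> g w \<le> ?h w"
    using AE_space by eventually_elim (auto simp: B_def split: split_indicator)
  moreover have "?h \<in> cond_values H"
    unfolding cond_values_def by (rule imageI[OF dual_paste[OF \<xi>(1) \<eta>(1) B]])
  ultimately show ?thesis by blast
qed

lemma ess_sup_cond_values:
  assumes H: "H \<in> Linfty M M"
  shows "\<exists>Y. Y \<in> borel_measurable FS \<and> integrable M Y \<and> is_ess_sup M (cond_values H) Y \<and>
    (\<integral>w. Y w \<partial>M) = (\<integral>w. PG H w \<partial>M)"
proof -
  have int: "integrable M (\<lambda>w. \<xi> w * H w)" if "\<xi> \<in> E.dual_densities" for \<xi>
    by (rule integrable_Linfty_mult[OF E.dual_densities_integrable[OF that] H])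
  show ?thesis
  proof (rule directed_ess_sup[OF FS_M, of "cond_values H" "\<integral>w. PG H w \<partial>M"])
    show "integrable M f \<and> f \<in> borel_measurable FS" if "f \<in> cond_values H" for f
      using that FS.real_cond_exp_int(1)[OF int] by (auto simp: cond_values_def)
    show "\<exists>h\<in>cond_values H. AE w in M. f w \<le> h w \<and> g w \<le> h w"
      if "f \<in> cond_values H" "g \<in> cond_values H" for f g
      by (rule cond_values_directed[OF H that])
    show "(\<integral>w. f w \<partial>M) \<le> (\<integral>w. PG H w \<partial>M)" if "f \<in> cond_values H" for f
      using that FS.real_cond_exp_int(2)[OF int] dual_integral_le[OF _ H] by (auto simp: cond_values_def)
    show "\<exists>f\<in>cond_values H. (\<integral>w. PG H w \<partial>M) - e \<le> (\<integral>w. f w \<partial>M)" if "0 < e" for e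
      using E.exists_dual_density[OF H that] FS.real_cond_exp_int(2)[OF int] by (auto simp: cond_values_def)
  next
    fix Y assume "Y \<in> borel_measurable FS" "integrable M Y" "is_ess_sup M (cond_values H) Y"
      "(\<integral>w. Y w \<partial>M) = (\<integral>w. PG H w \<partial>M)"
    then show ?thesis by (intro exI[of _ Y] conjI)
  qed
qed

text \<open>This is \<open>D\<close> times the evaluation under construction. The integral is
  recorded along with the supremum because the agreement with \<open>PG\<close> is derived from
  it.\<close>

definition cond_sup :: "('a \<Rightarrow> real) \<Rightarrow> ('a \<Rightarrow> real)" where
  "cond_sup H = (SOME Y. Y \<in> borel_measurable FS \<and> integrable M Y \<and> is_ess_sup M (cond_values H) Y \<and>
    (\<integral>w. Y w \<partial>M) = (\<integral>w. PG H w \<partial>M))"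

lemma cond_sup:
  assumes "H \<in> Linfty M M"
  shows cond_sup_meas: "cond_sup H \<in> borel_measurable FS"
    and cond_sup_int: "integrable M (cond_sup H)"
    and cond_sup_ess_sup: "is_ess_sup M (cond_values H) (cond_sup H)"
    and integral_cond_sup: "(\<integral>w. cond_sup H w \<partial>M) = (\<integral>w. PG H w \<partial>M)"
  using someI_ex[OF ess_sup_cond_values[OF assms]] unfolding cond_sup_def by blast+

lemma cond_sup_upper:
  assumes H: "H \<in> Linfty M M" and \<xi>: "\<xi> \<in> E.dual_densities"
  shows "AE w in M. real_cond_exp M FS (\<lambda>w. \<xi> w * H w) w \<le> cond_sup H w"
  using cond_sup_ess_sup[OF H] \<xi> by (auto simp: is_ess_sup_def cond_values_def)

lemma cond_sup_least:
  assumes H: "H \<in> Linfty M M" and U: "U \<in> borel_measurable M"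
    and ub: "\<And>\<xi>. \<xi> \<in> E.dual_densities \<Longrightarrow> AE w in M. real_cond_exp M FS (\<lambda>w. \<xi> w * H w) w \<le> U w"
  shows "AE w in M. cond_sup H w \<le> U w"
  using cond_sup_ess_sup[OF H] U ub by (auto simp: is_ess_sup_def cond_values_def)

lemma cond_sup_meas_M: "H \<in> Linfty M M \<Longrightarrow> cond_sup H \<in> borel_measurable M"
  using cond_sup_int by blast

lemma integrable_dual_mult: "\<xi> \<in> E.dual_densities \<Longrightarrow> H \<in> Linfty M M \<Longrightarrow> integrable M (\<lambda>w. \<xi> w * H w)"
  by (rule integrable_Linfty_mult[OF E.dual_densities_integrable])

lemma cond_sup_le_if_AE_eq:
  assumes H: "H \<in> Linfty M M" "H' \<in> Linfty M M" and eq: "AE w in M. H w = H' w"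
  shows "AE w in M. cond_sup H w \<le> cond_sup H' w"
proof (rule cond_sup_least[OF H(1) cond_sup_meas_M[OF H(2)]])
  fix \<xi> assume \<xi>: "\<xi> \<in> E.dual_densities"
  have "AE w in M. real_cond_exp M FS (\<lambda>w. \<xi> w * H w) w = real_cond_exp M FS (\<lambda>w. \<xi> w * H' w) w"
    using eq integrable_dual_mult[OF \<xi>] H by (intro FS.real_cond_exp_cong) auto
  with cond_sup_upper[OF H(2) \<xi>]
  show "AE w in M. real_cond_exp M FS (\<lambda>w. \<xi> w * H w) w \<le> cond_sup H' w"
    by eventually_elim simp
qed

lemma cond_sup_cong:
  assumes H: "H \<in> Linfty M M" "H' \<in> Linfty M M" and eq: "AE w in M. H w = H' w"
  shows "AE w in M. cond_sup H w = cond_sup H' w"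
proof -
  have "AE w in M. H' w = H w" using eq by eventually_elim simp
  from cond_sup_le_if_AE_eq[OF H eq] cond_sup_le_if_AE_eq[OF H(2,1) this] show ?thesis
    by eventually_elim simp
qed

lemma cond_sup_add:
  assumes H: "H1 \<in> Linfty M M" "H2 \<in> Linfty M M"
  shows "AE w in M. cond_sup (\<lambda>w. H1 w + H2 w) w \<le> cond_sup H1 w + cond_sup H2 w"
proof (rule cond_sup_least[OF Linfty_add[OF H]])
  show "(\<lambda>w. cond_sup H1 w + cond_sup H2 w) \<in> borel_measurable M"
    using cond_sup_meas_M H by simp
  fix \<xi> assume \<xi>: "\<xi> \<in> E.dual_densities"
  from FS.real_cond_exp_add[OF integrable_dual_mult[OF \<xi> H(1)] integrable_dual_mult[OF \<xi> H(2)]]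
    cond_sup_upper[OF H(1) \<xi>] cond_sup_upper[OF H(2) \<xi>]
  show "AE w in M. real_cond_exp M FS (\<lambda>w. \<xi> w * (H1 w + H2 w)) w \<le> cond_sup H1 w + cond_sup H2 w"
    unfolding distrib_left by eventually_elim simp
qed

text \<open>One inequality tests the supremum directly. The other divides by \<open>l\<close>, which
  is possible only where \<open>l\<close> is positive.\<close>

lemma cond_sup_scale:
  assumes H: "H \<in> Linfty M M" and l: "l \<in> Linfty M FS" and nn: "AE w in M. 0 \<le> l w"
  shows "AE w in M. cond_sup (\<lambda>w. l w * H w) w = l w * cond_sup H w"
proof -
  have lM: "l \<in> Linfty M M" by (rule Linfty_FS[OF l])
  have lH: "(\<lambda>w. l w * H w) \<in> Linfty M M" by (rule Linfty_mult[OF lM H])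
  have [measurable]: "l \<in> borel_measurable M" using lM by (simp add: Linfty_def)
  note [measurable] = cond_sup_meas_M[OF H] cond_sup_meas_M[OF lH]
  have mult: "AE w in M. real_cond_exp M FS (\<lambda>w. \<xi> w * (l w * H w)) w
      = l w * real_cond_exp M FS (\<lambda>w. \<xi> w * H w) w" if \<xi>: "\<xi> \<in> E.dual_densities" for \<xi>
  proof -
    have eq: "(\<lambda>w. \<xi> w * (l w * H w)) = (\<lambda>w. l w * (\<xi> w * H w))" by (simp add: mult.left_commute)
    show ?thesis
      using l integrable_dual_mult[OF \<xi> H] integrable_dual_mult[OF \<xi> lH]
      unfolding eq by (intro FS.real_cond_exp_mult) (auto simp: Linfty_def)
  qed
  have le: "AE w in M. cond_sup (\<lambda>w. l w * H w) w \<le> l w * cond_sup H w"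
  proof (rule cond_sup_least[OF lH])
    fix \<xi> assume \<xi>: "\<xi> \<in> E.dual_densities"
    from mult[OF \<xi>] cond_sup_upper[OF H \<xi>] nn
    show "AE w in M. real_cond_exp M FS (\<lambda>w. \<xi> w * (l w * H w)) w \<le> l w * cond_sup H w"
      by eventually_elim (simp add: mult_left_mono)
  qed measurable
  \<comment> \<open>Where \<open>l\<close> is not positive, \<open>U\<close> falls back on the
    trivial bound.\<close>
  define U where "U w = (if 0 < l w then cond_sup (\<lambda>w. l w * H w) w / l w else cond_sup H w)" for w
  obtain \<xi> where \<xi>: "\<xi> \<in> E.dual_densities" using E.exists_dual_density[OF Linfty_const, of 1 0] by auto
  have "AE w in M. cond_sup H w \<le> U w"
  proof (rule cond_sup_least[OF H])
    show "U \<in> borel_measurable M" unfolding U_def by measurable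
    fix \<xi> assume \<xi>: "\<xi> \<in> E.dual_densities"
    from mult[OF \<xi>] cond_sup_upper[OF H \<xi>] cond_sup_upper[OF lH \<xi>]
    show "AE w in M. real_cond_exp M FS (\<lambda>w. \<xi> w * H w) w \<le> U w"
      by eventually_elim (simp add: U_def pos_le_divide_eq mult.commute)
  qed
  then show ?thesis
    using le nn mult[OF \<xi>] cond_sup_upper[OF lH \<xi>]
  proof eventually_elim
    case (elim w)
    show ?case
    proof (cases "0 < l w")
      case True
      then have "l w * cond_sup H w \<le> cond_sup (\<lambda>w. l w * H w) w"
        using elim(1) by (simp add: U_def pos_le_divide_eq mult.commute)
      then show ?thesis using elim(2) by simp
    next
      case False
      \<comment> \<open>Here the supremum for \<open>l * H\<close> is at most 0 by the first
        inequality and at least 0 by any single dual density.\<close>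
      then have "l w = 0" using elim(3) by simp
      then show ?thesis using elim(2,4,5) by simp
    qed
  qed
qed

text \<open>\<open>E[\<xi> m | FS] = D * m\<close> is the same for every dual density, so the whole
  family shifts by \<open>D * m\<close>; division by \<open>D\<close> will turn this into cash
  invariance.\<close>

lemma cond_sup_cash:
  assumes H: "H \<in> Linfty M M" and m: "m \<in> Linfty M FS"
  shows "AE w in M. cond_sup (\<lambda>w. H w + m w) w = cond_sup H w + D w * m w"
proof -
  have mM: "m \<in> Linfty M M" by (rule Linfty_FS[OF m])
  have Hm: "(\<lambda>w. H w + m w) \<in> Linfty M M" by (rule Linfty_add[OF H mM])
  have [measurable]: "m \<in> borel_measurable M" "D \<in> borel_measurable M"
    using mM D_int by (auto simp: Linfty_def)
  note [measurable] = cond_sup_meas_M[OF H] cond_sup_meas_M[OF Hm]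
  have eq: "AE w in M. real_cond_exp M FS (\<lambda>w. \<xi> w * (H w + m w)) w
      = real_cond_exp M FS (\<lambda>w. \<xi> w * H w) w + D w * m w" if \<xi>: "\<xi> \<in> E.dual_densities" for \<xi>
  proof -
    have "AE w in M. real_cond_exp M FS (\<lambda>w. m w * \<xi> w) w = m w * real_cond_exp M FS \<xi> w"
      using m integrable_dual_mult[OF \<xi> mM] E.dual_densities_integrable[OF \<xi>]
      by (intro FS.real_cond_exp_mult) (auto simp: Linfty_def mult.commute)
    with FS.real_cond_exp_add[OF integrable_dual_mult[OF \<xi> H] integrable_dual_mult[OF \<xi> mM]]
      dual_cond_exp_FS[OF \<xi>]
    show ?thesis unfolding distrib_left mult.commute[of "m _"] by eventually_elim simp
  qed
  have "AE w in M. cond_sup (\<lambda>w. H w + m w) w \<le> cond_sup H w + D w * m w"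
  proof (rule cond_sup_least[OF Hm])
    fix \<xi> assume \<xi>: "\<xi> \<in> E.dual_densities"
    from eq[OF \<xi>] cond_sup_upper[OF H \<xi>]
    show "AE w in M. real_cond_exp M FS (\<lambda>w. \<xi> w * (H w + m w)) w \<le> cond_sup H w + D w * m w"
      by eventually_elim simp
  qed measurable
  moreover have "AE w in M. cond_sup H w \<le> cond_sup (\<lambda>w. H w + m w) w - D w * m w"
  proof (rule cond_sup_least[OF H])
    fix \<xi> assume \<xi>: "\<xi> \<in> E.dual_densities"
    from eq[OF \<xi>] cond_sup_upper[OF Hm \<xi>]
    show "AE w in M. real_cond_exp M FS (\<lambda>w. \<xi> w * H w) w \<le> cond_sup (\<lambda>w. H w + m w) w - D w * m w"
      by eventually_elim simp
  qed measurable
  ultimately show ?thesis by eventually_elim simp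
qed

text \<open>For a single density, conditional Fatou applies with the integrable bound
  \<open>c * \<bar>\<xi>\<bar>\<close>; the property then passes to the supremum.\<close>

lemma cond_sup_Fatou:
  assumes Hs: "\<And>n::nat. Hs n \<in> borel_measurable M" "\<And>n. AE w in M. \<bar>Hs n w\<bar> \<le> c"
    and H: "H \<in> Linfty M M" and lim: "AE w in M. (\<lambda>n. Hs n w) \<longlonglongrightarrow> H w"
  shows "AE w in M. ereal (cond_sup H w) \<le> liminf (\<lambda>n. ereal (cond_sup (Hs n) w))"
proof -
  have HsL: "Hs n \<in> Linfty M M" for n by (rule LinftyI[OF Hs])
  note [measurable] = cond_sup_meas_M[OF H] cond_sup_meas_M[OF HsL]
  define L where "L w = liminf (\<lambda>n. ereal (cond_sup (Hs n) w))" for w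
  have [measurable]: "L \<in> borel_measurable M" unfolding L_def by measurable
  have upper: "AE w in M. ereal (real_cond_exp M FS (\<lambda>w. \<xi> w * H w) w) \<le> L w"
    if \<xi>: "\<xi> \<in> E.dual_densities" for \<xi>
  proof -
    have "integrable M (\<lambda>w. c * \<bar>\<xi> w\<bar>)" using E.dual_densities_integrable[OF \<xi>] by simp
    moreover have "AE w in M. - (c * \<bar>\<xi> w\<bar>) \<le> \<xi> w * Hs n w" for n
      using Hs(2)[of n]
    proof eventually_elim
      case (elim w)
      then have "\<bar>\<xi> w\<bar> * \<bar>Hs n w\<bar> \<le> \<bar>\<xi> w\<bar> * c" by (intro mult_left_mono) auto
      then have "\<bar>\<xi> w * Hs n w\<bar> \<le> c * \<bar>\<xi> w\<bar>" by (simp add: abs_mult mult.commute)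
      then show ?case by linarith
    qed
    moreover have "AE w in M. ereal (\<xi> w * H w) \<le> liminf (\<lambda>n. ereal (\<xi> w * Hs n w))"
      using lim
    proof eventually_elim
      case (elim w)
      then have "(\<lambda>n. ereal (\<xi> w * Hs n w)) \<longlonglongrightarrow> ereal (\<xi> w * H w)"
        by (intro tendsto_ereal tendsto_mult tendsto_const)
      from lim_imp_Liminf[OF sequentially_bot this] show ?case by simp
    qed
    ultimately have "AE w in M. ereal (real_cond_exp M FS (\<lambda>w. \<xi> w * H w) w)
        \<le> liminf (\<lambda>n. ereal (real_cond_exp M FS (\<lambda>w. \<xi> w * Hs n w) w))"
      by (rule FS.real_cond_exp_Fatou[OF integrable_dual_mult[OF \<xi> HsL] integrable_dual_mult[OF \<xi> H]])
    moreover have "AE w in M. \<forall>n. real_cond_exp M FS (\<lambda>w. \<xi> w * Hs n w) w \<le> cond_sup (Hs n) w"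
      unfolding AE_all_countable using cond_sup_upper[OF HsL \<xi>] by blast
    ultimately show ?thesis
    proof eventually_elim
      case (elim w)
      have "liminf (\<lambda>n. ereal (real_cond_exp M FS (\<lambda>w. \<xi> w * Hs n w) w)) \<le> L w"
        unfolding L_def using elim(2) by (intro Liminf_mono always_eventually) simp
      then show ?case using elim(1) by (rule order_trans[rotated])
    qed
  qed
  \<comment> \<open>Upper bounds in \<open>is_ess_sup\<close> are real-valued, while
    \<open>L\<close> may be infinite. Where it is plus infinity the claim is trivial and
    \<open>cond_sup H\<close> serves as the bound; minus infinity is excluded almost surely by any
    single density.\<close>
  define U where "U w = (if L w = \<infinity> then cond_sup H w else real_of_ereal (L w))" for w
  obtain \<xi> where \<xi>: "\<xi> \<in> E.dual_densities" using E.exists_dual_density[OF Linfty_const, of 1 0] by auto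
  have "AE w in M. cond_sup H w \<le> U w"
  proof (rule cond_sup_least[OF H])
    show "U \<in> borel_measurable M" unfolding U_def by measurable
    fix \<xi> assume \<xi>: "\<xi> \<in> E.dual_densities"
    from upper[OF \<xi>] cond_sup_upper[OF H \<xi>]
    show "AE w in M. real_cond_exp M FS (\<lambda>w. \<xi> w * H w) w \<le> U w"
    proof eventually_elim
      case (elim w)
      then show ?case by (cases "L w") (auto simp: U_def)
    qed
  qed
  then have "AE w in M. ereal (cond_sup H w) \<le> L w"
    using upper[OF \<xi>]
  proof eventually_elim
    case (elim w)
    then show ?case by (cases "L w") (auto simp: U_def)
  qed
  then show ?thesis by (simp add: L_def)
qed

text \<open>Equality of expectations for all payoffs is enough: replacing \<open>H\<close> by
  \<open>indicator B * H\<close> with \<open>B\<close> in \<open>G\<close> localizes it on both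
  sides.\<close>

lemma cond_exp_cond_sup:
  assumes H: "H \<in> Linfty M M"
  shows "AE w in M. real_cond_exp M G (cond_sup H) w = PG H w"
proof (rule G.real_cond_exp_charact)
  fix B assume B: "B \<in> sets G"
  have BL: "(indicator B :: 'a \<Rightarrow> real) \<in> Linfty M FS" by (rule Linfty_indicator[OF sets_G[OF B]])
  have BM: "(indicator B :: 'a \<Rightarrow> real) \<in> Linfty M M" by (rule Linfty_FS[OF BL])
  have BH: "(\<lambda>w. indicator B w * H w) \<in> Linfty M M" by (rule Linfty_mult[OF BM H])
  have "(\<integral>w\<in>B. cond_sup H w \<partial>M) = (\<integral>w. cond_sup (\<lambda>w. indicator B w * H w) w \<partial>M)"
    unfolding set_lebesgue_integral_def
    using cond_sup_scale[OF H BL] integrable_Linfty_mult[OF cond_sup_int[OF H] BM] cond_sup_int[OF BH]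
    by (intro integral_cong_AE) (auto simp: mult.commute elim!: eventually_mono)
  also have "\<dots> = (\<integral>w. PG (\<lambda>w. indicator B w * H w) w \<partial>M)" by (rule integral_cond_sup[OF BH])
  also have "\<dots> = (\<integral>w\<in>B. PG H w \<partial>M)"
    unfolding set_lebesgue_integral_def
    using E.P_indicator[OF H B] integrable_Linfty_mult[OF PG_integrable[OF H] BM] PG_integrable[OF BH]
    by (intro integral_cong_AE) (auto simp: mult.commute elim!: eventually_mono)
  finally show "(\<integral>w\<in>B. cond_sup H w \<partial>M) = (\<integral>w\<in>B. PG H w \<partial>M)" .
qed (use cond_sup_int[OF H] PG_integrable[OF H] PG_Linfty[OF H] in \<open>auto simp: Linfty_def\<close>)

text \<open>The witness is \<open>cond_sup H\<close> divided by \<open>D\<close>. Its product with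
  \<open>D\<close> is integrable, which is exactly what membership in \<open>L1_density\<close>
  asks.\<close>

theorem exists_market_conditional_evaluation:
  "\<exists>PF. coherent_evaluation M FS (L1_density M FS D) PF \<and>
    (\<forall>H \<in> Linfty M M. AE w in M. PG H w = cond_exp_Q M G D (PF H) w)"
proof (intro exI conjI ballI)
  let ?P = "\<lambda>H w. inverse (D w) * cond_sup H w"
  have D_M [measurable]: "D \<in> borel_measurable M" using D_int by simp
  have DP: "AE w in M. D w * ?P H w = cond_sup H w" for H
    using D_pos by eventually_elim simp
  have int: "integrable M (\<lambda>w. D w * ?P H w)" if H: "H \<in> Linfty M M" for H
    using integrable_cong_AE[OF _ _ DP[of H]] cond_sup_int[OF H] cond_sup_meas_M[OF H] by simp
  show "AE w in M. PG H w = cond_exp_Q M G D (?P H) w" if H: "H \<in> Linfty M M" for H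
  proof -
    have "AE w in M. cond_exp_Q M G D (?P H) w = real_cond_exp M G (cond_sup H) w"
      unfolding cond_exp_Q_def
      using DP int[OF H] cond_sup_int[OF H] by (intro G.real_cond_exp_cong) auto
    with cond_exp_cond_sup[OF H] show ?thesis by eventually_elim simp
  qed
  show "coherent_evaluation M FS (L1_density M FS D) ?P"
  proof (rule coherent_evaluationI[OF FS_M])
    have "?P H \<in> borel_measurable FS" if "H \<in> Linfty M M" for H
      using cond_sup_meas[OF that] D_meas by measurable
    moreover have "AE w in M. ?P H w = ?P H' w"
      if "H \<in> Linfty M M" "H' \<in> Linfty M M" "AE w in M. H w = H' w" for H H'
      using cond_sup_cong[OF that] by eventually_elim simp
    ultimately show "Linfty_map M (L1_density M FS D) ?P"
      using int by (simp add: Linfty_map_def L1_density_def)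
  next
    fix H1 H2 assume H: "H1 \<in> Linfty M M" "H2 \<in> Linfty M M"
    show "AE w in M. ?P (\<lambda>w. H1 w + H2 w) w \<le> ?P H1 w + ?P H2 w"
      using cond_sup_add[OF H] D_pos
      by eventually_elim (simp add: distrib_left[symmetric] mult_left_mono)
  next
    fix H l assume H: "H \<in> Linfty M M" "l \<in> Linfty M FS" "AE w in M. 0 \<le> l w"
    show "AE w in M. ?P (\<lambda>w. l w * H w) w = l w * ?P H w"
      using cond_sup_scale[OF H] by eventually_elim simp
  next
    fix H m assume H: "H \<in> Linfty M M" "m \<in> Linfty M FS"
    show "AE w in M. ?P (\<lambda>w. H w + m w) w = ?P H w + m w"
      using cond_sup_cash[OF H] D_pos by eventually_elim (simp add: field_simps)
  next
    fix H c and Hs :: "nat \<Rightarrow> 'a \<Rightarrow> real"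
    assume Hs: "\<And>n. Hs n \<in> borel_measurable M" "\<And>n. AE w in M. \<bar>Hs n w\<bar> \<le> c"
      "H \<in> Linfty M M" "AE w in M. (\<lambda>n. Hs n w) \<longlonglongrightarrow> H w"
    from cond_sup_Fatou[OF Hs] D_pos
    show "AE w in M. ereal (?P H w) \<le> liminf (\<lambda>n. ereal (?P (Hs n) w))"
    proof eventually_elim
      case (elim w)
      then have "ereal (inverse (D w)) * ereal (cond_sup H w)
          \<le> ereal (inverse (D w)) * liminf (\<lambda>n. ereal (cond_sup (Hs n) w))"
        by (intro ereal_mult_left_mono) auto
      also have "\<dots> = liminf (\<lambda>n. ereal (inverse (D w)) * ereal (cond_sup (Hs n) w))"
        using elim by (intro Liminf_ereal_mult_left[symmetric]) auto
      finally show ?case by simp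
    qed
  qed
qed

end

section \<open>Boundedness and duality for an arbitrary evaluation representing the given
  one\<close>

locale market_representation = market_density M G FS D for M :: "'a measure" and G FS D +
  fixes PG PF :: "('a \<Rightarrow> real) \<Rightarrow> ('a \<Rightarrow> real)"
  assumes PF_coherent: "coherent_evaluation M FS (L1_density M FS D) PF"
    and PG_map: "Linfty_map M (Linfty M G) PG"
    and PG_eq: "\<And>H. H \<in> Linfty M M \<Longrightarrow> AE w in M. PG H w = cond_exp_Q M G D (PF H) w"
begin

sublocale market_evaluation M G FS D PG
proof unfold_locales
  show "coherent_evaluation M G (Linfty M G) PG"
    by (rule evaluation_by_conditioning(1)[OF PF_coherent PG_map PG_eq])
  show "market_consistent M G FS D PG"
    by (rule evaluation_by_conditioning(2)[OF PF_coherent PG_map PG_eq])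
  show "market_local M FS PG"
    by (rule evaluation_by_conditioning(3)[OF PF_coherent PG_map PG_eq])
qed

sublocale F: weighted_coherent_evaluation M FS D PF
  by unfold_locales (rule FS_M D_meas D_int D_pos PF_coherent)+

lemma integral_PG_indicator:
  assumes H: "H \<in> Linfty M M" and B: "B \<in> sets G"
  shows "(\<integral>w. PG H w * indicator B w \<partial>M) = (\<integral>w. D w * PF H w * indicator B w \<partial>M)"
proof -
  have BL: "(indicator B :: 'a \<Rightarrow> real) \<in> Linfty M M"
    by (rule Linfty_indicator[OF sets_FS[OF sets_G[OF B]]])
  have int: "integrable M (real_cond_exp M G (\<lambda>w. D w * PF H w))"
    by (rule G.real_cond_exp_int(1)[OF F.integrable_P[OF H]])
  have "(\<integral>w. PG H w * indicator B w \<partial>M)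
      = (\<integral>w. real_cond_exp M G (\<lambda>w. D w * PF H w) w * indicator B w \<partial>M)"
    using PG_eq[OF H] integrable_Linfty_mult[OF PG_integrable[OF H] BL] integrable_Linfty_mult[OF int BL]
    by (intro integral_cong_AE) (auto simp: cond_exp_Q_def elim!: eventually_mono)
  then show ?thesis
    using G.integral_real_cond_exp_indicator[OF F.integrable_P[OF H] B] by simp
qed

lemma integral_PG:
  assumes H: "H \<in> Linfty M M"
  shows "(\<integral>w. PG H w \<partial>M) = (\<integral>w. D w * PF H w \<partial>M)"
proof -
  have "(\<integral>w. PG H w \<partial>M) = (\<integral>w. real_cond_exp M G (\<lambda>w. D w * PF H w) w \<partial>M)"
    using PG_eq[OF H] PG_integrable[OF H] by (intro integral_cong_AE) (auto simp: cond_exp_Q_def)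
  then show ?thesis using G.real_cond_exp_int(2)[OF F.integrable_P[OF H]] by simp
qed

text \<open>Events of \<open>FS\<close> have to act inside the argument, since \<open>PG\<close> is
  local only over \<open>G\<close>; homogeneity of \<open>PF\<close> then releases them.\<close>

lemma integral_PG_restrict:
  assumes H: "H \<in> Linfty M M" and B: "B \<in> sets FS"
  shows "(\<integral>w. PG (\<lambda>w. indicator B w * H w) w \<partial>M) = (\<integral>w. D w * PF H w * indicator B w \<partial>M)"
proof -
  have BL: "(indicator B :: 'a \<Rightarrow> real) \<in> Linfty M M" by (rule Linfty_indicator[OF sets_FS[OF B]])
  have BH: "(\<lambda>w. indicator B w * H w) \<in> Linfty M M" by (rule Linfty_mult[OF BL H])
  have "(\<integral>w. D w * PF (\<lambda>w. indicator B w * H w) w \<partial>M) = (\<integral>w. D w * PF H w * indicator B w \<partial>M)"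
    using F.P_indicator[OF H B] F.integrable_P[OF BH] integrable_Linfty_mult[OF F.integrable_P[OF H] BL]
    by (intro integral_cong_AE) (auto elim!: eventually_mono)
  then show ?thesis using integral_PG[OF BH] by simp
qed

text \<open>The payoff \<open>c\<close> on an event \<open>B\<close> of \<open>FS\<close> is
  hedgeable, so \<open>market_bounded\<close> bounds the integral of \<open>D * PF J\<close> over
  \<open>B\<close> by that of \<open>D * (K * c)\<close>. As \<open>B\<close> is arbitrary,
  \<open>PF J \<le> K * c\<close>; the lower bound comes from the opposite payoff.\<close>

lemma PF_bounded:
  assumes "market_bounded M G FS D PG" and H: "H \<in> Linfty M M"
  shows "PF H \<in> Linfty M FS"
proof -
  obtain K where K: "\<And>X H. X \<in> Linfty M FS \<Longrightarrow> H \<in> Linfty M M \<Longrightarrow> AE w in M. \<bar>H w\<bar> \<le> X w \<Longrightarrow>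
      AE w in M. PG H w \<le> K * cond_exp_Q M G D X w"
    using assms(1) by (auto simp: market_bounded_def)
  obtain c where c: "AE w in M. \<bar>H w\<bar> \<le> c" using H by (auto simp: Linfty_def)
  have le: "AE w in M. PF J w \<le> K * c" if J: "J \<in> Linfty M M" and Jc: "AE w in M. \<bar>J w\<bar> \<le> c" for J
  proof -
    have "AE w in M. D w * PF J w \<le> D w * (K * c)"
    proof (rule AE_le_if_integral_le[OF FS_M F.integrable_P[OF J] F.DP_meas_A[OF J]])
      fix B assume B: "B \<in> sets FS"
      have BL: "(indicator B :: 'a \<Rightarrow> real) \<in> Linfty M FS" by (rule Linfty_indicator[OF B])
      have BJ: "(\<lambda>w. indicator B w * J w) \<in> Linfty M M" by (rule Linfty_mult[OF Linfty_FS[OF BL] J])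
      let ?X = "\<lambda>w. indicator B w * c"
      have X: "?X \<in> Linfty M FS" by (rule Linfty_mult[OF BL Linfty_const])
      have DX: "integrable M (\<lambda>w. D w * ?X w)" by (rule integrable_Linfty_mult[OF D_int Linfty_FS[OF X]])
      have "AE w in M. \<bar>indicator B w * J w\<bar> \<le> ?X w"
        using Jc by eventually_elim (auto split: split_indicator)
      from K[OF X BJ this]
      have "(\<integral>w. PG (\<lambda>w. indicator B w * J w) w \<partial>M) \<le> (\<integral>w. K * cond_exp_Q M G D ?X w \<partial>M)"
        using G.real_cond_exp_int(1)[OF DX] PG_integrable[OF BJ]
        by (intro integral_mono_AE) (auto simp: cond_exp_Q_def)
      also have "\<dots> = K * (\<integral>w. D w * ?X w \<partial>M)"
        using G.real_cond_exp_int(2)[OF DX] by (simp add: cond_exp_Q_def)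
      also have "\<dots> = (\<integral>w. K * (D w * ?X w) \<partial>M)" by simp
      also have "\<dots> = (\<integral>w. D w * (K * c) * indicator B w \<partial>M)"
        by (rule Bochner_Integration.integral_cong) (simp_all add: ac_simps)
      finally show "(\<integral>w. D w * PF J w * indicator B w \<partial>M) \<le> (\<integral>w. D w * (K * c) * indicator B w \<partial>M)"
        using integral_PG_restrict[OF J B] by simp
    qed (use D_int D_meas in auto)
    with D_pos show ?thesis by eventually_elim simp
  qed
  have "AE w in M. \<bar>- H w\<bar> \<le> c" using c by simp
  from le[OF H c] le[OF Linfty_minus[OF H] this] F.P_minus[OF H]
  have "AE w in M. \<bar>PF H w\<bar> \<le> K * c" by eventually_elim (simp add: abs_le_iff)
  then show ?thesis by (rule LinftyI[OF F.P_meas_A[OF H]])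
qed

text \<open>Boundedness of single values becomes uniform over the unit ball through
  \<open>near_maximum\<close>, and homogeneity over \<open>FS\<close> transfers the bound from
  \<open>H / X\<close> to \<open>H\<close>.\<close>

lemma market_bounded_if_PF_bounded:
  assumes bdd: "\<And>H. H \<in> Linfty M M \<Longrightarrow> PF H \<in> Linfty M FS"
  shows "market_bounded M G FS D PG"
proof -
  have "\<exists>K. \<forall>h\<in>Linfty M M. (AE w in M. \<bar>h w\<bar> \<le> 1) \<longrightarrow> (AE w in M. PF h w \<le> K)"
  proof (rule ccontr)
    assume "\<not> ?thesis"
    then have "\<forall>n::nat. \<exists>h. h \<in> Linfty M M \<and> (AE w in M. \<bar>h w\<bar> \<le> 1) \<and> \<not> (AE w in M. PF h w \<le> real n)"
      by blast
    from choice[OF this] obtain h where h: "\<And>n. h n \<in> Linfty M M" "\<And>n. AE w in M. \<bar>h n w\<bar> \<le> 1"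
      "\<And>n. \<not> (AE w in M. PF (h n) w \<le> real n)" by blast
    have h_meas: "h n \<in> borel_measurable M" for n using h(1) by (simp add: Linfty_def)
    obtain H where H: "H \<in> borel_measurable M" "AE w in M. \<bar>H w\<bar> \<le> 1"
      "\<And>n. AE w in M. PF (h n) w \<le> PF H w + 1"
      using F.near_maximum[of h, OF h_meas h(2)] by blast
    obtain c where c: "AE w in M. \<bar>PF H w\<bar> \<le> c"
      using bdd[OF LinftyI[OF H(1,2)]] by (auto simp: Linfty_def)
    obtain n :: nat where n: "c + 1 \<le> real n" using real_arch_simple by blast
    from H(3)[of n] c have "AE w in M. PF (h n) w \<le> real n"
      by eventually_elim (use n in linarith)
    with h(3) show False by blast
  qed
  then obtain K where K: "\<And>h. h \<in> Linfty M M \<Longrightarrow> AE w in M. \<bar>h w\<bar> \<le> 1 \<Longrightarrow> AE w in M. PF h w \<le> K"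
    by blast
  show ?thesis
    unfolding market_bounded_def
  proof (intro exI[of _ K] ballI impI)
    fix X H assume X: "X \<in> Linfty M FS" and H: "H \<in> Linfty M M" and HX: "AE w in M. \<bar>H w\<bar> \<le> X w"
    have XM: "X \<in> Linfty M M" by (rule Linfty_FS[OF X])
    have X_nn: "AE w in M. 0 \<le> X w" using HX by eventually_elim linarith
    \<comment> \<open>Where \<open>X\<close> vanishes so does \<open>H\<close>, and division by zero
      gives \<open>h = 0\<close>; hence \<open>H = X * h\<close> holds there as well.\<close>
    define h where "h w = H w / X w" for w
    have h1: "AE w in M. \<bar>h w\<bar> \<le> 1"
      using HX by eventually_elim (auto simp: h_def abs_divide divide_le_eq)
    have "h \<in> borel_measurable M" unfolding h_def using H XM by (auto simp: Linfty_def)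
    then have hL: "h \<in> Linfty M M" using h1 by (rule LinftyI)
    have "AE w in M. H w = X w * h w" using HX by eventually_elim (auto simp: h_def)
    from F.P_cong[OF H Linfty_mult[OF XM hL] this] F.P_scale[OF hL X X_nn] K[OF hL h1] X_nn D_pos
    have "AE w in M. D w * PF H w \<le> K * (D w * X w)"
    proof eventually_elim
      case (elim w)
      have "(D w * X w) * PF h w \<le> (D w * X w) * K"
        using elim by (intro mult_left_mono) auto
      then show ?case using elim(1,2) by (simp add: ac_simps)
    qed
    moreover have DX: "integrable M (\<lambda>w. D w * X w)" by (rule integrable_Linfty_mult[OF D_int XM])
    ultimately have "AE w in M. real_cond_exp M G (\<lambda>w. D w * PF H w) w
        \<le> real_cond_exp M G (\<lambda>w. K * (D w * X w)) w"
      using F.integrable_P[OF H] by (intro G.real_cond_exp_mono) auto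
    with G.real_cond_exp_cmult[OF DX, of K] PG_eq[OF H]
    show "AE w in M. PG H w \<le> K * cond_exp_Q M G D X w"
      unfolding cond_exp_Q_def by eventually_elim simp
  qed
qed

lemma dual_set_eq: "dual_set M G PG = E.dual_densities"
proof (intro set_eqI iffI)
  show "\<xi> \<in> E.dual_densities" if "\<xi> \<in> dual_set M G PG" for \<xi>
    using that by (simp add: dual_set_def cond_densities_def E.dual_densities_def)
  show "\<xi> \<in> dual_set M G PG" if "\<xi> \<in> E.dual_densities" for \<xi>
    using E.dual_densities_cond_exp[OF that] that
    by (simp add: dual_set_def cond_densities_def E.dual_densities_def)
qed

text \<open>Integrated over events, both sets describe the same inequalities: from \<open>PG\<close>
  to \<open>PF\<close> by inserting an event of \<open>FS\<close> into the payoff, and back because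
  events of \<open>G\<close> belong to \<open>FS\<close>.\<close>

lemma dual_densities_eq: "E.dual_densities = F.dual_densities"
proof (intro set_eqI iffI)
  fix \<xi> assume \<xi>: "\<xi> \<in> E.dual_densities"
  show "\<xi> \<in> F.dual_densities"
  proof (rule F.dual_densitiesI[OF E.dual_densities_integrable[OF \<xi>]])
    fix H B assume H: "H \<in> Linfty M M" and B: "B \<in> sets FS"
    have BH: "(\<lambda>w. indicator B w * H w) \<in> Linfty M M"
      by (intro Linfty_mult[OF Linfty_indicator H] sets_FS B)
    have "(\<integral>w. \<xi> w * H w * indicator B w \<partial>M) = (\<integral>w. \<xi> w * (indicator B w * H w) \<partial>M)"
      by (simp add: ac_simps)
    also have "\<dots> \<le> (\<integral>w. D w * PF H w * indicator B w \<partial>M)"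
      using dual_integral_le[OF \<xi> BH] integral_PG_restrict[OF H B] by simp
    finally show "(\<integral>w. \<xi> w * H w * indicator B w \<partial>M) \<le> (\<integral>w. D w * PF H w * indicator B w \<partial>M)" .
  qed
next
  fix \<xi> assume \<xi>: "\<xi> \<in> F.dual_densities"
  show "\<xi> \<in> E.dual_densities"
  proof (rule E.dual_densitiesI[OF F.dual_densities_integrable[OF \<xi>]])
    fix H B assume H: "H \<in> Linfty M M" and B: "B \<in> sets G"
    show "(\<integral>w. \<xi> w * H w * indicator B w \<partial>M) \<le> (\<integral>w. 1 * PG H w * indicator B w \<partial>M)"
      using F.dual_densities_integral_le[OF \<xi> H sets_G[OF B]] integral_PG_indicator[OF H B] by simp
  qed
qed

lemma represented_by_dual_set: "represented_by M G (dual_set M G PG) PG"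
  using E.is_ess_sup_dual_densities by (simp add: represented_by_def dual_set_eq)

lemma D_inverse: "(\<lambda>w. inverse (D w)) \<in> borel_measurable FS" "AE w in M. 0 \<le> inverse (D w)"
proof -
  show "(\<lambda>w. inverse (D w)) \<in> borel_measurable FS" using D_meas by measurable
  show "AE w in M. 0 \<le> inverse (D w)" using D_pos by eventually_elim simp
qed

lemma cond_exp_rescaled:
  assumes "f \<in> borel_measurable M"
  shows "AE w in M. real_cond_exp M FS (\<lambda>w. inverse (D w) * f w) w = inverse (D w) * real_cond_exp M FS f w"
  by (rule FS.real_cond_exp_mult_nonneg[OF D_inverse(1) assms D_inverse(2)])

text \<open>Multiplication by the positive \<open>D\<close> turns the claim into the duality theorem
  for \<open>PF\<close>, whose dual densities are those of \<open>PG\<close>.\<close>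

lemma represented_by_rescaled_dual_set: "represented_by M FS (rescaled_dual_set M G D PG) PF"
  unfolding represented_by_def is_ess_sup_def
proof (intro ballI conjI impI)
  fix H assume H: "H \<in> Linfty M M"
  show "PF H \<in> borel_measurable M" by (rule F.P_meas[OF H])
  let ?X = "(\<lambda>\<xi>. real_cond_exp M FS (\<lambda>w. \<xi> w * H w)) ` rescaled_dual_set M G D PG"
  have resc: "AE w in M. real_cond_exp M FS (\<lambda>w. inverse (D w) * \<xi> w * H w) w
      = inverse (D w) * real_cond_exp M FS (\<lambda>w. \<xi> w * H w) w"
    if \<xi>: "\<xi> \<in> F.dual_densities" for \<xi>
    using cond_exp_rescaled[OF borel_measurable_integrable[OF
        integrable_Linfty_mult[OF F.dual_densities_integrable[OF \<xi>] H]]]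
    by (simp add: mult.assoc)
  show "AE w in M. f w \<le> PF H w" if f: "f \<in> ?X" for f
  proof -
    obtain \<xi> where \<xi>: "\<xi> \<in> F.dual_densities"
      and f_eq: "f = real_cond_exp M FS (\<lambda>w. inverse (D w) * \<xi> w * H w)"
      using f by (auto simp: rescaled_dual_set_def dual_set_eq dual_densities_eq)
    from resc[OF \<xi>] F.dual_densities_le[OF \<xi> H] D_pos show ?thesis
      unfolding f_eq
    proof eventually_elim
      case (elim w)
      have "inverse (D w) * real_cond_exp M FS (\<lambda>w. \<xi> w * H w) w \<le> inverse (D w) * (D w * PF H w)"
        using elim(2,3) by (intro mult_left_mono) auto
      moreover have "inverse (D w) * (D w * PF H w) = PF H w"
        using elim(3) by (simp add: mult.assoc[symmetric])
      ultimately show ?case using elim(1) by linarith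
    qed
  qed
  fix U assume U: "U \<in> borel_measurable M" "\<forall>f\<in>?X. AE w in M. f w \<le> U w"
  have "AE w in M. D w * PF H w \<le> D w * U w"
  proof -
    have meas: "(\<lambda>w. D w * U w) \<in> borel_measurable M" using D_int U(1) by auto
    have "AE w in M. real_cond_exp M FS (\<lambda>w. \<xi> w * H w) w \<le> D w * U w"
      if \<xi>: "\<xi> \<in> F.dual_densities" for \<xi>
    proof -
      have "(\<lambda>w. inverse (D w) * \<xi> w) \<in> rescaled_dual_set M G D PG"
        using \<xi> by (auto simp: rescaled_dual_set_def dual_set_eq dual_densities_eq)
      from U(2)[rule_format, OF imageI[OF this]] resc[OF \<xi>] D_pos show ?thesis
      proof eventually_elim
        case (elim w)
        have "D w * (inverse (D w) * real_cond_exp M FS (\<lambda>w. \<xi> w * H w) w) \<le> D w * U w"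
          unfolding elim(2)[symmetric] using elim(1,3) by (intro mult_left_mono) auto
        then show ?case using elim(3) by (simp add: mult.assoc[symmetric])
      qed
    qed
    then show ?thesis
      using F.is_ess_sup_dual_densities[OF H] meas by (auto simp: is_ess_sup_def)
  qed
  with D_pos show "AE w in M. PF H w \<le> U w" by eventually_elim simp
qed

lemma cond_exp_rescaled_dual_set:
  assumes "Z \<in> rescaled_dual_set M G D PG"
  shows "AE w in M. real_cond_exp M FS Z w = 1"
proof -
  obtain \<xi> where \<xi>: "\<xi> \<in> F.dual_densities" and Z: "Z = (\<lambda>w. inverse (D w) * \<xi> w)"
    using assms by (auto simp: rescaled_dual_set_def dual_set_eq dual_densities_eq)
  from cond_exp_rescaled[OF borel_measurable_integrable[OF F.dual_densities_integrable[OF \<xi>]]]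
    F.dual_densities_cond_exp[OF \<xi>] D_pos
  show ?thesis unfolding Z by eventually_elim simp
qed

text \<open>Testing with \<open>sgn \<circ> \<xi>\<close> bounds the conditional expectation of \<open>\<bar>\<xi>\<bar>\<close> by a multiple of \<open>D\<close>; the
  truncations \<open>min n (inverse D)\<close> avoid conditioning the possibly non-integrable \<open>\<bar>\<xi>\<bar> / D\<close>.\<close>

lemma integrable_rescaled:
  assumes bdd: "\<And>H. H \<in> Linfty M M \<Longrightarrow> PF H \<in> Linfty M FS" and \<xi>: "\<xi> \<in> F.dual_densities"
  shows "integrable M (\<lambda>w. inverse (D w) * \<xi> w)"
proof -
  have \<xi>_int: "integrable M \<xi>" by (rule F.dual_densities_integrable[OF \<xi>])
  have [measurable]: "\<xi> \<in> borel_measurable M" "D \<in> borel_measurable M" using \<xi>_int D_int by auto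
  note [measurable] = D_meas
  let ?s = "\<lambda>w. sgn (\<xi> w)"
  have sL: "?s \<in> Linfty M M"
    by (rule LinftyI[where c=1]) (auto simp: sgn_if)
  obtain c where c: "AE w in M. \<bar>PF ?s w\<bar> \<le> c" using bdd[OF sL] by (auto simp: Linfty_def)
  have abs_eq: "(\<lambda>w. \<xi> w * ?s w) = (\<lambda>w. \<bar>\<xi> w\<bar>)" by (simp add: abs_sgn)
  have le: "AE w in M. real_cond_exp M FS (\<lambda>w. \<bar>\<xi> w\<bar>) w \<le> D w * c"
    using F.dual_densities_le[OF \<xi> sL] c D_pos unfolding abs_eq
  proof eventually_elim
    case (elim w)
    have "D w * PF ?s w \<le> D w * c" using elim(2,3) by (intro mult_left_mono) auto
    then show ?case using elim(1) by simp
  qed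
  \<comment> \<open>The maximum with 0 keeps \<open>t n\<close> nonnegative even on the null set
    where \<open>D\<close> is not positive.\<close>
  define t where "t n w = max 0 (min (real n) (inverse (D w)))" for n w
  have t_meas [measurable]: "t n \<in> borel_measurable FS" "t n \<in> borel_measurable M" for n
    unfolding t_def by measurable
  have t_nn: "0 \<le> t n w" and t_le: "t n w \<le> real n" for n w by (auto simp: t_def)
  have tL: "t n \<in> Linfty M M" for n
    by (rule LinftyI[where c="real n"]) (use t_nn t_le in auto)
  have int: "integrable M (\<lambda>w. t n w * \<bar>\<xi> w\<bar>)" for n
    using integrable_Linfty_mult[OF integrable_abs[OF \<xi>_int] tL] by (simp add: mult.commute)
  have bound: "(\<integral>w. t n w * \<bar>\<xi> w\<bar> \<partial>M) \<le> \<bar>c\<bar>" for n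
  proof -
    \<comment> \<open>Since \<open>t n\<close> is measurable in \<open>FS\<close>,
      \<open>\<bar>\<xi>\<bar>\<close> may be replaced by its conditional expectation; then
      \<open>t n * D \<le> 1\<close> yields a bound free of \<open>n\<close>.\<close>
    have "(\<integral>w. t n w * \<bar>\<xi> w\<bar> \<partial>M) = (\<integral>w. t n w * real_cond_exp M FS (\<lambda>w. \<bar>\<xi> w\<bar>) w \<partial>M)"
      by (rule FS.real_cond_exp_intg(2)[symmetric, OF int]) measurable
    also have "\<dots> \<le> (\<integral>w. \<bar>c\<bar> \<partial>M)"
    proof (rule integral_mono_AE)
      show "AE w in M. t n w * real_cond_exp M FS (\<lambda>w. \<bar>\<xi> w\<bar>) w \<le> \<bar>c\<bar>"
        using le D_pos
      proof eventually_elim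
        case (elim w)
        have "t n w * real_cond_exp M FS (\<lambda>w. \<bar>\<xi> w\<bar>) w \<le> t n w * (D w * c)"
          using elim t_nn by (intro mult_left_mono) auto
        also have "\<dots> \<le> t n w * D w * \<bar>c\<bar>"
          using elim t_nn[of n w] by (simp add: mult.assoc mult_left_mono)
        also have "\<dots> \<le> 1 * \<bar>c\<bar>"
        proof (rule mult_right_mono)
          have "t n w * D w \<le> inverse (D w) * D w"
            using elim by (intro mult_right_mono) (auto simp: t_def)
          then show "t n w * D w \<le> 1" using elim by simp
        qed simp
        finally show ?case by simp
      qed
      show "integrable M (\<lambda>w. t n w * real_cond_exp M FS (\<lambda>w. \<bar>\<xi> w\<bar>) w)"
        by (rule FS.real_cond_exp_intg(1)[OF int]) measurable
    qed simp
    finally show ?thesis by (simp add: prob_space)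
  qed
  have "(\<integral>\<^sup>+w. ennreal (norm (inverse (D w) * \<xi> w)) \<partial>M)
      \<le> (\<integral>\<^sup>+w. liminf (\<lambda>n. ennreal (t n w * \<bar>\<xi> w\<bar>)) \<partial>M)"
  proof (rule nn_integral_mono_AE)
    show "AE w in M. ennreal (norm (inverse (D w) * \<xi> w)) \<le> liminf (\<lambda>n. ennreal (t n w * \<bar>\<xi> w\<bar>))"
      using D_pos
    proof eventually_elim
      case (elim w)
      obtain N :: nat where N: "inverse (D w) \<le> real N" using real_arch_simple by blast
      have "\<forall>\<^sub>F n in sequentially. ennreal (norm (inverse (D w) * \<xi> w)) \<le> ennreal (t n w * \<bar>\<xi> w\<bar>)"
        unfolding eventually_sequentially
      proof (intro exI[of _ N] allI impI)
        fix n assume "N \<le> n"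
        then have "inverse (D w) \<le> real n" using N by linarith
        then have "t n w = inverse (D w)" using elim by (simp add: t_def)
        then show "ennreal (norm (inverse (D w) * \<xi> w)) \<le> ennreal (t n w * \<bar>\<xi> w\<bar>)"
          using elim by (simp add: abs_mult)
      qed
      then show ?case by (rule Liminf_bounded)
    qed
  qed
  also have "\<dots> \<le> liminf (\<lambda>n. \<integral>\<^sup>+w. ennreal (t n w * \<bar>\<xi> w\<bar>) \<partial>M)"
    by (rule nn_integral_liminf) measurable
  also have "\<dots> \<le> liminf (\<lambda>n. ennreal \<bar>c\<bar>)"
  proof (rule Liminf_mono, rule always_eventually, rule allI)
    show "(\<integral>\<^sup>+w. ennreal (t n w * \<bar>\<xi> w\<bar>) \<partial>M) \<le> ennreal \<bar>c\<bar>" for n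
      using bound[of n] t_nn by (subst nn_integral_eq_integral[OF int]) (auto intro: ennreal_leI)
  qed
  finally have "(\<integral>\<^sup>+w. ennreal (norm (inverse (D w) * \<xi> w)) \<partial>M) < \<infinity>"
    by (simp add: Liminf_const le_less_trans)
  then show ?thesis by (intro integrableI_bounded) measurable
qed

lemma rescaled_dual_set_subset:
  assumes bdd: "\<And>H. H \<in> Linfty M M \<Longrightarrow> PF H \<in> Linfty M FS"
  shows "rescaled_dual_set M G D PG \<subseteq> cond_densities M FS"
proof
  fix Z assume Z: "Z \<in> rescaled_dual_set M G D PG"
  then obtain \<xi> where "\<xi> \<in> F.dual_densities" "Z = (\<lambda>w. inverse (D w) * \<xi> w)"
    by (auto simp: rescaled_dual_set_def dual_set_eq dual_densities_eq)
  with integrable_rescaled[OF bdd] cond_exp_rescaled_dual_set[OF Z] show "Z \<in> cond_densities M FS"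
    by (simp add: cond_densities_def)
qed

end

section \<open>The concrete market and the equivalences\<close>

lemma market_density_if_complete_market:
  assumes "prob_space M" and G: "subalgebra M G" and market: "complete_market M G I S D"
  shows "market_density M G (market_algebra M G S I) D"
proof -
  interpret prob_space M by fact
  let ?C = "sets G \<union> {S t -` B \<inter> space M | t B. t \<in> I \<and> B \<in> sets borel}"
  let ?FS = "market_algebra M G S I"
  have S: "S t \<in> borel_measurable M" if "t \<in> I" for t using market that by (simp add: complete_market_def)
  have C: "?C \<subseteq> sets M" using G measurable_sets[OF S] by (auto simp: subalgebra_def)
  then have C': "?C \<subseteq> Pow (space M)" using sets.sets_into_space by blast
  have sets: "sets ?FS = sigma_sets (space M) ?C" and space: "space ?FS = space M"
    using C' by (simp_all add: market_algebra_def sets_measure_of space_measure_of)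
  have density: "martingale_density M G I S D" and pos: "AE w in M. 0 < D w"
    using market by (auto simp: complete_market_def)
  show ?thesis
  proof
    show "subalgebra M ?FS"
      using sets.sigma_sets_subset[OF C] by (simp add: subalgebra_def sets space)
    show "subalgebra ?FS G"
      using G by (auto simp: subalgebra_def sets space intro: sigma_sets.Basic)
  qed (use density pos in \<open>auto simp: martingale_density_def pos_cond_densities_def cond_densities_def\<close>)
qed

theorem theorem3p10:
  fixes M G FS :: "'a measure"
    and I :: "real set"
    and S :: "real \<Rightarrow> 'a \<Rightarrow> real ^ 'n"
    and D :: "'a \<Rightarrow> real"
    and PG :: "('a \<Rightarrow> real) \<Rightarrow> ('a \<Rightarrow> real)"
  assumes "prob_space M"
    and "subalgebra M G"
    and "FS = market_algebra M G S I"
    and "complete_market M G I S D"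
    and "Linfty_map M (Linfty M G) PG"
  shows "((coherent_evaluation M G (Linfty M G) PG \<and> market_consistent M G FS D PG \<and>
           market_local M FS PG \<and> market_bounded M G FS D PG)
          \<longleftrightarrow>
          (\<exists>PF. coherent_evaluation M FS (Linfty M FS) PF \<and>
                (\<forall>H \<in> Linfty M M. AE \<omega> in M. PG H \<omega> = cond_exp_Q M G D (PF H) \<omega>)))
       \<and>
         ((coherent_evaluation M G (Linfty M G) PG \<and> market_consistent M G FS D PG \<and>
           market_local M FS PG)
          \<longleftrightarrow>
          (\<exists>PF. coherent_evaluation M FS (L1_density M FS D) PF \<and>
                (\<forall>H \<in> Linfty M M. AE \<omega> in M. PG H \<omega> = cond_exp_Q M G D (PF H) \<omega>)))
       \<and>
         (\<forall>PF. coherent_evaluation M FS (L1_density M FS D) PF \<and>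
               (\<forall>H \<in> Linfty M M. AE \<omega> in M. PG H \<omega> = cond_exp_Q M G D (PF H) \<omega>)
          \<longrightarrow>
            L1_closed_convex M (dual_set M G PG) \<and>
            represented_by M G (dual_set M G PG) PG \<and>
            represented_by M FS (rescaled_dual_set M G D PG) PF \<and>
            (\<forall>Z \<in> rescaled_dual_set M G D PG. AE \<omega> in M. real_cond_exp M FS Z \<omega> = 1) \<and>
            ((\<forall>H \<in> Linfty M M. PF H \<in> Linfty M FS) \<longrightarrow>
               rescaled_dual_set M G D PG \<subseteq> cond_densities M FS))"
    (is "(?i \<and> _ \<and> _ \<and> ?bounded \<longleftrightarrow> ?ii_bounded) \<and> (_ \<longleftrightarrow> ?ii) \<and> ?dual")
proof -
  interpret market_density M G FS D
    unfolding assms(3) by (rule market_density_if_complete_market[OF assms(1,2,4)])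
  have repr: "market_representation M G FS D PG PF"
    if "coherent_evaluation M FS (L1_density M FS D) PF"
      "\<forall>H \<in> Linfty M M. AE w in M. PG H w = cond_exp_Q M G D (PF H) w" for PF
    by unfold_locales (use that assms(5) in auto)
  \<comment> \<open>Bounded values are in particular integrable against \<open>D\<close>, so the
    case of values in \<open>Linfty\<close> reduces to the general one.\<close>
  have L1: "coherent_evaluation M FS (L1_density M FS D) PF"
    if "coherent_evaluation M FS (Linfty M FS) PF" for PF
  proof (rule coherent_evaluation_change_codomain[OF that])
    show "PF H \<in> L1_density M FS D" if "H \<in> Linfty M M" for H
      using that \<open>coherent_evaluation M FS (Linfty M FS) PF\<close> Linfty_L1_density
      by (auto simp: coherent_evaluation_def cond_evaluation_def Linfty_map_def)
  qed
  have exists: "?ii" if "?i" "market_consistent M G FS D PG" "market_local M FS PG"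
  proof -
    interpret market_evaluation M G FS D PG
      by unfold_locales (rule that)+
    show ?thesis by (rule exists_market_conditional_evaluation)
  qed
  have props: "?i \<and> market_consistent M G FS D PG \<and> market_local M FS PG" if PF: "?ii"
    using PF evaluation_by_conditioning[OF _ assms(5)] by blast
  \<comment> \<open>The same \<open>PF\<close> is kept; boundedness only shrinks its
    codomain.\<close>
  have to_bounded: "?ii_bounded" if ?ii and bounded: ?bounded
  proof -
    obtain PF where PF: "coherent_evaluation M FS (L1_density M FS D) PF"
      "\<forall>H \<in> Linfty M M. AE w in M. PG H w = cond_exp_Q M G D (PF H) w"
      using \<open>?ii\<close> by blast
    interpret market_representation M G FS D PG PF by (rule repr[OF PF])
    have "coherent_evaluation M FS (Linfty M FS) PF"
      by (rule coherent_evaluation_change_codomain[OF PF(1) PF_bounded[OF bounded]])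
    with PF(2) show ?thesis by blast
  qed
  have from_bounded: "?ii \<and> ?bounded" if ?ii_bounded
  proof -
    obtain PF where PF: "coherent_evaluation M FS (Linfty M FS) PF"
      "\<forall>H \<in> Linfty M M. AE w in M. PG H w = cond_exp_Q M G D (PF H) w"
      using \<open>?ii_bounded\<close> by blast
    interpret market_representation M G FS D PG PF by (rule repr[OF L1[OF PF(1)] PF(2)])
    have "PF H \<in> Linfty M FS" if "H \<in> Linfty M M" for H
      using PF(1) that by (simp add: coherent_evaluation_def cond_evaluation_def Linfty_map_def)
    then have ?bounded by (rule market_bounded_if_PF_bounded)
    then show ?thesis using PF_coherent PF(2) by blast
  qed
  \<comment> \<open>Here \<open>PF\<close> is arbitrary: the representation holds for every
    evaluation satisfying the formula, not just for the constructed one.\<close>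
  have ?dual
  proof (intro allI impI)
    fix PF
    assume PF: "coherent_evaluation M FS (L1_density M FS D) PF \<and>
      (\<forall>H \<in> Linfty M M. AE w in M. PG H w = cond_exp_Q M G D (PF H) w)"
    interpret market_representation M G FS D PG PF
      by (rule repr[OF PF[THEN conjunct1] PF[THEN conjunct2]])
    show "L1_closed_convex M (dual_set M G PG) \<and>
      represented_by M G (dual_set M G PG) PG \<and>
      represented_by M FS (rescaled_dual_set M G D PG) PF \<and>
      (\<forall>Z \<in> rescaled_dual_set M G D PG. AE w in M. real_cond_exp M FS Z w = 1) \<and>
      ((\<forall>H \<in> Linfty M M. PF H \<in> Linfty M FS) \<longrightarrow>
         rescaled_dual_set M G D PG \<subseteq> cond_densities M FS)"
      using E.L1_closed_convex_dual_densities[folded dual_set_eq] represented_by_dual_set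
        represented_by_rescaled_dual_set cond_exp_rescaled_dual_set rescaled_dual_set_subset by blast
  qed
  moreover have "?i \<and> market_consistent M G FS D PG \<and> market_local M FS PG \<longleftrightarrow> ?ii"
    using exists props by blast
  moreover have "?i \<and> market_consistent M G FS D PG \<and> market_local M FS PG \<and> ?bounded \<longleftrightarrow> ?ii_bounded"
    using exists props to_bounded from_bounded by blast
  ultimately show ?thesis by blast
qed

end
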